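(* The set $\{\gamma_1/\gamma_2 : \gamma_1,\gamma_2 \text{ Gaussian primes}\}$ is dense in $\mathbb{C}$.
   Context: A Gaussian prime is a prime element of the ring $\mathbb{Z}[i]=\{a+bi : a,b\in\mathbb{Z}\}$ of Gaussian integers. Equivalently, a nonzero Gaussian integer is prime if and only if it is of the form $\pm p$ or $\pm pi$ with $p$ a rational prime satisfying $p\equiv 3 \pmod 4$, or it is of the form $a+bi$ with $a^2+b^2$ a rational prime. *)

theory Defs
  imports "HOL-Analysis.Analysis"
begin

definition gauss_ints :: "complex set" where
  "gauss_ints = {z. Re z \<in> \<int> \<and> Im z \<in> \<int>}"

definition gdvd :: "complex \<Rightarrow> complex \<Rightarrow> bool" where
  "gdvd a b \<longleftrightarrow> (\<exists>c\<in>gauss_ints. b = a * c)"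

definition gauss_unit :: "complex \<Rightarrow> bool" where
  "gauss_unit u \<longleftrightarrow> u \<in> gauss_ints \<and> gdvd u 1"

definition gauss_prime :: "complex \<Rightarrow> bool" where
  "gauss_prime p \<longleftrightarrow> p \<in> gauss_ints \<and> p \<noteq> 0 \<and> \<not> gauss_unit p \<and>
     (\<forall>a\<in>gauss_ints. \<forall>b\<in>gauss_ints. gdvd p (a * b) \<longrightarrow> gdvd p a \<or> gdvd p b)"

end

(* Write N for the norm on the Gaussian integers. For k in Z the Hecke character
   z \<mapsto> (z / |z|)^(4k) has an L-function L_k(s), the sum of (z / |z|)^(4k) N(z)^(-s) over z \<noteq> 0.

   Continuation: if alpha is a Gaussian integer with residue system R, then
   (1 - |R| hecke(alpha)) L_k is, up to finitely many terms, the sum over w and r of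
   hecke(alpha w + r) - hecke(alpha w), which converges for Re s > 1/2. For (k, t) \<noteq> (0, 0) one of
   alpha = 1+i, 2+i, 2-i makes the factor nonzero at s = 1 + it; at (0, 0) it has a simple zero.
   Together with the 3-4-1 inequality this shows that the sum P_k(s) of log N(p) hecke(p) over the
   Gaussian primes is bounded near every point 1 + it, except for the simple pole of P_0 at s = 1.

   Density: let Psi be a trigonometric polynomial in the angle whose coefficients are Fourier
   integrals over [0, 1] in log |z|, with positive mean, and Psi \<le> 0 away from the units. If no
   quotient p/q were close to a unit multiple of z0, then the sum of w(p) w(q) Psi(p / (q z0)) with
   weights w(p) = log N(p) N(p)^(-1-y) would be \<le> 0. But this sum is a combination of integrals of
   |P_k(1 + y + i t)|^2 over compact ranges of t, and as y \<rightarrow> 0 only the pole contributes an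
   unbounded, positive amount. No Tauberian theorem is needed. *)

theory Submission
  imports Defs "HOL-Complex_Analysis.Complex_Analysis"
begin

section \<open>Arithmetic of the Gaussian integers\<close>

text \<open>The exponent 4k makes the characters blind to units. Nothing is lost: a unit times a
  prime is again a prime, so it suffices to approximate z0 up to a unit. Bounded frequencies keep
  the analysis elementary: P_k is only known to be bounded near each point of the line, without
  control as t grows, and compactness turns this into one bound for each k on the range in use.
  Likewise a trigonometric polynomial in the angle involves only finitely many k. A single alpha
  cannot give the continuation, because its factor vanishes along an arithmetic progression of t on
  Re s = 1. The pole wins because |P_0|^2 has size y^(-2) on a range of t of length about y, which
  contributes the order 1/y, while the remaining terms are bounded below by a constant. Between that
  range and the region where P_0 is bounded only the positivity of the coefficient is used, so no
  upper bound near the pole is needed. The condition on Psi is one-sided: it may be very negative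
  away from the units, which is why an explicit kernel of compact Fourier support is
  available.\<close>

lemma gauss_ints_arith [simp, intro]:
  "0 \<in> gauss_ints" "1 \<in> gauss_ints" "\<i> \<in> gauss_ints" "-1 \<in> gauss_ints"
  "a \<in> gauss_ints \<Longrightarrow> b \<in> gauss_ints \<Longrightarrow> a + b \<in> gauss_ints"
  "a \<in> gauss_ints \<Longrightarrow> b \<in> gauss_ints \<Longrightarrow> a - b \<in> gauss_ints"
  "a \<in> gauss_ints \<Longrightarrow> b \<in> gauss_ints \<Longrightarrow> a * b \<in> gauss_ints"
  "a \<in> gauss_ints \<Longrightarrow> - a \<in> gauss_ints"
  "a \<in> gauss_ints \<Longrightarrow> cnj a \<in> gauss_ints"
  by (auto simp: gauss_ints_def)

lemma gauss_ints_power [simp, intro]: "a \<in> gauss_ints \<Longrightarrow> a ^ n \<in> gauss_ints"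
  by (induction n) auto

lemma gauss_ints_Complex [simp, intro]: "Complex (of_int a) (of_int b) \<in> gauss_ints"
  by (auto simp: gauss_ints_def)

lemma gauss_intsE:
  assumes "z \<in> gauss_ints"
  obtains a b :: int where "z = Complex (of_int a) (of_int b)"
  using assms by (auto simp: gauss_ints_def Ints_def complex_eq_iff)

lemma cmod_gauss_int_sq:
  "(cmod (Complex (of_int a) (of_int b)))\<^sup>2 = of_int (a\<^sup>2 + b\<^sup>2)"
  by (simp add: cmod_def)

lemma gauss_int_norm_sq_Ints: "z \<in> gauss_ints \<Longrightarrow> (norm z)\<^sup>2 \<in> \<int>"
  by (auto elim!: gauss_intsE simp: cmod_gauss_int_sq)

lemma gauss_int_norm_ge_1:
  assumes "z \<in> gauss_ints" "z \<noteq> 0"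
  shows "norm z \<ge> 1"
proof -
  obtain n where n: "(norm z)\<^sup>2 = of_int n"
    using gauss_int_norm_sq_Ints[OF assms(1)] by (auto simp: Ints_def)
  have "(norm z)\<^sup>2 > 0" using assms by simp
  then have "n \<ge> 1" using n by simp
  then have "(norm z)\<^sup>2 \<ge> 1\<^sup>2" using n by simp
  then show ?thesis using power2_le_imp_le norm_ge_zero by blast
qed

lemma finite_gauss_ints_norm_le: "finite {z \<in> gauss_ints. norm z \<le> B}"
proof -
  have "{z \<in> gauss_ints. norm z \<le> B} \<subseteq>
    (\<lambda>(a, b). Complex (of_int a) (of_int b)) ` ({-\<lceil>B\<rceil>..\<lceil>B\<rceil>} \<times> {-\<lceil>B\<rceil>..\<lceil>B\<rceil>})"
  proof
    fix z assume z: "z \<in> {z \<in> gauss_ints. norm z \<le> B}"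
    then obtain a b where ab: "z = Complex (of_int a) (of_int b)" by (auto elim: gauss_intsE)
    have "\<bar>of_int a\<bar> \<le> B" "\<bar>of_int b\<bar> \<le> B"
      using z ab abs_Re_le_cmod[of z] abs_Im_le_cmod[of z] by auto
    then have "a \<in> {-\<lceil>B\<rceil>..\<lceil>B\<rceil>}" "b \<in> {-\<lceil>B\<rceil>..\<lceil>B\<rceil>}" by (auto, linarith+)
    then show "z \<in> (\<lambda>(a, b). Complex (of_int a) (of_int b)) ` ({-\<lceil>B\<rceil>..\<lceil>B\<rceil>} \<times> {-\<lceil>B\<rceil>..\<lceil>B\<rceil>})"
      using ab by auto
  qed
  then show ?thesis by (rule finite_subset) auto
qed

lemma gauss_unit_iff: "gauss_unit u \<longleftrightarrow> u \<in> {1, -1, \<i>, -\<i>}"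
proof
  assume u: "gauss_unit u"
  then obtain c where c: "c \<in> gauss_ints" "1 = u * c" and uG: "u \<in> gauss_ints"
    by (auto simp: gauss_unit_def gdvd_def)
  have nz: "u \<noteq> 0" "c \<noteq> 0" using c(2) by auto
  have prod: "norm u * norm c = 1" using c(2) by (metis norm_mult norm_one)
  have "norm u \<ge> 1" "norm c \<ge> 1" using gauss_int_norm_ge_1 uG c nz by auto
  then have "norm u = 1" using prod mult_left_mono[of 1 "norm c" "norm u"] by simp
  moreover obtain a b where ab: "u = Complex (of_int a) (of_int b)" using uG by (auto elim: gauss_intsE)
  ultimately have "(of_int (a\<^sup>2 + b\<^sup>2) :: real) = 1" using cmod_gauss_int_sq[of a b] by simp
  then have s: "a\<^sup>2 + b\<^sup>2 = 1" by linarith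
  have "a\<^sup>2 \<le> 1" "b\<^sup>2 \<le> 1" using s zero_le_power2[of a] zero_le_power2[of b] by linarith+
  then have "\<bar>a\<bar> \<le> 1" "\<bar>b\<bar> \<le> 1" by (simp_all add: abs_square_le_1)
  then have "a \<in> {-1, 0, 1}" "b \<in> {-1, 0, 1}" by auto
  then show "u \<in> {1, -1, \<i>, -\<i>}" using s ab by (auto simp: complex_eq_iff)
next
  assume "u \<in> {1, -1, \<i>, -\<i>}"
  then show "gauss_unit u"
    unfolding gauss_unit_def gdvd_def
    by (auto intro: bexI[of _ 1] bexI[of _ "-1"] bexI[of _ "\<i>"] bexI[of _ "-\<i>"])
qed

lemma norm_gauss_unit: "gauss_unit u \<Longrightarrow> norm u = 1"
  by (auto simp: gauss_unit_iff)

lemma norm_1_imp_gauss_unit: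
  assumes "u \<in> gauss_ints" "norm u = 1"
  shows "gauss_unit u"
proof -
  have "u * cnj u = 1" using assms by (simp add: complex_norm_square[symmetric])
  then show ?thesis using assms unfolding gauss_unit_def gdvd_def by (metis gauss_ints_arith(9))
qed

lemma gdvd_refl: "gdvd a a"
  unfolding gdvd_def by (metis gauss_ints_arith(2) mult.right_neutral)

lemma gdvd_trans: "gdvd a b \<Longrightarrow> gdvd b c \<Longrightarrow> gdvd a c"
  unfolding gdvd_def by (metis gauss_ints_arith(7) mult.assoc)

lemma gdvd_mult_right: "gdvd a b \<Longrightarrow> c \<in> gauss_ints \<Longrightarrow> gdvd a (b * c)"
  unfolding gdvd_def by (metis gauss_ints_arith(7) mult.assoc)

lemma gdvd_mult_left: "gdvd a b \<Longrightarrow> c \<in> gauss_ints \<Longrightarrow> gdvd a (c * b)"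
  by (metis gdvd_mult_right mult.commute)

lemma gdvd_add: "gdvd a b \<Longrightarrow> gdvd a c \<Longrightarrow> gdvd a (b + c)"
  unfolding gdvd_def by (metis gauss_ints_arith(5) distrib_left)

lemma gdvd_mult_cancel_left: "a \<noteq> 0 \<Longrightarrow> gdvd (a * b) (a * c) \<longleftrightarrow> gdvd b c"
  unfolding gdvd_def by (simp add: mult.assoc)

lemma gdvd_norm_le:
  assumes "gdvd a b" "b \<noteq> 0"
  shows "norm a \<le> norm b"
proof -
  obtain c where c: "c \<in> gauss_ints" "b = a * c" using assms by (auto simp: gdvd_def)
  then have "norm c \<ge> 1" using assms gauss_int_norm_ge_1 by auto
  then show ?thesis using c by (simp add: norm_mult mult_le_cancel_left1)
qed

text \<open>Rounding both coordinates of \<open>a / b\<close> leaves an error of squared norm at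
  most 1/4 + 1/4 < 1. All divisibility theory below rests on this Euclidean property.\<close>

lemma gauss_int_division:
  assumes "b \<noteq> 0"
  obtains q where "q \<in> gauss_ints" "norm (a - q * b) < norm b"
proof
  define q where "q = Complex (of_int (round (Re (a / b)))) (of_int (round (Im (a / b))))"
  show "q \<in> gauss_ints" by (simp add: q_def)
  have 1: "\<bar>Re (a / b - q)\<bar> \<le> 1/2" "\<bar>Im (a / b - q)\<bar> \<le> 1/2"
    using of_int_round_abs_le[of "Re (a/b)"] of_int_round_abs_le[of "Im (a/b)"]
    by (simp_all add: q_def abs_minus_commute)
  have "(norm (a / b - q))\<^sup>2 = \<bar>Re (a / b - q)\<bar>\<^sup>2 + \<bar>Im (a / b - q)\<bar>\<^sup>2"
    by (simp add: cmod_power2)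
  also have "\<dots> \<le> (1/2)\<^sup>2 + (1/2)\<^sup>2" using 1 by (intro add_mono power_mono) auto
  also have "\<dots> < 1\<^sup>2" by (simp add: power2_eq_square)
  finally have "norm (a / b - q) < 1" using power_less_imp_less_base by fastforce
  then have "norm (a / b - q) * norm b < 1 * norm b" using assms by (intro mult_strict_right_mono) auto
  moreover have "norm (a / b - q) * norm b = norm (a - q * b)"
    using assms by (simp add: norm_mult[symmetric] left_diff_distrib)
  ultimately show "norm (a - q * b) < norm b" by simp
qed

text \<open>\<open>norm\<close> is real valued, so the minimum comes from the finiteness of the
  Gaussian integers in a disc rather than from well-foundedness of the naturals.\<close>

lemma gauss_norm_minimal:
  assumes "x \<in> A" "A \<subseteq> gauss_ints"
  obtains d where "d \<in> A" "\<And>y. y \<in> A \<Longrightarrow> norm d \<le> norm y"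
proof -
  have "finite {y \<in> A. norm y \<le> norm x}"
    by (rule finite_subset[OF _ finite_gauss_ints_norm_le[of "norm x"]]) (use assms in auto)
  moreover have "{y \<in> A. norm y \<le> norm x} \<noteq> {}" using assms by auto
  ultimately obtain d where "is_arg_min norm (\<lambda>y. y \<in> {y \<in> A. norm y \<le> norm x}) d"
    using ex_is_arg_min_if_finite[of "{y \<in> A. norm y \<le> norm x}" norm] by auto
  then have "d \<in> A" "norm d \<le> norm x" "\<And>y. y \<in> A \<Longrightarrow> norm y \<le> norm x \<Longrightarrow> norm d \<le> norm y"
    by (auto simp: is_arg_min_linorder)
  then show ?thesis by (intro that[of d]) (auto, meson le_cases order_trans)
qed

text \<open>\<open>d\<close> is a nonzero combination of least norm: dividing any other combination
  by \<open>d\<close> leaves a combination of smaller norm, hence 0.\<close>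

lemma gauss_bezout:
  assumes "p \<in> gauss_ints" "a \<in> gauss_ints" "p \<noteq> 0"
  obtains d x y where "x \<in> gauss_ints" "y \<in> gauss_ints" "d = x * p + y * a" "d \<in> gauss_ints"
    "gdvd d p" "gdvd d a" "d \<noteq> 0"
proof -
  define A where "A = {d. d \<noteq> 0 \<and> (\<exists>x\<in>gauss_ints. \<exists>y\<in>gauss_ints. d = x * p + y * a)}"
  have "p \<in> A" unfolding A_def using assms
    by (intro CollectI conjI bexI[of _ 1] bexI[of _ 0]) auto
  moreover have "A \<subseteq> gauss_ints" using assms by (auto simp: A_def)
  ultimately obtain d where d: "d \<in> A" "\<And>y. y \<in> A \<Longrightarrow> norm d \<le> norm y" using gauss_norm_minimal by metis
  obtain x y where xy: "x \<in> gauss_ints" "y \<in> gauss_ints" "d = x * p + y * a" "d \<noteq> 0"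
    using d(1) by (auto simp: A_def)
  have comb: "gdvd d e" if e: "e = x' * p + y' * a" "x' \<in> gauss_ints" "y' \<in> gauss_ints" for e x' y'
  proof -
    obtain q where q: "q \<in> gauss_ints" "norm (e - q * d) < norm d" using gauss_int_division[OF xy(4)] by metis
    have "e - q * d = (x' - q * x) * p + (y' - q * y) * a" using e xy by (simp add: algebra_simps)
    moreover have "x' - q * x \<in> gauss_ints" "y' - q * y \<in> gauss_ints" using q e xy by auto
    ultimately have "e - q * d \<in> A" if "e - q * d \<noteq> 0" using that unfolding A_def by blast
    then have "e - q * d = 0" using d(2) q(2) by force
    then show ?thesis using q unfolding gdvd_def by (auto simp: mult.commute)
  qed
  show ?thesis
    by (rule that[OF xy(1,2,3) _ comb[of p 1 0] comb[of a 0 1] xy(4)]) (use xy assms in auto)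
qed

text \<open>A nonunit divisor of least norm has no proper divisors, and the Bezout identity upgrades
  this irreducibility to the product condition in \<open>gauss_prime\<close>.\<close>

lemma gauss_prime_divisor_exists:
  assumes "z \<in> gauss_ints" "z \<noteq> 0" "\<not> gauss_unit z"
  obtains p where "gauss_prime p" "gdvd p z"
proof -
  define A where "A = {d \<in> gauss_ints. gdvd d z \<and> \<not> gauss_unit d}"
  have "z \<in> A" "A \<subseteq> gauss_ints" using assms gdvd_refl by (auto simp: A_def)
  then obtain p where p: "p \<in> A" "\<And>y. y \<in> A \<Longrightarrow> norm p \<le> norm y" using gauss_norm_minimal by metis
  have pG: "p \<in> gauss_ints" "gdvd p z" "\<not> gauss_unit p" using p by (auto simp: A_def)
  have p0: "p \<noteq> 0" using pG assms by (auto simp: gdvd_def)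
  have "gdvd p b" if ab: "a \<in> gauss_ints" "b \<in> gauss_ints" "gdvd p (a * b)" "\<not> gdvd p a" for a b
  proof -
    obtain d x y where d: "x \<in> gauss_ints" "y \<in> gauss_ints" "d = x * p + y * a" "d \<in> gauss_ints"
      "gdvd d p" "gdvd d a" "d \<noteq> 0" using gauss_bezout[OF pG(1) ab(1) p0] by metis
    have du: "gauss_unit d"
    proof (rule ccontr)
      assume "\<not> gauss_unit d"
      then have "d \<in> A" using d pG gdvd_trans by (auto simp: A_def)
      then have le: "norm p \<le> norm d" using p by auto
      obtain c where c: "c \<in> gauss_ints" "p = d * c" using d by (auto simp: gdvd_def)
      have c0: "c \<noteq> 0" using c p0 by auto
      have "norm d * norm c \<le> norm d * 1" using le c by (simp add: norm_mult)
      then have "norm c \<le> 1" using d(7) by (simp add: mult_le_cancel_left1)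
      then have "norm c = 1" using gauss_int_norm_ge_1[OF c(1) c0] by simp
      then have "gdvd c 1" using norm_1_imp_gauss_unit c by (auto simp: gauss_unit_def)
      then have "gdvd p d" using gdvd_mult_cancel_left[OF d(7), of c 1] c by simp
      then show False using d ab gdvd_trans by blast
    qed
    then obtain e where e: "e \<in> gauss_ints" "1 = d * e" by (auto simp: gauss_unit_def gdvd_def)
    \<comment> \<open>\<open>b = (x * p + y * a) * b * e\<close>, where \<open>e\<close> inverts the
      unit \<open>d\<close>; both summands are multiples of \<open>p\<close>.\<close>
    have "gdvd p (p * (x * b))" using d ab by (auto simp: gdvd_def)
    moreover have "gdvd p ((a * b) * y)" using ab d gdvd_mult_right by blast
    ultimately have "gdvd p ((p * (x * b) + (a * b) * y) * e)" using gdvd_add gdvd_mult_right e by blast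
    moreover have "(p * (x * b) + (a * b) * y) * e = b * (d * e)" using d by (simp add: algebra_simps)
    ultimately show ?thesis using e by simp
  qed
  then have "gauss_prime p" using pG p0 unfolding gauss_prime_def by blast
  then show ?thesis using that pG by blast
qed

lemma gauss_primeD:
  assumes "gauss_prime p"
  shows "p \<in> gauss_ints" "p \<noteq> 0" "\<not> gauss_unit p"
    "a \<in> gauss_ints \<Longrightarrow> b \<in> gauss_ints \<Longrightarrow> gdvd p (a * b) \<Longrightarrow> gdvd p a \<or> gdvd p b"
  using assms by (auto simp: gauss_prime_def)

lemma gauss_prime_norm_gt_1:
  assumes "gauss_prime p" shows "norm p > 1"
  using gauss_int_norm_ge_1[of p] norm_1_imp_gauss_unit[of p] gauss_primeD[OF assms] by fastforce

lemma gauss_prime_norm_sq_ge_2: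
  assumes "gauss_prime p" shows "(norm p)\<^sup>2 \<ge> 2"
proof -
  obtain j where j: "(norm p)\<^sup>2 = of_int j"
    using gauss_int_norm_sq_Ints[OF gauss_primeD(1)[OF assms]] by (auto simp: Ints_def)
  have "(norm p)\<^sup>2 > 1" using gauss_prime_norm_gt_1[OF assms] by (simp add: one_less_power)
  then show ?thesis using j by simp
qed

lemma gdvd_unit_mult:
  assumes "gauss_unit u"
  shows "gdvd (u * a) b \<longleftrightarrow> gdvd a b" "gdvd a (u * b) \<longleftrightarrow> gdvd a b"
proof -
  obtain v where v: "v \<in> gauss_ints" "1 = u * v" and u: "u \<in> gauss_ints"
    using assms by (auto simp: gauss_unit_def gdvd_def)
  have "a = (u * a) * v" "b = (u * b) * v" using v by (simp_all add: mult_ac)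
  then show "gdvd (u * a) b \<longleftrightarrow> gdvd a b" "gdvd a (u * b) \<longleftrightarrow> gdvd a b"
    using u v by (metis gdvd_refl gdvd_mult_left gdvd_mult_right gdvd_trans)+
qed

lemma gauss_unit_mult: "gauss_unit u \<Longrightarrow> gauss_unit (u * a) \<longleftrightarrow> gauss_unit a"
proof -
  assume u: "gauss_unit u"
  have "u \<in> gauss_ints" "u \<noteq> 0" using u by (auto simp: gauss_unit_iff)
  moreover have "a \<in> gauss_ints" if "u * a \<in> gauss_ints"
    using u that by (auto simp: gauss_unit_iff) (auto simp: gauss_ints_def)
  ultimately show ?thesis unfolding gauss_unit_def by (auto simp: gdvd_unit_mult(1)[OF u])
qed

lemma gauss_prime_unit_mult:
  assumes "gauss_unit u" "gauss_prime p" shows "gauss_prime (u * p)"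
  using assms gauss_primeD[OF assms(2)] unfolding gauss_prime_def
  by (auto simp: gdvd_unit_mult gauss_unit_mult) (auto simp: gauss_unit_def gdvd_def)

lemma gauss_unit_power: "gauss_unit u \<Longrightarrow> gauss_unit (u ^ m)"
  by (induction m) (auto simp: gauss_unit_mult, auto simp: gauss_unit_iff)

lemma gauss_prime_dvd_prime:
  assumes "gauss_prime p" "gauss_prime r" "gdvd p r"
  obtains u where "gauss_unit u" "p = u * r"
proof -
  obtain c where c: "c \<in> gauss_ints" "r = p * c" using assms by (auto simp: gdvd_def)
  note p = gauss_primeD[OF assms(1)] and r = gauss_primeD[OF assms(2)]
  have c0: "c \<noteq> 0" using c r by auto
  have "gdvd r (p * c)" using c gdvd_refl by auto
  then consider "gdvd r p" | "gdvd r c" using r(4) p c by blast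
  then show ?thesis
  proof cases
    case 1
    then obtain u where u: "u \<in> gauss_ints" "p = r * u" by (auto simp: gdvd_def)
    then have "1 = u * c" using c p by (metis mult.assoc mult_cancel_left mult.right_neutral mult.commute)
    then have "gauss_unit u" using u c by (auto simp: gauss_unit_def gdvd_def)
    then show ?thesis using that u by (auto simp: mult.commute)
  next
    case 2
    then have "gdvd (c * p) (c * 1)" using c by (simp add: mult.commute)
    then have "gdvd p 1" using gdvd_mult_cancel_left c0 by blast
    then show ?thesis using p by (auto simp: gauss_unit_def)
  qed
qed

section \<open>Prime powers dividing a Gaussian integer\<close>

lemma gauss_prime_power_dvd_mult:
  assumes "gauss_prime p" "r \<in> gauss_ints" "z \<in> gauss_ints" "\<not> gdvd p r" "gdvd (p ^ m) (r * z)"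
  shows "gdvd (p ^ m) z"
  using assms(5)
proof (induction m)
  case 0
  then show ?case using assms by (auto simp: gdvd_def)
next
  case (Suc m)
  note p = gauss_primeD[OF assms(1)]
  have "gdvd (p ^ m) (p ^ Suc m)" using p by (auto simp: gdvd_def mult.commute)
  then have "gdvd (p ^ m) z" using Suc gdvd_trans by blast
  then obtain y where y: "y \<in> gauss_ints" "z = p ^ m * y" by (auto simp: gdvd_def)
  have "gdvd (p ^ m * p) (p ^ m * (r * y))" using Suc.prems y by (simp add: mult_ac)
  then have "gdvd p (r * y)" using gdvd_mult_cancel_left p by (metis power_not_zero)
  then have "gdvd p y" using p(4) assms y by blast
  then show ?case using y p gdvd_mult_cancel_left[of "p ^ m" p y] by (simp add: mult.commute)
qed

text \<open>The logarithm of the algebraic norm N(z) = |z|^2, so that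
  \<open>exp (-(s * lnorm z))\<close> is N(z)^(-s).\<close>

definition lnorm :: "complex \<Rightarrow> real" where
  "lnorm z = 2 * ln (norm z)"

lemma lnorm_mult: "a \<noteq> 0 \<Longrightarrow> b \<noteq> 0 \<Longrightarrow> lnorm (a * b) = lnorm a + lnorm b"
  by (simp add: lnorm_def norm_mult ln_mult)

lemma lnorm_power: "a \<noteq> 0 \<Longrightarrow> lnorm (a ^ m) = of_nat m * lnorm a"
  by (simp add: lnorm_def norm_power ln_realpow)

lemma lnorm_nonneg: "z \<in> gauss_ints \<Longrightarrow> lnorm z \<ge> 0"
  by (cases "z = 0") (auto simp: lnorm_def gauss_int_norm_ge_1)

lemma gauss_power_dvd_le:
  assumes "gdvd (p ^ m) z" "j \<le> m" "p \<in> gauss_ints"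
  shows "gdvd (p ^ j) z"
proof -
  have "p ^ m = p ^ j * p ^ (m - j)" using assms by (simp add: power_add[symmetric])
  then show ?thesis using assms gdvd_trans by (metis gdvd_def gauss_ints_power)
qed

lemma gauss_prime_power_bounded:
  assumes "gauss_prime p" "z \<noteq> 0" "gdvd (p ^ m) z"
  shows "of_nat m * ln 2 \<le> lnorm z"
proof -
  have "norm (p ^ m) \<le> norm z" using gdvd_norm_le assms by blast
  then have "lnorm (p ^ m) \<le> lnorm z"
    using gauss_primeD[OF assms(1)] assms(2) by (simp add: lnorm_def)
  moreover have "ln 2 \<le> lnorm p"
  proof -
    have "ln 2 \<le> ln ((norm p)\<^sup>2)"
      using gauss_prime_norm_sq_ge_2[OF assms(1)] by (intro ln_mono) auto
    then show ?thesis using gauss_primeD(2)[OF assms(1)] by (simp add: lnorm_def ln_realpow)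
  qed
  ultimately show ?thesis using lnorm_power gauss_primeD(2)[OF assms(1)]
    by (metis mult_left_mono of_nat_0_le_iff order_trans)
qed

text \<open>Associated primes give separate pairs, so no representatives up to units have to be
  chosen.\<close>

definition prime_power_divs :: "complex \<Rightarrow> (complex \<times> nat) set" where
  "prime_power_divs z = {(p, m). gauss_prime p \<and> m \<ge> 1 \<and> gdvd (p ^ m) z}"

lemma finite_prime_power_divs:
  assumes "z \<noteq> 0" shows "finite (prime_power_divs z)"
proof -
  have "prime_power_divs z \<subseteq> {p \<in> gauss_ints. norm p \<le> norm z} \<times> {..nat \<lceil>lnorm z / ln 2\<rceil>}"
  proof clarify
    fix p m assume "(p, m) \<in> prime_power_divs z"
    then have p: "gauss_prime p" "m \<ge> 1" "gdvd (p ^ m) z" by (auto simp: prime_power_divs_def)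
    then have "gdvd (p ^ 1) z" using gauss_power_dvd_le gauss_primeD by blast
    then have "norm p \<le> norm z" using gdvd_norm_le assms by simp
    moreover have "of_nat m \<le> lnorm z / ln 2"
      using gauss_prime_power_bounded[OF p(1) assms p(3)] by (simp add: field_simps)
    then have "m \<le> nat \<lceil>lnorm z / ln 2\<rceil>" by linarith
    ultimately show "p \<in> {p \<in> gauss_ints. norm p \<le> norm z} \<and> m \<in> {..nat \<lceil>lnorm z / ln 2\<rceil>}"
      using gauss_primeD p by auto
  qed
  then show ?thesis by (rule finite_subset) (auto intro: finite_gauss_ints_norm_le)
qed

text \<open>With \<open>v\<close> the exact multiplicity of \<open>r\<close> in \<open>z\<close>,
  the new pairs are the powers \<open>v + 1\<close> of the four associates of \<open>r\<close>;
  powers of other primes divide \<open>r * z\<close> only if they divide \<open>z\<close>. This is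
  the induction step that stands in for unique factorization.\<close>

lemma prime_power_divs_mult_prime:
  assumes "gauss_prime r" "z \<in> gauss_ints" "z \<noteq> 0"
  obtains v where "prime_power_divs (r * z) = prime_power_divs z \<union> (\<lambda>u. (u * r, Suc v)) ` {u. gauss_unit u}"
    "prime_power_divs z \<inter> (\<lambda>u. (u * r, Suc v)) ` {u. gauss_unit u} = {}"
proof -
  note r = gauss_primeD[OF assms(1)]
  have r2: "gdvd (r ^ m) z \<Longrightarrow> m \<le> nat \<lceil>lnorm z / ln 2\<rceil>" for m
  proof -
    assume "gdvd (r ^ m) z"
    from gauss_prime_power_bounded[OF assms(1,3) this] have "of_nat m \<le> lnorm z / ln 2" by (simp add: field_simps)
    then show "m \<le> nat \<lceil>lnorm z / ln 2\<rceil>" by linarith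
  qed
  have ex0: "gdvd (r ^ 0) z" using assms by (auto simp: gdvd_def)
  \<comment> \<open>\<open>GREATEST\<close> is meaningful since the exponent 0 qualifies and
    \<open>r2\<close> bounds all exponents.\<close>
  define v where "v = (GREATEST m. gdvd (r ^ m) z)"
  have v1: "gdvd (r ^ v) z" unfolding v_def using GreatestI_nat[of "\<lambda>m. gdvd (r ^ m) z", OF ex0 r2] by blast
  have v2: "m \<le> v" if "gdvd (r ^ m) z" for m
    unfolding v_def using Greatest_le_nat[of "\<lambda>m. gdvd (r ^ m) z", OF that r2] by blast
  have v: "gdvd (r ^ m) z \<longleftrightarrow> m \<le> v" for m using v1 v2 gauss_power_dvd_le r(1) by blast
  have vu: "gdvd ((u * r) ^ m) w \<longleftrightarrow> gdvd (r ^ m) w" if "gauss_unit u" for u m w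
    using gdvd_unit_mult(1)[OF gauss_unit_power[OF that]] by (simp add: power_mult_distrib)
  have vr: "gdvd (r ^ m) (r * z) \<longleftrightarrow> m \<le> Suc v" for m
  proof (cases m)
    case 0 then show ?thesis using r assms by (auto simp: gdvd_def)
  next
    case (Suc j) then show ?thesis using gdvd_mult_cancel_left[OF r(2), of "r ^ j" z] v by simp
  qed
  have "(p, m) \<in> prime_power_divs (r * z) \<longleftrightarrow>
     (p, m) \<in> prime_power_divs z \<or> (p, m) \<in> (\<lambda>u. (u * r, Suc v)) ` {u. gauss_unit u}" for p m
  proof (cases "\<exists>u. gauss_unit u \<and> p = u * r")
    case True
    then obtain u where u: "gauss_unit u" "p = u * r" by auto
    have "gauss_prime p" using gauss_prime_unit_mult u assms by auto
    moreover have "(p, m) \<in> (\<lambda>u. (u * r, Suc v)) ` {u. gauss_unit u} \<longleftrightarrow> m = Suc v"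
      using u r by auto
    ultimately show ?thesis using u by (auto simp: prime_power_divs_def vu v vr)
  next
    case False
    have "gdvd (p ^ m) (r * z) \<longleftrightarrow> gdvd (p ^ m) z" if p: "gauss_prime p"
    proof -
      have "\<not> gdvd p r" using False gauss_prime_dvd_prime[OF p assms(1)] by metis
      then show ?thesis
        using gauss_prime_power_dvd_mult[OF p r(1) assms(2)] gdvd_mult_left[OF _ r(1)] by metis
    qed
    then show ?thesis using False unfolding prime_power_divs_def image_def by simp blast
  qed
  then have "prime_power_divs (r * z) = prime_power_divs z \<union> (\<lambda>u. (u * r, Suc v)) ` {u. gauss_unit u}"
    by (intro set_eqI) (simp only: Un_iff split_paired_all)
  moreover have "prime_power_divs z \<inter> (\<lambda>u. (u * r, Suc v)) ` {u. gauss_unit u} = {}"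
    by (auto simp: prime_power_divs_def vu v simp del: power_Suc)
  ultimately show ?thesis using that by blast
qed

text \<open>The factor 4 appears because every prime is counted together with its associates.\<close>

lemma sum_lnorm_prime_power_divs:
  assumes "z \<in> gauss_ints" "z \<noteq> 0"
  shows "(\<Sum>(p, m)\<in>prime_power_divs z. lnorm p) = 4 * lnorm z"
  using assms
proof (induction "nat \<lfloor>(norm z)\<^sup>2\<rfloor>" arbitrary: z rule: less_induct)
  case less
  show ?case
  proof (cases "gauss_unit z")
    case True
    have "prime_power_divs z = {}"
    proof -
      have False if "gauss_prime p" "m \<ge> 1" "gdvd (p ^ m) z" for p m
      proof -
        have "gdvd (p ^ 1) z" using gauss_power_dvd_le that gauss_primeD by blast
        then have "norm p \<le> norm z" using less gdvd_norm_le by simp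
        then show False using gauss_prime_norm_gt_1[OF that(1)] norm_gauss_unit[OF True] by simp
      qed
      then show ?thesis by (auto simp: prime_power_divs_def)
    qed
    then show ?thesis using norm_gauss_unit[OF True] by (simp add: lnorm_def)
  next
    case False
    then obtain r where r: "gauss_prime r" "gdvd r z" using gauss_prime_divisor_exists less by metis
    then obtain y where y: "y \<in> gauss_ints" "z = r * y" by (auto simp: gdvd_def)
    have y0: "y \<noteq> 0" using y less by auto
    note rr = gauss_primeD[OF r(1)]
    \<comment> \<open>Removing a prime factor, whose squared norm is at least 2, lowers the squared
      norm by at least 1, so the floor that governs the induction drops.\<close>
    have "(norm y)\<^sup>2 \<ge> 1" using gauss_int_norm_ge_1[OF y(1) y0] by simp
    then have "(norm y)\<^sup>2 + 1 \<le> (norm y)\<^sup>2 * 2" by simp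
    also have "\<dots> \<le> (norm y)\<^sup>2 * (norm r)\<^sup>2" using gauss_prime_norm_sq_ge_2[OF r(1)] by (intro mult_left_mono) auto
    also have "\<dots> = (norm z)\<^sup>2" using y by (simp add: norm_mult power_mult_distrib)
    finally have le: "(norm y)\<^sup>2 + 1 \<le> (norm z)\<^sup>2" .
    then have "\<lfloor>(norm y)\<^sup>2\<rfloor> < \<lfloor>(norm z)\<^sup>2\<rfloor>" by linarith
    moreover have "\<lfloor>(norm y)\<^sup>2\<rfloor> \<ge> 0" by simp
    ultimately have "nat \<lfloor>(norm y)\<^sup>2\<rfloor> < nat \<lfloor>(norm z)\<^sup>2\<rfloor>" by linarith
    then have IH: "(\<Sum>(p, m)\<in>prime_power_divs y. lnorm p) = 4 * lnorm y" using less y y0 by blast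
    obtain v where v: "prime_power_divs (r * y) = prime_power_divs y \<union> (\<lambda>u. (u * r, Suc v)) ` {u. gauss_unit u}"
      "prime_power_divs y \<inter> (\<lambda>u. (u * r, Suc v)) ` {u. gauss_unit u} = {}"
      using prime_power_divs_mult_prime[OF r(1) y(1) y0] by metis
    have U: "{u. gauss_unit u} = {1, -1, \<i>, -\<i>}" using gauss_unit_iff by auto
    have "card {u. gauss_unit u} = 4" unfolding U by (auto simp: complex_eq_iff card_insert_if)
    moreover have "(\<Sum>(p, m)\<in>(\<lambda>u. (u * r, Suc v)) ` {u. gauss_unit u}. lnorm p) = (\<Sum>u\<in>{u. gauss_unit u}. lnorm r)"
      using rr by (subst sum.reindex) (auto simp: inj_on_def lnorm_def norm_mult norm_gauss_unit intro!: sum.cong)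
    ultimately have "(\<Sum>(p, m)\<in>(\<lambda>u. (u * r, Suc v)) ` {u. gauss_unit u}. lnorm p) = 4 * lnorm r" by simp
    then have "(\<Sum>(p, m)\<in>prime_power_divs (r * y). lnorm p) = 4 * lnorm y + 4 * lnorm r"
      unfolding v(1) using IH v(2) finite_prime_power_divs[OF y0]
      by (subst sum.union_disjoint) (auto simp: U)
    then show ?thesis using y y0 rr lnorm_mult by (simp add: algebra_simps)
  qed
qed

section \<open>Hecke L-functions\<close>

lemma gauss_prime_0 [simp]: "\<not> gauss_prime 0"
  by (simp add: gauss_prime_def)

section \<open>Absolute convergence of sums over the Gaussian integers\<close>

lemma summable_on_mult_product:
  fixes f :: "'a \<Rightarrow> real" and g :: "'b \<Rightarrow> real"
  assumes "f summable_on A" "g summable_on B" "\<And>x. x \<in> A \<Longrightarrow> f x \<ge> 0" "\<And>x. x \<in> B \<Longrightarrow> g x \<ge> 0"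
  shows "(\<lambda>(x, y). f x * g y) summable_on A \<times> B"
proof (rule summable_on_SigmaI)
  show "((\<lambda>y. case (x, y) of (x, y) \<Rightarrow> f x * g y) has_sum f x * infsum g B) B" for x
    using assms by (auto intro!: has_sum_cmult_right)
  show "(\<lambda>x. f x * infsum g B) summable_on A" using assms by (intro summable_on_cmult_left)
qed (use assms in auto)

text \<open>The term is (1 + a^2)^(-c/2), dominated by |a|^(-c); the added 1 keeps
  \<open>a = 0\<close> harmless.\<close>

lemma summable_on_int_powr:
  fixes c :: real
  assumes "c > 1"
  shows "(\<lambda>a::int. exp (-(c / 2 * ln (1 + (of_int a)\<^sup>2)))) summable_on UNIV"
proof -
  let ?f = "\<lambda>x::real. exp (-(c / 2 * ln (1 + x\<^sup>2)))"
  have bd: "?f (real n) \<le> real n powr (-c)" if "n \<ge> 1" for n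
  proof -
    have "ln ((real n)\<^sup>2) \<le> ln (1 + (real n)\<^sup>2)" using that by (intro ln_mono) auto
    then have "2 * ln (real n) \<le> ln (1 + (real n)\<^sup>2)" using that by (simp add: ln_realpow)
    then have "c / 2 * (2 * ln (real n)) \<le> c / 2 * ln (1 + (real n)\<^sup>2)"
      using assms by (intro mult_left_mono) auto
    then show ?thesis using that by (simp add: powr_def)
  qed
  have s: "summable (\<lambda>n. ?f (real n))"
    by (rule summable_comparison_test'[of "\<lambda>n. real n powr (-c)" 1])
      (use assms bd in \<open>auto simp: summable_real_powr_iff\<close>)
  then have n1: "(\<lambda>n. ?f (real n)) summable_on UNIV"
    by (subst summable_on_UNIV_nonneg_real_iff) auto
  have n2: "(\<lambda>n. ?f (real (Suc n))) summable_on UNIV"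
    using summable_Suc_iff[of "\<lambda>n. ?f (real n)"] s by (subst summable_on_UNIV_nonneg_real_iff) auto
  have "(\<lambda>a. ?f (of_int a)) summable_on {0..}"
  proof -
    have "bij_betw int UNIV {0..}" by (rule bij_betw_byWitness[of _ nat]) auto
    from summable_on_reindex_bij_betw[OF this, of "\<lambda>a. ?f (of_int a)"] n1 show ?thesis by simp
  qed
  moreover have "(\<lambda>a. ?f (of_int a)) summable_on {..<0}"
  proof -
    have "bij_betw (\<lambda>n. - int (Suc n)) UNIV {..<0}"
      by (rule bij_betw_byWitness[of _ "\<lambda>a. nat (-a - 1)"]) auto
    from summable_on_reindex_bij_betw[OF this, of "\<lambda>a. ?f (of_int a)"] n2
    show ?thesis by (simp add: power2_eq_square algebra_simps)
  qed
  ultimately have "(\<lambda>a. ?f (of_int a)) summable_on {0..} \<union> {..<0}" by (intro summable_on_union)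
  moreover have "{0..} \<union> {..<0} = (UNIV :: int set)" by auto
  ultimately show ?thesis by simp
qed

abbreviation gnz :: "complex set" where "gnz \<equiv> gauss_ints - {0}"

lemma exp_lnorm_eq: "z \<noteq> 0 \<Longrightarrow> exp (lnorm z) = (norm z)\<^sup>2"
  by (simp add: lnorm_def exp_double)

text \<open>For N = a^2 + b^2 at least 1 one has (1 + a^2) (1 + b^2) \<le> (2 N)^2, so N^(-c) is at
  most 2^c times a product of two one-dimensional terms. This splits the lattice sum into two series
  that converge exactly for c > 1.\<close>

lemma summable_on_exp_lnorm:
  fixes c :: real
  assumes "c > 1"
  shows "(\<lambda>z. exp (-(c * lnorm z))) summable_on gnz"
proof -
  let ?t = "\<lambda>a::int. exp (-(c / 2 * ln (1 + (of_int a)\<^sup>2)))"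
  let ?C = "\<lambda>(a::int, b::int). Complex (of_int a) (of_int b)"
  have bij: "bij_betw ?C (UNIV - {(0, 0)}) gnz"
    by (auto simp: bij_betw_def inj_on_def image_iff complex_eq_iff elim!: gauss_intsE)
  have "(\<lambda>(a, b). ?t a * ?t b) summable_on UNIV \<times> UNIV"
    by (intro summable_on_mult_product summable_on_int_powr assms) auto
  then have "(\<lambda>x. exp (c * ln 2) * (\<lambda>(a, b). ?t a * ?t b) x) summable_on UNIV - {(0, 0)}"
    by (intro summable_on_cmult_right) (auto intro: summable_on_subset_banach)
  then have "(\<lambda>x. exp (-(c * lnorm (?C x)))) summable_on UNIV - {(0, 0)}"
  proof (rule summable_on_comparison_test)
    fix x :: "int \<times> int" assume x: "x \<in> UNIV - {(0, 0)}"
    obtain a b where ab: "x = (a, b)" by (cases x)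
    let ?z = "Complex (of_int a) (of_int b)"
    define N where "N = (norm ?z)\<^sup>2"
    have N: "N = (of_int a)\<^sup>2 + (of_int b)\<^sup>2" by (simp add: N_def cmod_power2)
    have z0: "?z \<noteq> 0" using x ab by (auto simp: complex_eq_iff)
    then have N1: "N \<ge> 1" using gauss_int_norm_ge_1[of ?z] by (simp add: N_def)
    have lN: "lnorm ?z = ln N" using z0 by (simp add: N_def lnorm_def ln_realpow)
    let ?A = "(of_int a)\<^sup>2 :: real" and ?B = "(of_int b)\<^sup>2 :: real"
    have "?A * ?B \<le> N * N" unfolding N by (intro mult_mono) auto
    moreover have "N \<le> N * N" "1 \<le> N * N" using N1 mult_mono[of 1 N 1 N] mult_mono[of N N 1 N] by auto
    moreover have "(1 + ?A) * (1 + ?B) = 1 + N + ?A * ?B" unfolding N by (simp only: algebra_simps)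
    ultimately have "(1 + ?A) * (1 + ?B) \<le> (2 * N) * (2 * N)"
      by simp
    then have "ln ((1 + ?A) * (1 + ?B)) \<le> ln ((2 * N) * (2 * N))"
      by (intro ln_mono) (auto intro!: mult_pos_pos add_pos_nonneg)
    moreover have "1 + ?A > 0" "1 + ?B > 0" by (auto intro: add_pos_nonneg)
    ultimately have "ln (1 + ?A) + ln (1 + ?B) \<le> 2 * (ln 2 + ln N)"
      using N1 by (simp only: ln_mult_pos mult_pos_pos) (simp add: ln_mult_pos)
    then have "c / 2 * (ln (1 + ?A) + ln (1 + ?B)) \<le> c / 2 * (2 * (ln 2 + ln N))"
      using assms by (intro mult_left_mono) auto
    then have "- (c * ln N) \<le> c * ln 2 + (-(c / 2 * ln (1 + ?A)) + -(c / 2 * ln (1 + ?B)))"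
      by (simp add: algebra_simps)
    then have "exp (- (c * ln N)) \<le> exp (c * ln 2 + (-(c / 2 * ln (1 + ?A)) + -(c / 2 * ln (1 + ?B))))"
      by (simp only: exp_le_cancel_iff)
    then show "exp (- (c * lnorm (?C x))) \<le> exp (c * ln 2) * (\<lambda>(a, b). ?t a * ?t b) x"
      using ab lN by (simp only: exp_add split_conv)
  qed auto
  then show ?thesis using summable_on_reindex_bij_betw[OF bij, of "\<lambda>z. exp (-(c * lnorm z))"] by simp
qed

text \<open>The logarithm costs an arbitrarily small power of the norm, and half of the surplus
  \<open>c - 1\<close> pays for it.\<close>

lemma summable_on_lnorm_exp_lnorm:
  fixes c :: real
  assumes "c > 1"
  shows "(\<lambda>z. lnorm z * exp (-(c * lnorm z))) summable_on gnz"
proof -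
  define e where "e = (c - 1) / 2"
  have e: "e > 0" "c - e > 1" using assms by (auto simp: e_def field_simps)
  have "(\<lambda>z. 1 / e * exp (-((c - e) * lnorm z))) summable_on gnz"
    using e by (intro summable_on_cmult_right summable_on_exp_lnorm)
  then show ?thesis
  proof (rule summable_on_comparison_test)
    fix z assume z: "z \<in> gnz"
    then have l: "lnorm z \<ge> 0" by (auto intro: lnorm_nonneg)
    then show "lnorm z * exp (-(c * lnorm z)) \<ge> 0" by simp
    have "e * lnorm z \<le> exp (e * lnorm z)" using exp_ge_add_one_self[of "e * lnorm z"] by linarith
    then have "lnorm z \<le> 1 / e * exp (e * lnorm z)" using e by (simp add: field_simps)
    then have "lnorm z * exp (-(c * lnorm z)) \<le> 1 / e * exp (e * lnorm z) * exp (-(c * lnorm z))"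
      by (intro mult_right_mono) auto
    also have "\<dots> = 1 / e * exp (-((c - e) * lnorm z))"
      by (simp add: exp_add[symmetric] algebra_simps)
    finally show "lnorm z * exp (-(c * lnorm z)) \<le> 1 / e * exp (-((c - e) * lnorm z))" .
  qed
qed

text \<open>These are the continuous characters of the multiplicative group of complex numbers that
  are trivial on the units: the angular exponent has to be a multiple of 4 because of
  \<open>\<i>\<close>.\<close>

definition hecke :: "int \<Rightarrow> complex \<Rightarrow> complex \<Rightarrow> complex" where
  "hecke k s z = sgn z powi (4 * k) * exp (-(s * of_real (lnorm z)))"

lemma hecke_mult: "a \<noteq> 0 \<Longrightarrow> b \<noteq> 0 \<Longrightarrow> hecke k s (a * b) = hecke k s a * hecke k s b"
proof -
  assume "a \<noteq> 0" "b \<noteq> 0"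
  then have "-(s * of_real (lnorm (a * b))) = -(s * of_real (lnorm a)) + -(s * of_real (lnorm b))"
    by (simp add: lnorm_mult distrib_left)
  then have "exp (-(s * of_real (lnorm (a * b)))) = exp (-(s * of_real (lnorm a))) * exp (-(s * of_real (lnorm b)))"
    by (simp only: exp_add)
  moreover have "sgn (a * b) powi (4 * k) = sgn a powi (4 * k) * sgn b powi (4 * k)"
    by (simp only: sgn_mult power_int_mult_distrib)
  ultimately show ?thesis
    unfolding hecke_def by (metis mult.assoc mult.left_commute)
qed

lemma norm_hecke: "z \<noteq> 0 \<Longrightarrow> norm (hecke k s z) = exp (-(Re s * lnorm z))"
proof -
  assume z: "z \<noteq> 0"
  have "norm (sgn z powi (4 * k)) = 1" using z by (simp only: norm_power_int norm_sgn) simp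
  moreover have "norm (exp (-(s * of_real (lnorm z)))) = exp (-(Re s * lnorm z))"
    by (simp only: norm_exp_eq_Re) simp
  ultimately show ?thesis unfolding hecke_def norm_mult by simp
qed

lemma hecke_unit: "gauss_unit u \<Longrightarrow> hecke k s u = 1"
proof -
  assume u: "gauss_unit u"
  have "sgn u = u" using norm_gauss_unit[OF u] by (simp add: sgn_div_norm)
  moreover have "u ^ 4 = 1" using u by (auto simp: gauss_unit_iff power4_eq_xxxx)
  then have "u powi 4 = 1" by simp
  then have "u powi (4 * k) = 1" by (simp add: power_int_mult)
  ultimately show ?thesis using norm_gauss_unit[OF u] by (simp add: hecke_def lnorm_def)
qed

lemma hecke_has_field_derivative:
  "((\<lambda>s. hecke k s z) has_field_derivative -(of_real (lnorm z) * hecke k s z)) (at s)"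
proof -
  have "((\<lambda>s. c * exp (-(s * d))) has_field_derivative -(d * (c * exp (-(s * d))))) (at s)" for c d :: complex
    by (rule derivative_eq_intros refl | simp)+
  then show ?thesis unfolding hecke_def .
qed

lemma hecke_holomorphic: "(\<lambda>s. hecke k s z) holomorphic_on A"
  unfolding hecke_def by (intro holomorphic_intros)

lemma hecke_summable: "Re s > 1 \<Longrightarrow> hecke k s summable_on gnz"
  by (rule abs_summable_summable, rule summable_on_cong[THEN iffD2, OF _ summable_on_exp_lnorm[of "Re s"]])
    (auto simp: norm_hecke)

definition hecke_L :: "int \<Rightarrow> complex \<Rightarrow> complex" where
  "hecke_L k s = (\<Sum>\<^sub>\<infinity>z\<in>gnz. hecke k s z)"

abbreviation prime_powers :: "(complex \<times> nat) set" where
  "prime_powers \<equiv> {p. gauss_prime p} \<times> {1..}"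

text \<open>The analogue of the von Mangoldt series. Each prime occurs with its four associates, so
  this is -4 L'/L instead of -L'/L.\<close>

definition hecke_Lambda :: "int \<Rightarrow> complex \<Rightarrow> complex" where
  "hecke_Lambda k s = (\<Sum>\<^sub>\<infinity>(p, m)\<in>prime_powers. of_real (lnorm p) * hecke k s (p ^ m))"

lemma lnorm_prime_ge: "gauss_prime p \<Longrightarrow> lnorm p \<ge> ln 2"
  using gauss_prime_power_bounded[of p p 1] gauss_primeD[of p] gdvd_refl by simp

lemma lambda_summable_real:
  fixes c :: real
  assumes "c > 1"
  shows "(\<lambda>(p, m). lnorm p * exp (-(c * lnorm (p ^ m)))) summable_on prime_powers"
proof -
  have "bij_betw Suc UNIV {1..}" by (rule bij_betw_byWitness[of _ "\<lambda>n. n - 1"]) auto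
  moreover have "(\<lambda>n. (1/2::real) ^ n) summable_on UNIV"
    by (subst summable_on_UNIV_nonneg_real_iff) auto
  ultimately have g: "(\<lambda>m. (1/2::real) ^ (m - 1)) summable_on {1..}"
    using summable_on_reindex_bij_betw[of Suc UNIV "{1..}" "\<lambda>m. (1/2::real) ^ (m - 1)"] by simp
  have "(\<lambda>p. lnorm p * exp (-(c * lnorm p))) summable_on {p. gauss_prime p}"
    by (rule summable_on_subset_banach[OF summable_on_lnorm_exp_lnorm[OF assms]]) (auto simp: gauss_primeD)
  with g have "(\<lambda>(p, m). (lnorm p * exp (-(c * lnorm p))) * (1/2::real) ^ (m - 1)) summable_on prime_powers"
    by (intro summable_on_mult_product) (auto simp: gauss_primeD lnorm_nonneg)
  then show ?thesis
  proof (rule summable_on_comparison_test; clarify)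
    fix p :: complex and m :: nat
    assume p: "gauss_prime p" and m: "1 \<le> m"
    have l: "lnorm p \<ge> 0" using p by (auto simp: gauss_primeD lnorm_nonneg)
    then show "0 \<le> lnorm p * exp (-(c * lnorm (p ^ m)))" by simp
    have "lnorm (p ^ m) = lnorm p + of_nat (m - 1) * lnorm p"
      using m lnorm_power[of p m] gauss_primeD[OF p] by (simp add: algebra_simps of_nat_diff)
    then have e: "exp (-(c * lnorm (p ^ m))) = exp (-(c * lnorm p)) * exp (-(c * lnorm p)) ^ (m - 1)"
      by (simp add: exp_add[symmetric] exp_of_nat_mult[symmetric] algebra_simps)
    \<comment> \<open>A prime has norm N(p) \<ge> 2, so each further power of \<open>p\<close> costs
      a factor of at most 1/2.\<close>
    have "1 * ln 2 \<le> c * lnorm p" using lnorm_prime_ge[OF p] assms l by (intro mult_mono) auto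
    then have "exp (-(c * lnorm p)) \<le> exp (- ln 2)" by simp
    then have "exp (-(c * lnorm p)) \<le> 1/2" by (simp add: exp_minus)
    then have "exp (-(c * lnorm p)) ^ (m - 1) \<le> (1/2) ^ (m - 1)" by (intro power_mono) auto
    then have "lnorm p * (exp (-(c * lnorm p)) * exp (-(c * lnorm p)) ^ (m - 1)) \<le>
        lnorm p * (exp (-(c * lnorm p)) * (1/2) ^ (m - 1))"
      using l by (intro mult_left_mono) auto
    then show "lnorm p * exp (-(c * lnorm (p ^ m))) \<le> lnorm p * exp (-(c * lnorm p)) * (1/2) ^ (m - 1)"
      using e by (simp add: mult_ac)
  qed
qed

lemma lambda_abs_summable:
  assumes "Re s > 1"
  shows "(\<lambda>x. norm ((\<lambda>(p, m). of_real (lnorm p) * hecke k s (p ^ m)) x)) summable_on prime_powers"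
proof (rule Infinite_Sum.abs_summable_on_comparison_test'[OF lambda_summable_real[OF assms]])
  fix x assume "x \<in> prime_powers"
  then obtain p m where x: "x = (p, m)" "gauss_prime p" by auto
  have "p ^ m \<noteq> 0" using gauss_primeD[OF x(2)] by simp
  then show "norm (case x of (p, m) \<Rightarrow> of_real (lnorm p) * hecke k s (p ^ m))
      \<le> (case x of (p, m) \<Rightarrow> lnorm p * exp (- (Re s * lnorm (p ^ m))))"
    using x lnorm_nonneg[of p] gauss_primeD[OF x(2)] by (simp add: norm_mult norm_hecke)
qed

text \<open>The M-test gives locally uniform convergence, and for holomorphic functions this passes
  to the derivatives; therefore only the \<open>f i\<close>, not the \<open>f' i\<close>, need a
  majorant.\<close>

lemma infsum_has_field_derivative:
  fixes f f' :: "'i \<Rightarrow> complex \<Rightarrow> complex"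
  assumes r: "r > 0"
    and der: "\<And>i w. i \<in> I \<Longrightarrow> w \<in> cball z r \<Longrightarrow> (f i has_field_derivative f' i w) (at w)"
    and bd: "\<And>i w. i \<in> I \<Longrightarrow> w \<in> cball z r \<Longrightarrow> norm (f i w) \<le> M i"
    and M: "M summable_on I"
  shows "((\<lambda>w. \<Sum>\<^sub>\<infinity>i\<in>I. f i w) has_field_derivative (\<Sum>\<^sub>\<infinity>i\<in>I. f' i z)) (at z)"
proof -
  let ?F = "finite_subsets_at_top I"
  have ul: "uniform_limit (cball z r) (\<lambda>X w. \<Sum>i\<in>X. f i w) (\<lambda>w. \<Sum>\<^sub>\<infinity>i\<in>I. f i w) ?F"
    by (rule Weierstrass_m_test_general[OF bd M])
  have ev: "\<forall>\<^sub>F X in ?F. continuous_on (cball z r) (\<lambda>w. \<Sum>i\<in>X. f i w) \<and>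
     (\<forall>w\<in>ball z r. ((\<lambda>w. \<Sum>i\<in>X. f i w) has_field_derivative (\<Sum>i\<in>X. f' i w)) (at w))"
  proof (rule eventually_finite_subsets_at_top_weakI)
    fix X assume X: "finite X" "X \<subseteq> I"
    have "((\<lambda>w. \<Sum>i\<in>X. f i w) has_field_derivative (\<Sum>i\<in>X. f' i w)) (at w)" if "w \<in> cball z r" for w
      using X that by (intro DERIV_sum der) auto
    then show "continuous_on (cball z r) (\<lambda>w. \<Sum>i\<in>X. f i w) \<and>
     (\<forall>w\<in>ball z r. ((\<lambda>w. \<Sum>i\<in>X. f i w) has_field_derivative (\<Sum>i\<in>X. f' i w)) (at w))"
      by (auto intro!: DERIV_atLeastAtMost_imp_continuous_on continuous_at_imp_continuous_on DERIV_isCont)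
  qed
  obtain g' where g': "\<And>w. w \<in> ball z r \<Longrightarrow> ((\<lambda>w. \<Sum>\<^sub>\<infinity>i\<in>I. f i w) has_field_derivative g' w) (at w) \<and>
      ((\<lambda>X. \<Sum>i\<in>X. f' i w) \<longlongrightarrow> g' w) ?F"
    using has_complex_derivative_uniform_limit[OF ev ul _ r] by auto
  have "((\<lambda>i. f' i z) has_sum g' z) I" using g'[of z] r by (simp add: has_sum_def)
  then show ?thesis using g'[of z] r by (simp add: infsumI)
qed

lemma hecke_L_has_field_derivative:
  assumes "Re s > 1"
  shows "(hecke_L k has_field_derivative -(\<Sum>\<^sub>\<infinity>z\<in>gnz. of_real (lnorm z) * hecke k s z)) (at s)"
proof -
  define r where "r = (Re s - 1) / 2"
  have r: "r > 0" using assms by (simp add: r_def)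
  have "((\<lambda>w. \<Sum>\<^sub>\<infinity>z\<in>gnz. hecke k w z) has_field_derivative (\<Sum>\<^sub>\<infinity>z\<in>gnz. -(of_real (lnorm z) * hecke k s z))) (at s)"
  proof (rule infsum_has_field_derivative[OF r])
    show "(\<lambda>z. exp (-((Re s - r) * lnorm z))) summable_on gnz"
      using assms by (intro summable_on_exp_lnorm) (simp add: r_def field_simps)
    fix z w assume z: "z \<in> gnz" and w: "w \<in> cball s r"
    show "((\<lambda>w. hecke k w z) has_field_derivative -(of_real (lnorm z) * hecke k w z)) (at w)"
      by (rule hecke_has_field_derivative)
    have "Re s - Re w \<le> r" using w abs_Re_le_cmod[of "s - w"] by (simp add: dist_norm)
    then have "(Re s - r) * lnorm z \<le> Re w * lnorm z"
      using z by (intro mult_right_mono lnorm_nonneg) auto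
    then show "norm (hecke k w z) \<le> exp (-((Re s - r) * lnorm z))" using z by (simp add: norm_hecke)
  qed
  then show ?thesis by (simp add: hecke_L_def[abs_def] infsum_uminus)
qed

lemma hecke_L_holomorphic: "hecke_L k holomorphic_on {s. Re s > 1}"
  unfolding holomorphic_on_def field_differentiable_def
  using hecke_L_has_field_derivative has_field_derivative_at_within by blast

text \<open>Dirichlet convolution: a prime power times a nonzero w is the same datum as z with a
  chosen prime power divisor. By multiplicativity the terms agree, and the inner sum over the
  divisors of z is 4 \<open>lnorm z\<close>.\<close>

lemma hecke_L_mult_Lambda:
  assumes s: "Re s > 1"
  shows "hecke_L k s * hecke_Lambda k s = 4 * (\<Sum>\<^sub>\<infinity>z\<in>gnz. of_real (lnorm z) * hecke k s z)"
proof -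
  define a where "a x = of_real (lnorm (fst x)) * hecke k s (fst x ^ snd x)" for x :: "complex \<times> nat"
  define h where "h x = (fst (fst x) ^ snd (fst x) * snd x, fst x)" for x :: "(complex \<times> nat) \<times> complex"
  define g where "g x = of_real (lnorm (fst (snd x))) * hecke k s (fst x)" for x :: "complex \<times> (complex \<times> nat)"
  have sa: "(\<lambda>x. norm (a x)) summable_on prime_powers"
    using lambda_abs_summable[OF s, of k] by (simp add: a_def case_prod_unfold)
  have sL: "(\<lambda>x. norm (hecke k s x)) summable_on gnz"
    using hecke_summable[OF s] summable_on_iff_abs_summable_on_complex by blast
  have "(\<lambda>(x, w). norm (a x) * norm (hecke k s w)) summable_on prime_powers \<times> gnz"
    by (rule summable_on_mult_product[OF sa sL]) auto
  then have "(\<lambda>y. norm ((\<lambda>(x, w). a x * hecke k s w) y)) summable_on prime_powers \<times> gnz"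
    by (simp add: norm_mult case_prod_unfold)
  then have sAB: "(\<lambda>(x, w). a x * hecke k s w) summable_on prime_powers \<times> gnz"
    by (rule abs_summable_summable)
  have bij: "bij_betw h (prime_powers \<times> gnz) (Sigma gnz prime_power_divs)"
  proof (rule bij_betw_byWitness[of _ "\<lambda>(z, (p, m)). ((p, m), z / p ^ m)"])
    show "\<forall>x\<in>prime_powers \<times> gnz. (case h x of (z, p, m) \<Rightarrow> ((p, m), z / p ^ m)) = x"
      by (auto simp: gauss_primeD h_def)
    show "\<forall>x\<in>Sigma gnz prime_power_divs. h (case x of (z, p, m) \<Rightarrow> ((p, m), z / p ^ m)) = x"
      by (auto simp: gauss_primeD prime_power_divs_def h_def)
    show "h ` (prime_powers \<times> gnz) \<subseteq> Sigma gnz prime_power_divs"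
      by (auto simp: prime_power_divs_def gdvd_def gauss_primeD h_def)
    show "(\<lambda>(z, (p, m)). ((p, m), z / p ^ m)) ` Sigma gnz prime_power_divs \<subseteq> prime_powers \<times> gnz"
      by (auto simp: prime_power_divs_def gdvd_def gauss_primeD)
  qed
  have eq: "g (h x) = (\<lambda>(x, w). a x * hecke k s w) x" if x0: "x \<in> prime_powers \<times> gnz" for x
  proof -
    obtain p m w where x: "x = ((p, m), w)" "gauss_prime p" "w \<noteq> 0" using x0 by auto
    then have "p ^ m \<noteq> 0" using gauss_primeD by auto
    then show ?thesis using x by (simp add: hecke_mult g_def h_def a_def)
  qed
  have "(\<lambda>x. g (h x)) summable_on prime_powers \<times> gnz"
    by (rule summable_on_cong[OF eq, THEN iffD2, OF _ sAB])
  then have sg: "g summable_on Sigma gnz prime_power_divs"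
    by (rule summable_on_reindex_bij_betw[OF bij, THEN iffD1])
  have "hecke_L k s * hecke_Lambda k s = (\<Sum>\<^sub>\<infinity>x\<in>prime_powers. a x * (\<Sum>\<^sub>\<infinity>w\<in>gnz. hecke k s w))"
    unfolding hecke_L_def hecke_Lambda_def a_def case_prod_unfold
    by (subst infsum_cmult_left') (rule mult.commute)
  also have "\<dots> = (\<Sum>\<^sub>\<infinity>x\<in>prime_powers. \<Sum>\<^sub>\<infinity>w\<in>gnz. a x * hecke k s w)"
    by (simp only: infsum_cmult_right')
  also have "\<dots> = infsum (\<lambda>(x, w). a x * hecke k s w) (prime_powers \<times> gnz)"
    using infsum_Sigma_banach[OF sAB] by simp
  also have "\<dots> = infsum (\<lambda>x. g (h x)) (prime_powers \<times> gnz)"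
    by (rule infsum_cong[OF eq, symmetric])
  also have "\<dots> = infsum g (Sigma gnz prime_power_divs)"
    by (rule infsum_reindex_bij_betw[OF bij])
  also have "\<dots> = (\<Sum>\<^sub>\<infinity>z\<in>gnz. \<Sum>\<^sub>\<infinity>y\<in>prime_power_divs z. g (z, y))"
    using infsum_Sigma_banach[OF sg] by simp
  also have "\<dots> = (\<Sum>\<^sub>\<infinity>z\<in>gnz. 4 * (of_real (lnorm z) * hecke k s z))"
  proof (rule infsum_cong)
    fix z assume z: "z \<in> gnz"
    have "(\<Sum>\<^sub>\<infinity>y\<in>prime_power_divs z. g (z, y)) = (\<Sum>y\<in>prime_power_divs z. g (z, y))"
      using z by (intro infsum_finite finite_prime_power_divs) auto
    also have "\<dots> = of_real (\<Sum>(p, m)\<in>prime_power_divs z. lnorm p) * hecke k s z"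
      by (simp add: sum_distrib_right case_prod_unfold g_def)
    also have "\<dots> = 4 * (of_real (lnorm z) * hecke k s z)"
      using sum_lnorm_prime_power_divs[of z] z by simp
    finally show "(\<Sum>\<^sub>\<infinity>y\<in>prime_power_divs z. g (z, y)) = 4 * (of_real (lnorm z) * hecke k s z)" .
  qed
  also have "\<dots> = 4 * (\<Sum>\<^sub>\<infinity>z\<in>gnz. of_real (lnorm z) * hecke k s z)" by (rule infsum_cmult_right')
  finally show ?thesis .
qed

lemma deriv_hecke_L:
  assumes "Re s > 1"
  shows "hecke_L k s * hecke_Lambda k s = -4 * deriv (hecke_L k) s"
  using hecke_L_mult_Lambda[OF assms] DERIV_imp_deriv[OF hecke_L_has_field_derivative[OF assms]] by simp

text \<open>Far to the right the four units dominate, each contributing 1. This will exclude that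
  the continued function vanishes identically.\<close>

lemma hecke_L_nonzero_at:
  obtains c :: real where "c > 1" "hecke_L k (of_real c) \<noteq> 0"
proof -
  let ?U = "{1, -1, \<i>, -\<i>}"
  have U: "?U \<subseteq> gnz" by auto
  define B where "B = (\<Sum>\<^sub>\<infinity>z\<in>gnz - ?U. exp (-(2 * lnorm z)))"
  have s2: "(\<lambda>z. exp (-(2 * lnorm z))) summable_on gnz - ?U"
    by (rule summable_on_subset_banach[OF summable_on_exp_lnorm]) auto
  \<comment> \<open>Moving from the exponent 2 to 2 + n gains 2^(-n) on every nonunit, since these
    have N(z) \<ge> 2; and B < n < 2^n makes the remainder smaller than 1.\<close>
  define n where "n = nat \<lceil>B\<rceil> + 1"
  have nB: "B < real n" unfolding n_def by linarith
  have n2: "real n < 2 ^ n" using less_exp[of n] by (metis of_nat_less_iff of_nat_numeral of_nat_power)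
  define c where "c = 2 + real n"
  have c1: "c > 1" by (simp add: c_def)
  have sc: "hecke k (of_real c) summable_on gnz" using c1 by (intro hecke_summable) auto
  have sc': "hecke k (of_real c) summable_on gnz - ?U" by (rule summable_on_subset_banach[OF sc]) auto
  have "hecke_L k (of_real c) = (\<Sum>\<^sub>\<infinity>z\<in>?U \<union> (gnz - ?U). hecke k (of_real c) z)"
    unfolding hecke_L_def using U by (intro arg_cong[of _ _ "infsum _"]) blast
  also have "\<dots> = (\<Sum>\<^sub>\<infinity>z\<in>?U. hecke k (of_real c) z) + (\<Sum>\<^sub>\<infinity>z\<in>gnz - ?U. hecke k (of_real c) z)"
    using sc' by (intro infsum_Un_disjoint) auto
  also have "(\<Sum>\<^sub>\<infinity>z\<in>?U. hecke k (of_real c) z) = (\<Sum>z\<in>?U. 1)"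
    by (subst infsum_finite) (auto intro!: sum.cong hecke_unit simp: gauss_unit_iff simp del: sum_constant)
  also have "\<dots> = 4" by (auto simp: complex_eq_iff card_insert_if)
  finally have L: "hecke_L k (of_real c) = 4 + (\<Sum>\<^sub>\<infinity>z\<in>gnz - ?U. hecke k (of_real c) z)" .
  have "norm (\<Sum>\<^sub>\<infinity>z\<in>gnz - ?U. hecke k (of_real c) z) \<le> 1 / 2 ^ n * B"
  proof (rule norm_infsum_le)
    show "(hecke k (of_real c) has_sum (\<Sum>\<^sub>\<infinity>z\<in>gnz - ?U. hecke k (of_real c) z)) (gnz - ?U)" using sc' by simp
    show "((\<lambda>z. 1 / 2 ^ n * exp (-(2 * lnorm z))) has_sum 1 / 2 ^ n * B) (gnz - ?U)"
      unfolding B_def using s2 by (intro has_sum_cmult_right) simp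
    fix z assume z: "z \<in> gnz - ?U"
    then have "norm z \<noteq> 1" using norm_1_imp_gauss_unit[of z] gauss_unit_iff[of z] by auto
    moreover have "norm z \<ge> 1" using z gauss_int_norm_ge_1 by auto
    ultimately have "(norm z)\<^sup>2 > 1" by (simp add: one_less_power)
    moreover obtain j where "(norm z)\<^sup>2 = of_int j" using gauss_int_norm_sq_Ints[of z] z by (auto simp: Ints_def)
    ultimately have "exp (lnorm z) \<ge> 2" using z by (simp add: exp_lnorm_eq)
    then have "2 ^ n \<le> exp (lnorm z) ^ n" by (intro power_mono) auto
    then have "2 ^ n \<le> exp (real n * lnorm z)" by (simp add: exp_of_nat_mult)
    then have "1 / exp (real n * lnorm z) \<le> 1 / 2 ^ n" by (intro divide_left_mono) auto
    then have "exp (-(real n * lnorm z)) \<le> 1 / 2 ^ n" by (simp add: exp_minus field_simps)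
    then have "exp (-(real n * lnorm z)) * exp (-(2 * lnorm z)) \<le> 1 / 2 ^ n * exp (-(2 * lnorm z))"
      by (intro mult_right_mono) auto
    moreover have "norm (hecke k (of_real c) z) = exp (-(real n * lnorm z)) * exp (-(2 * lnorm z))"
      using z by (simp add: norm_hecke c_def exp_add[symmetric] algebra_simps)
    ultimately show "norm (hecke k (of_real c) z) \<le> 1 / 2 ^ n * exp (-(2 * lnorm z))" by simp
  qed
  moreover have "1 / 2 ^ n * B < 1" using order.strict_trans[OF nB n2] by simp
  ultimately have "norm (\<Sum>\<^sub>\<infinity>z\<in>gnz - ?U. hecke k (of_real c) z) < 4" by linarith
  then have "hecke_L k (of_real c) \<noteq> 0" unfolding L
    by (metis add_eq_0_iff norm_minus_cancel norm_numeral less_irrefl)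
  then show ?thesis using that c1 by blast
qed

section \<open>Analytic continuation\<close>

lemma norm_exp_minus_1_le:
  fixes w :: complex
  shows "norm (exp w - 1) \<le> norm w * exp (norm w)"
proof -
  have "norm (exp w - exp 0) \<le> exp (norm w) * norm (w - 0)"
  proof (rule field_differentiable_bound[of "cball 0 (norm w)" exp exp])
    fix z :: complex assume "z \<in> cball 0 (norm w)"
    then have "Re z \<le> norm w" using complex_Re_le_cmod[of z] by simp
    then show "norm (exp z) \<le> exp (norm w)" by simp
    show "(exp has_field_derivative exp z) (at z within cball 0 (norm w))"
      by (auto intro: derivative_eq_intros)
  qed auto
  then show ?thesis by (simp add: mult.commute)
qed

lemma norm_power_int_diff_le:
  fixes x y :: complex
  assumes "norm x = 1" "norm y = 1"
  shows "norm (x powi n - y powi n) \<le> of_int \<bar>n\<bar> * norm (x - y)"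
proof (cases "n \<ge> 0")
  case True
  then show ?thesis using norm_power_diff[of x y "nat n"] assms by (simp add: power_int_def)
next
  case False
  have "x \<noteq> 0" "y \<noteq> 0" using assms by auto
  then have "norm (inverse x - inverse y) = norm (x - y)"
    using assms by (simp add: inverse_diff_inverse norm_mult norm_inverse norm_minus_commute)
  then show ?thesis
    using False norm_power_diff[of "inverse x" "inverse y" "nat (-n)"] assms
    by (simp add: power_int_def norm_inverse)
qed

lemma norm_sgn_diff_le:
  fixes z r :: complex
  assumes "z \<noteq> 0" "z + r \<noteq> 0"
  shows "norm (sgn (z + r) - sgn z) \<le> 2 * norm r / norm z"
proof -
  have "sgn (z + r) - sgn z = (of_real (norm z - norm (z + r)) * sgn (z + r) + r) / of_real (norm z)"
    using assms by (simp add: sgn_eq field_simps)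
  also have "norm \<dots> \<le> (\<bar>norm z - norm (z + r)\<bar> * 1 + norm r) / norm z"
    unfolding norm_divide norm_of_real abs_norm_cancel using assms
    by (intro divide_right_mono order_trans[OF norm_triangle_ineq] add_mono) (auto simp: norm_mult norm_sgn)
  also have "\<dots> \<le> (2 * norm r) / norm z"
    using norm_triangle_ineq3[of z "z + r"] by (intro divide_right_mono) auto
  finally show ?thesis by simp
qed

lemma abs_ln_diff_le:
  fixes a b m :: real
  assumes "m > 0" "a \<ge> m" "b \<ge> m"
  shows "\<bar>ln a - ln b\<bar> \<le> \<bar>a - b\<bar> / m"
proof -
  have "ln x - ln y \<le> \<bar>x - y\<bar> / m" if "x \<ge> m" "y \<ge> m" for x y
  proof -
    have "ln x - ln y \<le> (x - y) / y" using that assms by (intro ln_diff_le) auto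
    also have "\<dots> \<le> \<bar>x - y\<bar> / y" using that assms by (intro divide_right_mono) auto
    also have "\<dots> \<le> \<bar>x - y\<bar> / m" using that assms by (intro divide_left_mono) auto
    finally show ?thesis .
  qed
  from this[of a b] this[of b a] show ?thesis using assms by (simp add: abs_if split: if_splits)
qed

text \<open>A bounded shift moves both the direction \<open>sgn z\<close> and the logarithmic norm
  by O(1/|z|). The factor 1/|z| is N(z)^(-1/2), hence the exponent
  \<open>Re s + 1/2\<close>.\<close>

lemma norm_hecke_diff_le:
  assumes z: "norm z \<ge> sqrt 2" and r: "norm r \<le> 1"
  shows "norm (hecke k s (z + r) - hecke k s z) \<le>
    8 * (\<bar>of_int k\<bar> + norm s) * exp (8 * norm s) * exp (-((Re s + 1/2) * lnorm z))"
proof -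
  define a where "a = norm z"
  \<comment> \<open>4/3 is the threshold beyond which a - 1 \<ge> a/4; thus z + r stays away from 0
    at a distance comparable with |z|.\<close>
  have s2: "sqrt 2 > 4/3" by (rule real_less_rsqrt) (simp add: power2_eq_square)
  then have a: "a > 4/3" using z by (simp add: a_def)
  have b: "norm (z + r) \<ge> a / 4" using norm_diff_ineq[of z r] r a by (simp add: a_def)
  have nz: "z \<noteq> 0" "z + r \<noteq> 0" using a b by (auto simp: a_def)
  define d where "d = lnorm (z + r) - lnorm z"
  have "\<bar>ln (norm (z + r)) - ln (norm z)\<bar> \<le> \<bar>norm (z + r) - norm z\<bar> / (a / 4)"
    using a b by (intro abs_ln_diff_le) (auto simp: a_def)
  also have "\<dots> \<le> 1 / (a / 4)"
    using norm_triangle_ineq3[of "z + r" z] r a by (intro divide_right_mono) auto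
  finally have d: "\<bar>d\<bar> \<le> 8 / a" unfolding d_def lnorm_def by (simp add: abs_if split: if_splits)
  have a8: "8 / a \<le> 8" using a by (simp add: field_simps)
  have sd: "norm (s * of_real d) \<le> norm s * (8 / a)" using mult_left_mono[OF d norm_ge_zero[of s]] by (simp add: norm_mult)
  also have "\<dots> \<le> norm s * 8" using a8 by (intro mult_left_mono) auto
  finally have sd8: "norm (s * of_real d) \<le> 8 * norm s" by simp
  define E where "E = exp (-(s * of_real d))"
  have E: "norm E \<le> exp (8 * norm s)"
  proof -
    have "norm E \<le> exp (norm (-(s * of_real d)))" unfolding E_def by (rule norm_exp)
    also have "\<dots> \<le> exp (8 * norm s)" using sd8 by simp
    finally show ?thesis .
  qed
  have E1: "norm (E - 1) \<le> norm s * (8 / a) * exp (8 * norm s)"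
  proof -
    have "norm (E - 1) \<le> norm (-(s * of_real d)) * exp (norm (-(s * of_real d)))"
      unfolding E_def by (rule norm_exp_minus_1_le)
    also have "\<dots> \<le> (norm s * (8 / a)) * exp (8 * norm s)"
      using sd sd8 a by (intro mult_mono) auto
    finally show ?thesis .
  qed
  define X Y where "X = sgn (z + r) powi (4 * k)" and "Y = sgn z powi (4 * k)"
  have "norm (X - Y) \<le> of_int \<bar>4 * k\<bar> * norm (sgn (z + r) - sgn z)"
    unfolding X_def Y_def using nz by (intro norm_power_int_diff_le) (auto simp: norm_sgn)
  also have "\<dots> \<le> of_int \<bar>4 * k\<bar> * (2 / a)"
  proof (intro mult_left_mono)
    have "norm (sgn (z + r) - sgn z) \<le> 2 * norm r / a" unfolding a_def by (rule norm_sgn_diff_le[OF nz])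
    also have "\<dots> \<le> 2 / a" using r a by (intro divide_right_mono) auto
    finally show "norm (sgn (z + r) - sgn z) \<le> 2 / a" .
  qed auto
  finally have XY: "norm (X - Y) \<le> \<bar>of_int k\<bar> * (8 / a)" by (simp add: abs_mult mult.commute)
  have Y1: "norm Y = 1" using nz by (simp only: Y_def norm_power_int norm_sgn) simp
  define e where "e = exp (-(s * of_real (lnorm z)))"
  have ne: "norm e = exp (-(Re s * lnorm z))" by (simp only: e_def norm_exp_eq_Re) simp
  have "-(s * of_real (lnorm (z + r))) = -(s * of_real (lnorm z)) + -(s * of_real d)"
    by (simp add: d_def algebra_simps)
  then have "hecke k s (z + r) = X * (e * E)" unfolding hecke_def X_def e_def E_def by (simp only: exp_add)
  moreover have "hecke k s z = Y * e" by (simp add: hecke_def Y_def e_def)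
  ultimately have "hecke k s (z + r) - hecke k s z = e * ((X - Y) * E + Y * (E - 1))"
    by (simp add: algebra_simps)
  then have "norm (hecke k s (z + r) - hecke k s z) = norm e * norm ((X - Y) * E + Y * (E - 1))"
    by (simp add: norm_mult)
  also have "\<dots> \<le> norm e * (norm (X - Y) * norm E + norm Y * norm (E - 1))"
    by (intro mult_left_mono order_trans[OF norm_triangle_ineq]) (simp_all add: norm_mult)
  also have "\<dots> \<le> norm e * (\<bar>of_int k\<bar> * (8 / a) * exp (8 * norm s) + 1 * (norm s * (8 / a) * exp (8 * norm s)))"
    using XY E E1 Y1 a by (intro mult_left_mono add_mono mult_mono) auto
  also have "\<dots> = 8 * (\<bar>of_int k\<bar> + norm s) * exp (8 * norm s) * (norm e * (1 / a))"
    by (simp add: algebra_simps)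
  also have "norm e * (1 / a) = exp (-((Re s + 1/2) * lnorm z))"
  proof -
    have "1 / a = exp (-(1/2 * lnorm z))" using nz by (simp add: lnorm_def a_def exp_minus field_simps)
    moreover have "-((Re s + 1/2) * lnorm z) = -(Re s * lnorm z) + -(1/2 * lnorm z)" by (simp add: algebra_simps)
    ultimately show ?thesis unfolding ne by (simp only: exp_add)
  qed
  finally show ?thesis .
qed

text \<open>Representatives in the closed unit disc and \<open>norm \<alpha> \<ge> sqrt 2\<close>
  are what \<open>norm_hecke_diff_le\<close> asks of the shift \<open>r\<close> and of
  \<open>\<alpha> * w\<close> with \<open>w \<noteq> 0\<close>.\<close>

definition residue_system :: "complex \<Rightarrow> complex set \<Rightarrow> bool" where
  "residue_system \<alpha> R \<longleftrightarrow> \<alpha> \<in> gauss_ints \<and> norm \<alpha> \<ge> sqrt 2 \<and> finite R \<and> 0 \<in> R \<and> R \<subseteq> gauss_ints \<and>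
     (\<forall>r\<in>R. norm r \<le> 1) \<and> of_nat (card R) = (norm \<alpha>)\<^sup>2 \<and> bij_betw (\<lambda>(w, r). \<alpha> * w + r) (gauss_ints \<times> R) gauss_ints"

text \<open>The finite sum restores the nonzero elements \<open>\<alpha> * w + r\<close> with
  \<open>w = 0\<close>, which the infinite sum omits.\<close>

definition hecke_cont :: "complex \<Rightarrow> complex set \<Rightarrow> int \<Rightarrow> complex \<Rightarrow> complex" where
  "hecke_cont \<alpha> R k s =
     (\<Sum>\<^sub>\<infinity>x\<in>gnz \<times> R. hecke k s (\<alpha> * fst x + snd x) - hecke k s (\<alpha> * fst x)) + (\<Sum>r\<in>R - {0}. hecke k s r)"

text \<open>A shift by a bounded \<open>r\<close> gains a factor \<open>1 / norm z\<close>, which moves the abscissa of absolute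
  convergence from \<open>1\<close> to \<open>1/2\<close>.\<close>

lemma hecke_cont_holomorphic:
  assumes "residue_system \<alpha> R"
  shows "hecke_cont \<alpha> R k holomorphic_on {s. Re s > 1/2}"
proof -
  have R: "\<alpha> \<in> gauss_ints" "norm \<alpha> \<ge> sqrt 2" "finite R" "\<And>r. r \<in> R \<Longrightarrow> norm r \<le> 1"
    using assms by (auto simp: residue_system_def)
  have \<alpha>0: "\<alpha> \<noteq> 0" using R(2) by auto
  have "(\<lambda>s. \<Sum>\<^sub>\<infinity>x\<in>gnz \<times> R. hecke k s (\<alpha> * fst x + snd x) - hecke k s (\<alpha> * fst x))
     field_differentiable at s" if s: "Re s > 1/2" for s
  proof -
    \<comment> \<open>Half the distance to the line Re = 1/2, so that on the whole disc the gained
      exponent stays at least \<open>c > 1\<close>.\<close>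
    define \<rho> where "\<rho> = (Re s - 1/2) / 2"
    have \<rho>: "\<rho> > 0" using s by (simp add: \<rho>_def)
    define B where "B = norm s + \<rho>"
    define C where "C = 8 * (\<bar>of_int k\<bar> + B) * exp (8 * B)"
    define c where "c = Re s - \<rho> + 1/2"
    have c1: "c > 1" using s by (simp add: c_def \<rho>_def field_simps)
    have "(\<lambda>(w, r). C * exp (-(c * lnorm w)) * 1) summable_on gnz \<times> R"
      using R \<rho> by (intro summable_on_mult_product summable_on_cmult_right summable_on_exp_lnorm c1)
        (auto simp: C_def B_def)
    then have sm: "(\<lambda>x. C * exp (-(c * lnorm (fst x)))) summable_on gnz \<times> R"
      by (simp add: case_prod_unfold)
    have "((\<lambda>s. \<Sum>\<^sub>\<infinity>x\<in>gnz \<times> R. hecke k s (\<alpha> * fst x + snd x) - hecke k s (\<alpha> * fst x))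
       has_field_derivative (\<Sum>\<^sub>\<infinity>x\<in>gnz \<times> R. -(of_real (lnorm (\<alpha> * fst x + snd x)) * hecke k s (\<alpha> * fst x + snd x))
         - -(of_real (lnorm (\<alpha> * fst x)) * hecke k s (\<alpha> * fst x)))) (at s)"
    proof (rule infsum_has_field_derivative[OF \<rho> _ _ sm])
      fix x w assume x: "x \<in> gnz \<times> R" and w: "w \<in> cball s \<rho>"
      show "((\<lambda>s. hecke k s (\<alpha> * fst x + snd x) - hecke k s (\<alpha> * fst x)) has_field_derivative
        -(of_real (lnorm (\<alpha> * fst x + snd x)) * hecke k w (\<alpha> * fst x + snd x))
         - -(of_real (lnorm (\<alpha> * fst x)) * hecke k w (\<alpha> * fst x))) (at w)"
        by (intro DERIV_diff hecke_has_field_derivative)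
      obtain y r where yr: "x = (y, r)" "y \<in> gauss_ints" "y \<noteq> 0" "r \<in> R" using x by auto
      have y1: "norm y \<ge> 1" using gauss_int_norm_ge_1 yr by auto
      have "norm (\<alpha> * y) \<ge> sqrt 2" using R(2) y1 mult_mono[of "sqrt 2" "norm \<alpha>" 1 "norm y"] by (simp add: norm_mult)
      then have "norm (hecke k w (\<alpha> * y + r) - hecke k w (\<alpha> * y)) \<le>
         8 * (\<bar>of_int k\<bar> + norm w) * exp (8 * norm w) * exp (-((Re w + 1/2) * lnorm (\<alpha> * y)))"
        using R yr by (intro norm_hecke_diff_le) auto
      also have "\<dots> \<le> C * exp (-(c * lnorm y))"
      proof -
        have "norm (w - s) \<le> \<rho>" using w by (simp add: dist_norm norm_minus_commute)
        then have "norm w \<le> B" using norm_triangle_sub[of w s] by (simp add: B_def)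
        then have "8 * (\<bar>of_int k\<bar> + norm w) * exp (8 * norm w) \<le> C"
          unfolding C_def using norm_ge_zero[of w] by (intro mult_mono add_mono add_nonneg_nonneg mult_nonneg_nonneg) (auto simp del: norm_ge_zero)
        moreover have "c * lnorm y \<le> (Re w + 1/2) * lnorm (\<alpha> * y)"
        proof (rule mult_mono)
          have "Re s - Re w \<le> \<rho>" using w abs_Re_le_cmod[of "s - w"] by (simp add: dist_norm)
          then show "c \<le> Re w + 1/2" by (simp add: c_def)
          then show "0 \<le> Re w + 1/2" using c1 by simp
          show "lnorm y \<le> lnorm (\<alpha> * y)" using lnorm_mult[OF \<alpha>0 yr(3)] lnorm_nonneg[OF R(1)] by simp
        qed (use lnorm_nonneg yr in auto)
        ultimately show ?thesis using \<rho> by (intro mult_mono) (auto simp: C_def B_def)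
      qed
      finally show "norm (hecke k w (\<alpha> * fst x + snd x) - hecke k w (\<alpha> * fst x)) \<le> C * exp (-(c * lnorm (fst x)))"
        using yr by simp
    qed
    then show ?thesis by (auto simp: field_differentiable_def)
  qed
  then have "(\<lambda>s. \<Sum>\<^sub>\<infinity>x\<in>gnz \<times> R. hecke k s (\<alpha> * fst x + snd x) - hecke k s (\<alpha> * fst x))
      holomorphic_on {s. Re s > 1/2}"
    by (auto simp: holomorphic_on_def intro: field_differentiable_at_within)
  then show ?thesis unfolding hecke_cont_def[abs_def]
    by (intro holomorphic_on_add holomorphic_on_sum hecke_holomorphic)
qed

text \<open>Sorting the nonzero elements by quotient and remainder modulo \<open>\<alpha>\<close>
  reproduces \<open>hecke_L\<close>, while the subtracted terms do not depend on \<open>r\<close>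
  and sum to \<open>card R * hecke k s \<alpha>\<close> times \<open>hecke_L\<close>.\<close>

lemma hecke_cont_eq:
  assumes "residue_system \<alpha> R" and s: "Re s > 1"
  shows "hecke_cont \<alpha> R k s = (1 - of_nat (card R) * hecke k s \<alpha>) * hecke_L k s"
proof -
  have R: "\<alpha> \<in> gauss_ints" "norm \<alpha> \<ge> sqrt 2" "finite R" "0 \<in> R" "R \<subseteq> gauss_ints"
    and bij: "bij_betw (\<lambda>(w, r). \<alpha> * w + r) (gauss_ints \<times> R) gauss_ints"
    using assms by (auto simp: residue_system_def)
  have \<alpha>0: "\<alpha> \<noteq> 0" using R(2) by auto
  let ?f = "\<lambda>x. \<alpha> * fst x + snd x :: complex"
  have bij': "bij_betw ?f (gauss_ints \<times> R) gauss_ints" using bij by (simp add: case_prod_unfold)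
  have "bij_betw ?f (gauss_ints \<times> R - {0} \<times> R) (gauss_ints - ?f ` ({0} \<times> R))"
    using bij' R by (intro bij_betw_DiffI) (auto intro: bij_betw_subset)
  moreover have "?f ` ({0} \<times> R) = R" by force
  moreover have "gauss_ints \<times> R - {0} \<times> R = gnz \<times> R" by auto
  moreover have "gauss_ints - R = gnz - (R - {0})" using R by auto
  ultimately have b: "bij_betw ?f (gnz \<times> R) (gnz - (R - {0}))" by simp
  have sL: "hecke k s summable_on gnz" by (rule hecke_summable[OF s])
  have sL': "hecke k s summable_on gnz - (R - {0})" by (rule summable_on_subset_banach[OF sL]) auto
  have s1: "(\<lambda>x. hecke k s (?f x)) summable_on gnz \<times> R"
    using summable_on_reindex_bij_betw[OF b, of "hecke k s"] sL' by simp
  have i1: "infsum (\<lambda>x. hecke k s (?f x)) (gnz \<times> R) = hecke_L k s - (\<Sum>r\<in>R - {0}. hecke k s r)"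
  proof -
    have "infsum (\<lambda>x. hecke k s (?f x)) (gnz \<times> R) = infsum (hecke k s) (gnz - (R - {0}))"
      by (rule infsum_reindex_bij_betw[OF b])
    also have "\<dots> = infsum (hecke k s) gnz - infsum (hecke k s) (R - {0})"
      using R sL by (intro infsum_Diff) auto
    finally show ?thesis using R by (simp add: hecke_L_def)
  qed
  have "(\<lambda>x. norm (hecke k s x)) summable_on gnz" using sL summable_on_iff_abs_summable_on_complex by blast
  then have "(\<lambda>(w, r). norm (hecke k s w) * 1) summable_on gnz \<times> R"
    using R by (intro summable_on_mult_product) auto
  then have "(\<lambda>x. norm (hecke k s (fst x))) summable_on gnz \<times> R" by (simp add: case_prod_unfold)
  then have s2': "(\<lambda>x. hecke k s (fst x)) summable_on gnz \<times> R" by (rule abs_summable_summable)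
  have eq2: "hecke k s (\<alpha> * fst x) = hecke k s \<alpha> * hecke k s (fst x)" if "x \<in> gnz \<times> R" for x
    using that \<alpha>0 by (intro hecke_mult) auto
  have s2: "(\<lambda>x. hecke k s (\<alpha> * fst x)) summable_on gnz \<times> R"
    by (rule summable_on_cong[OF eq2, THEN iffD2, OF _ summable_on_cmult_right[OF s2']])
  have "infsum (\<lambda>x. hecke k s (\<alpha> * fst x)) (gnz \<times> R) = hecke k s \<alpha> * infsum (\<lambda>x. hecke k s (fst x)) (gnz \<times> R)"
    unfolding infsum_cmult_right'[symmetric] by (rule infsum_cong[OF eq2])
  also have "infsum (\<lambda>x. hecke k s (fst x)) (gnz \<times> R) = infsum (\<lambda>w. infsum (\<lambda>r. hecke k s w) R) gnz"
    using infsum_Sigma_banach[OF s2'] by simp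
  also have "\<dots> = infsum (\<lambda>w. of_nat (card R) * hecke k s w) gnz" using R by simp
  also have "\<dots> = of_nat (card R) * hecke_L k s" unfolding hecke_L_def by (rule infsum_cmult_right')
  finally have i2: "infsum (\<lambda>x. hecke k s (\<alpha> * fst x)) (gnz \<times> R) = hecke k s \<alpha> * (of_nat (card R) * hecke_L k s)" .
  have "infsum (\<lambda>x. hecke k s (?f x) - hecke k s (\<alpha> * fst x)) (gnz \<times> R) =
     infsum (\<lambda>x. hecke k s (?f x)) (gnz \<times> R) - infsum (\<lambda>x. hecke k s (\<alpha> * fst x)) (gnz \<times> R)"
    using infsum_add[OF s1 summable_on_uminus[THEN iffD2, OF s2]] by (simp add: infsum_uminus)
  then show ?thesis unfolding hecke_cont_def i1 i2 by (simp add: algebra_simps)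
qed

section \<open>Residue systems modulo 1 + i and 2 +- i, and the independence of their
  factors\<close>

lemma residue_system_1_i: "residue_system (1 + \<i>) {0, 1}"
proof -
  have norm: "norm (1 + \<i>) = sqrt 2" by (simp add: cmod_def)
  have "bij_betw (\<lambda>(w, r). (1 + \<i>) * w + r) (gauss_ints \<times> {0, 1}) gauss_ints"
    unfolding bij_betw_def
  proof
    show "inj_on (\<lambda>(w, r). (1 + \<i>) * w + r) (gauss_ints \<times> {0, 1})"
    proof (rule inj_onI; clarify)
      fix w r v q assume h: "w \<in> gauss_ints" "v \<in> gauss_ints" "r \<in> {0, 1}" "q \<in> {0, 1}"
        "(1 + \<i>) * w + r = (1 + \<i>) * v + q"
      have "(1 + \<i>) * (w - v) = q - r" using h(5) by (simp add: algebra_simps)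
      then have "sqrt 2 * norm (w - v) = norm (q - r)" by (metis norm norm_mult)
      moreover have "norm (q - r) \<le> 1" using h by auto
      moreover have "norm (w - v) \<ge> 1" if "w \<noteq> v" using gauss_int_norm_ge_1[of "w - v"] h that by auto
      moreover have "sqrt 2 \<le> sqrt 2 * norm (w - v)" if "norm (w - v) \<ge> 1" using that by simp
      moreover have "sqrt 2 > 1" by simp
      ultimately have "w = v" by linarith
      then show "w = v \<and> r = q" using h by simp
    qed
    show "(\<lambda>(w, r). (1 + \<i>) * w + r) ` (gauss_ints \<times> {0, 1}) = gauss_ints"
    proof (intro equalityI subsetI)
      fix z assume "z \<in> gauss_ints"
      then obtain a b where z: "z = Complex (of_int a) (of_int b)" by (rule gauss_intsE)
      \<comment> \<open>The residue of a + bi modulo 1 + i is the parity of a + b.\<close>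
      obtain j r where jr: "a + b = 2 * j + r" "r \<in> {0, 1}"
        by (metis mod_mult_div_eq insertCI mod2_eq_if add.commute)
      have "z = (1 + \<i>) * Complex (of_int j) (of_int (b - j)) + of_int r"
        using arg_cong[OF jr(1), of "of_int :: int \<Rightarrow> real"] by (simp add: z complex_eq_iff)
      moreover have "(of_int r :: complex) \<in> {0, 1}" using jr by auto
      ultimately show "z \<in> (\<lambda>(w, r). (1 + \<i>) * w + r) ` (gauss_ints \<times> {0, 1})"
        by (auto intro!: image_eqI[of _ _ "(Complex (of_int j) (of_int (b - j)), of_int r)"])
    qed auto
  qed
  then show ?thesis unfolding residue_system_def using norm by auto
qed

lemma bij_betw_residues_2_i:
  assumes e: "e = 1 \<or> e = (-1::int)" and R: "R = {0, 1, -1, \<i>, -\<i>}"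
  shows "bij_betw (\<lambda>(w, r). Complex 2 (of_int e) * w + r) (gauss_ints \<times> R) gauss_ints"
  unfolding bij_betw_def
proof
  have norm: "norm (Complex 2 (of_int e)) = sqrt 5" using e by (auto simp: cmod_def)
  have s5: "sqrt 5 > 2" by (rule real_less_rsqrt) simp
  have R1: "norm r \<le> 1" if "r \<in> R" for r using that R by auto
  show "inj_on (\<lambda>(w, r). Complex 2 (of_int e) * w + r) (gauss_ints \<times> R)"
  proof (rule inj_onI; clarify)
    fix w r v q assume h: "w \<in> gauss_ints" "v \<in> gauss_ints" "r \<in> R" "q \<in> R"
      "Complex 2 (of_int e) * w + r = Complex 2 (of_int e) * v + q"
    have "Complex 2 (of_int e) * (w - v) = q - r" using h(5) by (simp add: algebra_simps)
    then have "sqrt 5 * norm (w - v) = norm (q - r)" by (metis norm norm_mult)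
    moreover have "norm (q - r) \<le> 2" using norm_triangle_ineq4[of q r] R1[OF h(3)] R1[OF h(4)] by simp
    moreover have "norm (w - v) \<ge> 1" if "w \<noteq> v" using gauss_int_norm_ge_1[of "w - v"] h that by auto
    moreover have "sqrt 5 \<le> sqrt 5 * norm (w - v)" if "norm (w - v) \<ge> 1" using that by simp
    ultimately have "w = v" using s5 by linarith
    then show "w = v \<and> r = q" using h by simp
  qed
  show "(\<lambda>(w, r). Complex 2 (of_int e) * w + r) ` (gauss_ints \<times> R) = gauss_ints"
  proof (intro equalityI subsetI)
    fix z assume "z \<in> gauss_ints"
    then obtain a b where z: "z = Complex (of_int a) (of_int b)" by (rule gauss_intsE)
    have "\<exists>x y c d. a = 2 * x - e * y + c \<and> b = 2 * y + e * x + d \<and> (c, d) \<in> {(0, 0), (1, 0), (-1, 0), (0, 1), (0, -1)}"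
    proof -
      \<comment> \<open>The coordinates of z / (2 + e i), obtained by multiplying with the conjugate
        and dividing by the norm 5; adding 2 before \<open>div\<close> rounds to the nearest
        integer. The remainder times the conjugate then has coordinates in [-2, 2], which leaves
        only the five residues.\<close>
      define x y where "x = (2 * a + e * b + 2) div 5" and "y = (2 * b - e * a + 2) div 5"
      define c d where "c = a - 2 * x + e * y" and "d = b - 2 * y - e * x"
      have x: "-2 \<le> 2 * a + e * b - 5 * x" "2 * a + e * b - 5 * x \<le> 2"
        and y: "-2 \<le> 2 * b - e * a - 5 * y" "2 * b - e * a - 5 * y \<le> 2"
        unfolding x_def y_def by linarith+
      have "2 * a + e * b - 5 * x = 2 * c + e * d" "2 * b - e * a - 5 * y = 2 * d - e * c"
        using e unfolding c_def d_def by (auto simp: algebra_simps)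
      then have cd: "-2 \<le> 2 * c + e * d" "2 * c + e * d \<le> 2" "-2 \<le> 2 * d - e * c" "2 * d - e * c \<le> 2"
        using x y by simp_all
      have "-1 \<le> c" "c \<le> 1" "-1 \<le> d" "d \<le> 1" using cd e by auto
      then have "c \<in> {-1, 0, 1}" "d \<in> {-1, 0, 1}" by auto
      then have "(c, d) \<in> {(0, 0), (1, 0), (-1, 0), (0, 1), (0, -1)}" using cd e by auto
      then show ?thesis by (intro exI[of _ x] exI[of _ y] exI[of _ c] exI[of _ d]) (simp add: c_def d_def)
    qed
    then obtain x y c d where xy: "a = 2 * x - e * y + c" "b = 2 * y + e * x + d"
      "(c, d) \<in> {(0, 0), (1, 0), (-1, 0), (0, 1), (0, -1)}" by blast
    have "z = Complex 2 (of_int e) * Complex (of_int x) (of_int y) + Complex (of_int c) (of_int d)"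
      using xy by (simp add: z complex_eq_iff)
    moreover have "Complex (of_int c) (of_int d) \<in> R" using xy(3) R by (auto simp: complex_eq_iff)
    ultimately show "z \<in> (\<lambda>(w, r). Complex 2 (of_int e) * w + r) ` (gauss_ints \<times> R)"
      by (auto intro!: image_eqI[of _ _ "(Complex (of_int x) (of_int y), Complex (of_int c) (of_int d))"])
  qed (use R in \<open>auto simp: gauss_ints_def\<close>)
qed

lemma residue_system_2_i:
  assumes e: "e = 1 \<or> e = (-1::int)"
  shows "residue_system (Complex 2 (of_int e)) {0, 1, -1, \<i>, -\<i>}"
proof -
  have norm: "norm (Complex 2 (of_int e)) = sqrt 5" using e by (auto simp: cmod_def)
  have "Complex (of_int 2) (of_int e) \<in> gauss_ints" by (rule gauss_ints_Complex)
  then show ?thesis unfolding residue_system_def using norm bij_betw_residues_2_i[OF e refl]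
    by (auto simp: complex_eq_iff card_insert_if)
qed

text \<open>Modulo 5 the powers of 2 + i alternate between 2 + i and 3 + 4i, so the imaginary part
  is never divisible by 5. Hence the direction of 2 + i is not a root of unity.\<close>

lemma power_2_i_not_real: "Im (Complex 2 1 ^ Suc n) \<noteq> 0"
proof -
  have "\<exists>a b :: int. Complex 2 1 ^ Suc n = Complex (of_int (5 * a + 2)) (of_int (5 * b + 1)) \<or>
      Complex 2 1 ^ Suc n = Complex (of_int (5 * a + 3)) (of_int (5 * b + 4))"
  proof (induction n)
    case 0
    show ?case by (rule exI[of _ 0], rule exI[of _ 0]) (simp add: complex_eq_iff)
  next
    case (Suc n)
    then consider a b :: int where "Complex 2 1 ^ Suc n = Complex (of_int (5 * a + 2)) (of_int (5 * b + 1))"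
      | a b :: int where "Complex 2 1 ^ Suc n = Complex (of_int (5 * a + 3)) (of_int (5 * b + 4))" by blast
    then show ?case
    proof cases
      case 1
      have "Complex 2 1 ^ Suc (Suc n) = Complex (of_int (5 * (2 * a - b) + 3)) (of_int (5 * (a + 2 * b) + 4))"
        by (subst power_Suc, subst 1) (simp add: complex_eq_iff)
      then show ?thesis by blast
    next
      case 2
      have "Complex 2 1 ^ Suc (Suc n) = Complex (of_int (5 * (2 * a - b) + 2)) (of_int (5 * (a + 2 * b + 2) + 1))"
        by (subst power_Suc, subst 2) (simp add: complex_eq_iff)
      then show ?thesis by blast
    qed
  qed
  then obtain b :: int where "Im (Complex 2 1 ^ Suc n) = of_int (5 * b + 1) \<or> Im (Complex 2 1 ^ Suc n) = of_int (5 * b + 4)"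
    by (metis complex.sel(2))
  moreover have "5 * b + 1 \<noteq> 0" "5 * b + 4 \<noteq> 0" by presburger+
  ultimately show ?thesis by (auto simp del: power_Suc of_int_add of_int_mult)
qed

lemma sgn_2_i_power_int_neq_1:
  assumes "n \<noteq> 0" shows "sgn (Complex 2 1) powi n \<noteq> 1"
proof
  assume h: "sgn (Complex 2 1) powi n = 1"
  define m where "m = nat \<bar>n\<bar> - 1"
  have m: "nat \<bar>n\<bar> = Suc m" using assms by (simp add: m_def)
  have "sgn (Complex 2 1) ^ nat \<bar>n\<bar> = 1"
    using h by (cases "n \<ge> 0") (auto simp: power_int_def power_inverse)
  then have "sgn (Complex 2 1) ^ Suc m = 1" using m by simp
  moreover have "Complex 2 1 = of_real (norm (Complex 2 1)) * sgn (Complex 2 1)"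
    by (simp add: sgn_eq)
  ultimately have "Complex 2 1 ^ Suc m = of_real (norm (Complex 2 1)) ^ Suc m"
    by (metis mult.right_neutral power_mult_distrib)
  also have "\<dots> = of_real (norm (Complex 2 1) ^ Suc m)" by simp
  finally have "Im (Complex 2 1 ^ Suc m) = 0" by (simp only: Im_complex_of_real)
  then show False using power_2_i_not_real by blast
qed

lemma ln_2_ln_5_independent:
  fixes n m :: int
  assumes "of_int n * ln 5 = of_int m * ln (2::real)" shows "n = 0"
proof (rule ccontr)
  assume n: "n \<noteq> 0"
  have "\<bar>of_int n * ln 5\<bar> = \<bar>of_int m * ln (2::real)\<bar>" using assms by simp
  then have "real (nat \<bar>n\<bar>) * ln 5 = real (nat \<bar>m\<bar>) * ln (2::real)" by (simp add: abs_mult)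
  then have "ln ((5::real) ^ nat \<bar>n\<bar>) = ln (2 ^ nat \<bar>m\<bar>)" by (simp add: ln_realpow)
  then have "(5::real) ^ nat \<bar>n\<bar> = 2 ^ nat \<bar>m\<bar>" by (subst (asm) ln_inj_iff) auto
  then have eq: "(5::nat) ^ nat \<bar>n\<bar> = 2 ^ nat \<bar>m\<bar>" by (metis of_nat_eq_iff of_nat_numeral of_nat_power)
  have "odd ((5::nat) ^ nat \<bar>n\<bar>)" by simp
  then have "nat \<bar>m\<bar> = 0" using eq by (metis even_power even_numeral neq0_conv)
  then show False using eq n by simp
qed

text \<open>If the factors for \<open>1 + \<i>\<close> and \<open>2 \<plusminus> \<i>\<close> all vanish, then \<open>t * ln 2\<close> and \<open>t * ln 5\<close> are both
  multiples of \<open>pi\<close>, so \<open>t = 0\<close>; and \<open>2 + \<i>\<close> has no real power, so \<open>k = 0\<close>.\<close>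

lemma ex_residue_system_factor_nonzero:
  assumes "k \<noteq> 0 \<or> t \<noteq> 0"
  obtains \<alpha> R where "residue_system \<alpha> R" "of_nat (card R) * hecke k (Complex 1 t) \<alpha> \<noteq> 1"
proof (rule ccontr)
  assume h: "\<not> thesis"
  let ?R = "{0, 1, -1, \<i>, -\<i>}"
  let ?a = "Complex 2 1" and ?b = "Complex 2 (-1)"
  have card5: "card ?R = 5" by (auto simp: complex_eq_iff card_insert_if)
  \<comment> \<open>At s = 1 + it the size of the residue system cancels N(\<alpha>)^(-1), leaving a
    number of modulus 1.\<close>
  have split: "of_real (exp l) * hecke k (Complex 1 t) \<alpha> = sgn \<alpha> powi (4 * k) * exp (-(\<i> * of_real (t * l)))"
    if "lnorm \<alpha> = l" for \<alpha> l
  proof -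
    have "exp (-(Complex 1 t * of_real l)) = exp (of_real (-l) + -(\<i> * of_real (t * l)))"
      by (rule arg_cong[of _ _ exp]) (simp add: complex_eq_iff)
    also have "\<dots> = of_real (exp (-l)) * exp (-(\<i> * of_real (t * l)))" by (simp only: exp_add exp_of_real)
    finally have "of_real (exp l) * exp (-(Complex 1 t * of_real l)) =
       of_real (exp l * exp (-l)) * exp (-(\<i> * of_real (t * l)))" by (simp only: of_real_mult mult.assoc)
    also have "exp l * exp (-l) = 1" by (simp add: exp_minus)
    finally show ?thesis unfolding hecke_def that by (metis mult.left_commute mult_1 of_real_1)
  qed
  have n2: "lnorm (1 + \<i>) = ln 2" by (simp add: lnorm_def cmod_def ln_sqrt)
  have n5: "lnorm ?a = ln 5" "lnorm ?b = ln 5" by (simp_all add: lnorm_def cmod_def ln_sqrt)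
  have "of_nat (card {0::complex, 1}) * hecke k (Complex 1 t) (1 + \<i>) = 1"
    using h that residue_system_1_i by blast
  then have e1: "sgn (1 + \<i>) powi (4 * k) * exp (-(\<i> * of_real (t * ln 2))) = 1"
    using split[OF n2] by simp
  have "of_nat (card ?R) * hecke k (Complex 1 t) ?a = 1"
    using h that residue_system_2_i[of 1] by fastforce
  then have e2: "sgn ?a powi (4 * k) * exp (-(\<i> * of_real (t * ln 5))) = 1"
    unfolding card5 using split[OF n5(1)] by simp
  have "of_nat (card ?R) * hecke k (Complex 1 t) ?b = 1"
    using h that residue_system_2_i[of "-1"] by fastforce
  then have e3: "sgn ?b powi (4 * k) * exp (-(\<i> * of_real (t * ln 5))) = 1"
    unfolding card5 using split[OF n5(2)] by simp
  \<comment> \<open>Multiplying two vanishing conditions removes the angular parts: for 1 + i the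
    condition is used twice, as its direction is an eighth root of unity; for 2 + i and 2 - i the
    directions are inverse to each other.\<close>
  have sq: "E * E = 1" if "x * E = 1" "y * E = 1" "x * y = 1" for x y E :: complex
  proof -
    have "E * E = (x * y) * (E * E)" using that by simp
    also have "\<dots> = (x * E) * (y * E)" by (simp only: mult_ac)
    finally show ?thesis using that by simp
  qed
  have per: "\<exists>n::int. t * l = of_int n * pi" if "exp (-(\<i> * of_real (t * l))) * exp (-(\<i> * of_real (t * l))) = 1" for l
  proof -
    have "exp (-(\<i> * of_real (t * l)) + -(\<i> * of_real (t * l))) = 1" using that by (simp only: exp_add)
    then obtain n :: int where "Im (-(\<i> * of_real (t * l)) + -(\<i> * of_real (t * l))) = of_int (2 * n) * pi"
      unfolding exp_eq_1 by blast
    then have "t * l = of_int (-n) * pi" by (simp add: algebra_simps)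
    then show ?thesis by blast
  qed
  have "sgn (1 + \<i>) powi (4 * k) * sgn (1 + \<i>) powi (4 * k) = 1"
  proof -
    have "(sgn (1 + \<i>)) ^ 8 = (1 + \<i>) ^ 8 / of_real (sqrt 2 ^ 8)"
      by (simp add: sgn_eq power_divide cmod_def)
    also have "sqrt 2 ^ 8 = (sqrt 2 ^ 2) ^ 4" by (simp only: power_mult[symmetric]) simp
    also have "(1 + \<i>) ^ 8 = (((1 + \<i>)\<^sup>2)\<^sup>2)\<^sup>2" by (simp only: power_mult[symmetric]) simp
    also have "\<dots> = 16" by (simp add: power2_eq_square complex_eq_iff)
    finally have "(sgn (1 + \<i>)) powi 8 = 1" by simp
    then have "(sgn (1 + \<i>)) powi (8 * k) = 1" by (simp add: power_int_mult)
    moreover have "sgn (1 + \<i>) \<noteq> (0::complex)" by (simp add: sgn_zero_iff complex_eq_iff)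
    ultimately show ?thesis by (subst power_int_add[symmetric]) auto
  qed
  then have "exp (-(\<i> * of_real (t * ln 2))) * exp (-(\<i> * of_real (t * ln 2))) = 1"
    by (rule sq[OF e1 e1])
  then obtain n where n: "t * ln 2 = of_int n * pi" using per by blast
  have "sgn ?a powi (4 * k) * sgn ?b powi (4 * k) = 1"
  proof -
    have "sgn ?a * sgn ?b = 1" by (simp add: sgn_eq complex_eq_iff cmod_def field_simps)
    then show ?thesis by (simp only: power_int_mult_distrib[symmetric]) simp
  qed
  then have "exp (-(\<i> * of_real (t * ln 5))) * exp (-(\<i> * of_real (t * ln 5))) = 1"
    by (rule sq[OF e2 e3])
  then obtain m where m: "t * ln 5 = of_int m * pi" using per by blast
  have t0: "t = 0"
  proof (rule ccontr)
    assume t: "t \<noteq> 0"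
    have "of_int n * (t * ln 5) = of_int m * (t * ln 2)" unfolding n m by simp
    then have "t * (of_int n * ln 5) = t * (of_int m * ln 2)" by (simp only: mult.left_commute)
    then have "of_int n * ln 5 = of_int m * ln (2::real)" using t by simp
    then have "n = 0" by (rule ln_2_ln_5_independent)
    then show False using n t by simp
  qed
  then have "k \<noteq> 0" using assms by simp
  then have "sgn ?a powi (4 * k) \<noteq> 1" by (intro sgn_2_i_power_int_neq_1) simp
  then show False using e2 t0 by simp
qed

section \<open>Behaviour on the line of real part one\<close>

lemma bounded_log_deriv_nonzero:
  assumes "g holomorphic_on ball s0 r" "r > 0" "\<And>s. s \<in> ball s0 r \<Longrightarrow> g s \<noteq> 0"
  obtains C where "\<And>s. s \<in> ball s0 (r/2) \<Longrightarrow> norm (deriv g s / g s) \<le> C"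
proof -
  have "continuous_on (cball s0 (r/2)) (\<lambda>s. deriv g s / g s)"
    using assms by (intro continuous_intros holomorphic_on_imp_continuous_on
        holomorphic_on_subset[OF holomorphic_deriv[OF assms(1)]] holomorphic_on_subset[OF assms(1)]) auto
  then have "compact ((\<lambda>s. deriv g s / g s) ` cball s0 (r/2))"
    by (rule compact_continuous_image) auto
  then have "bounded ((\<lambda>s. deriv g s / g s) ` cball s0 (r/2))" by (rule compact_imp_bounded)
  then obtain C where C: "\<forall>s\<in>cball s0 (r/2). norm (deriv g s / g s) \<le> C"
    unfolding bounded_iff by auto
  show ?thesis by (rule that[of C]) (use C in auto)
qed

text \<open>Writing g = (s - s0)^m h with h nonvanishing, the logarithmic derivative is m / (s - s0)
  plus h'/h. The clause forcing \<open>m = 1\<close> serves the simple zero of the factor at s =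
  1.\<close>

lemma log_deriv_near_zero:
  assumes g: "g holomorphic_on ball s0 r" "r > 0" and nz: "\<exists>s\<in>ball s0 r. g s \<noteq> 0"
  obtains m :: nat and C \<delta> where "\<delta> > 0" "\<delta> \<le> r" "(m = 0) = (g s0 \<noteq> 0)"
    "g s0 = 0 \<Longrightarrow> deriv g s0 \<noteq> 0 \<Longrightarrow> m = 1"
    "\<And>s. s \<in> ball s0 \<delta> \<Longrightarrow> s \<noteq> s0 \<Longrightarrow> g s \<noteq> 0 \<and> norm (deriv g s / g s - of_nat m / (s - s0)) \<le> C"
proof (cases "g s0 = 0")
  case False
  have "isCont g s0"
    using continuous_on_interior[OF holomorphic_on_imp_continuous_on[OF g(1)], of s0] g(2) by simp
  then obtain e where e: "e > 0" "\<And>s. dist s0 s < e \<Longrightarrow> g s \<noteq> 0"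
    using False continuous_at_avoid[of s0 g 0] by auto
  define d where "d = min e r"
  have d: "d > 0" "d \<le> r" "d \<le> e" using e g by (auto simp: d_def)
  obtain C where C: "\<And>s. s \<in> ball s0 (d/2) \<Longrightarrow> norm (deriv g s / g s) \<le> C"
    using bounded_log_deriv_nonzero[of g s0 d] d e holomorphic_on_subset[OF g(1), of "ball s0 d"]
    by (metis subset_ball mem_ball order_less_le_trans)
  show ?thesis
    by (rule that[of "d/2" 0 C]) (use d e C False in auto)
next
  case True
  have "\<not> g constant_on ball s0 r"
  proof
    assume "g constant_on ball s0 r"
    then obtain c where "\<And>s. s \<in> ball s0 r \<Longrightarrow> g s = c" by (auto simp: constant_on_def)
    then show False using nz True g(2) by (metis centre_in_ball)
  qed
  then obtain h d m where h: "0 < m" "0 < d" "ball s0 d \<subseteq> ball s0 r" "h holomorphic_on ball s0 d"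
    "\<And>w. w \<in> ball s0 d \<Longrightarrow> g w = (w - s0) ^ m * h w" "\<And>w. w \<in> ball s0 d \<Longrightarrow> h w \<noteq> 0"
    using holomorphic_factor_zero_nonconstant[OF g(1) open_ball connected_ball _ True] g(2)
    by (metis centre_in_ball)
  obtain C where C: "\<And>s. s \<in> ball s0 (d/2) \<Longrightarrow> norm (deriv h s / h s) \<le> C"
    using bounded_log_deriv_nonzero[OF h(4,2,6)] by metis
  have dg: "deriv g s = of_nat m * (s - s0) ^ (m - 1) * h s + (s - s0) ^ m * deriv h s" if s: "s \<in> ball s0 d" for s
  proof -
    have dh: "(h has_field_derivative deriv h s) (at s)"
      using h(4) s holomorphic_derivI open_ball by blast
    have "((\<lambda>w. (w - s0) ^ m * h w) has_field_derivative
       of_nat m * (s - s0) ^ (m - 1) * h s + (s - s0) ^ m * deriv h s) (at s)"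
      by (rule derivative_eq_intros dh refl)+ (simp add: algebra_simps)
    then have "(g has_field_derivative of_nat m * (s - s0) ^ (m - 1) * h s + (s - s0) ^ m * deriv h s) (at s)"
      by (rule has_field_derivative_transform_within_open[of _ _ _ "ball s0 d"]) (use s h(5) in auto)
    then show ?thesis by (rule DERIV_imp_deriv)
  qed
  have dr: "d \<le> r" using h(2,3) g(2) by (simp add: ball_subset_ball_iff)
  show ?thesis
  proof (rule that[of "d/2" m C])
    show "d/2 > 0" "d/2 \<le> r" using h dr by auto
    show "(m = 0) = (g s0 \<noteq> 0)" using True h by simp
    show "m = 1" if "deriv g s0 \<noteq> 0"
    proof (rule ccontr)
      assume "m \<noteq> 1"
      then have "m > 1" using h(1) by simp
      then have "deriv g s0 = 0" using dg[of s0] h by (simp add: power_0_left)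
      then show False using that by simp
    qed
    fix s assume s: "s \<in> ball s0 (d/2)" "s \<noteq> s0"
    then have sd: "s \<in> ball s0 d" using h by auto
    have "g s \<noteq> 0" using h(5,6)[OF sd] s by simp
    moreover have "deriv g s / g s - of_nat m / (s - s0) = deriv h s / h s"
    proof -
      have "(s - s0) ^ m = (s - s0) * (s - s0) ^ (m - 1)" using h(1) by (metis power_eq_if neq0_conv)
      moreover have "(a * w * b + x * w * c) / (x * w * b) - a / x = c / b" if "x \<noteq> 0" "w \<noteq> 0" "b \<noteq> 0"
        for a b c w x :: complex using that by (simp add: field_simps)
      ultimately show ?thesis unfolding dg[OF sd] h(5)[OF sd] using h(6)[OF sd] s by simp
    qed
    ultimately show "g s \<noteq> 0 \<and> norm (deriv g s / g s - of_nat m / (s - s0)) \<le> C" using C[OF s(1)] by simp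
  qed
qed

definition euler_factor :: "complex \<Rightarrow> complex set \<Rightarrow> int \<Rightarrow> complex \<Rightarrow> complex" where
  "euler_factor \<alpha> R k s = 1 - of_nat (card R) * hecke k s \<alpha>"

lemma euler_factor_holomorphic: "euler_factor \<alpha> R k holomorphic_on A"
  unfolding euler_factor_def[abs_def] by (intro holomorphic_intros hecke_holomorphic)

lemma euler_factor_nonzero:
  assumes "residue_system \<alpha> R" "Re s > 1"
  shows "euler_factor \<alpha> R k s \<noteq> 0"
proof
  have R: "norm \<alpha> \<ge> sqrt 2" "real (card R) = (norm \<alpha>)\<^sup>2" using assms by (auto simp: residue_system_def)
  have a0: "\<alpha> \<noteq> 0" using R by auto
  have "(norm \<alpha>)\<^sup>2 \<ge> (sqrt 2)\<^sup>2" using R by (intro power_mono) auto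
  then have "(norm \<alpha>)\<^sup>2 > 1" by simp
  then have "ln ((norm \<alpha>)\<^sup>2) > 0" by (rule ln_gt_zero)
  then have l: "lnorm \<alpha> > 0" using a0 by (simp add: lnorm_def ln_realpow)
  assume "euler_factor \<alpha> R k s = 0"
  then have "norm (of_nat (card R) * hecke k s \<alpha>) = 1" by (simp add: euler_factor_def)
  then have "exp (lnorm \<alpha>) * exp (-(Re s * lnorm \<alpha>)) = 1"
    using a0 R by (simp add: norm_mult norm_hecke exp_lnorm_eq)
  then have "exp (lnorm \<alpha> + -(Re s * lnorm \<alpha>)) = 1" by (simp only: exp_add)
  then have "(1 - Re s) * lnorm \<alpha> = 0" by (simp add: algebra_simps)
  then show False using l assms by simp
qed

lemma open_connected_halfplane: "open {s. Re s > c}" "connected {s. Re s > c}"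
  by (auto simp: open_halfspace_Re_gt intro!: convex_connected convex_halfspace_Re_gt)

text \<open>On Re s > 1 one has L'/L = G'/G - q'/q, and G and q are holomorphic across the line. So
  \<open>hecke_Lambda\<close> is controlled by the orders of vanishing of G and q without
  introducing a continuation of L itself.\<close>

lemma hecke_Lambda_near_line_aux:
  assumes R: "residue_system \<alpha> R"
  obtains mG mq :: nat and C \<delta> where "\<delta> > 0"
    "(mG = 0) = (hecke_cont \<alpha> R k (Complex 1 t) \<noteq> 0)"
    "(mq = 0) = (euler_factor \<alpha> R k (Complex 1 t) \<noteq> 0)"
    "euler_factor \<alpha> R k (Complex 1 t) = 0 \<Longrightarrow> deriv (euler_factor \<alpha> R k) (Complex 1 t) \<noteq> 0 \<Longrightarrow> mq = 1"
    "\<And>s. s \<in> ball (Complex 1 t) \<delta> \<Longrightarrow> Re s > 1 \<Longrightarrow>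
       norm (hecke_Lambda k s + 4 * (of_nat mG - of_nat mq) / (s - Complex 1 t)) \<le> C"
proof -
  define s0 where "s0 = Complex 1 t"
  let ?G = "hecke_cont \<alpha> R k" and ?q = "euler_factor \<alpha> R k"
  have sub: "ball s0 (1/2) \<subseteq> {s. Re s > 1/2}"
  proof
    fix s assume "s \<in> ball s0 (1/2)"
    then show "s \<in> {s. Re s > 1/2}" using abs_Re_le_cmod[of "s0 - s"] by (simp add: s0_def dist_norm)
  qed
  have hG: "?G holomorphic_on {s. Re s > 1/2}" by (rule hecke_cont_holomorphic[OF R])
  obtain c where c: "c > 1" "hecke_L k (of_real c) \<noteq> 0" using hecke_L_nonzero_at by blast
  have Gc: "?G (of_real c) \<noteq> 0"
    using hecke_cont_eq[OF R, of "of_real c" k] euler_factor_nonzero[OF R, of "of_real c" k] c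
    by (simp add: euler_factor_def)
  have lim: "s0 islimpt ball s0 (1/2)" by (simp add: islimpt_ball)
  \<comment> \<open>Vanishing on a disc would spread over the half-plane Re s > 1/2 by the identity
    theorem, contradicting the value at \<open>c\<close>.\<close>
  have nzG: "\<exists>s\<in>ball s0 (1/2). ?G s \<noteq> 0"
  proof (rule ccontr)
    assume "\<not> ?thesis"
    then have "?G (of_real c) = 0"
      using analytic_continuation[OF hG open_connected_halfplane sub _ lim, of "of_real c"] c sub by (auto simp: s0_def)
    then show False using Gc by simp
  qed
  have nzq: "\<exists>s\<in>ball s0 (1/2). ?q s \<noteq> 0"
    by (rule bexI[of _ "s0 + of_real (1/4)"])
      (auto intro!: euler_factor_nonzero[OF R] simp: s0_def dist_norm)
  obtain mG CG \<delta>G where G: "\<delta>G > 0" "\<delta>G \<le> 1/2" "(mG = 0) = (?G s0 \<noteq> 0)"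
    "\<And>s. s \<in> ball s0 \<delta>G \<Longrightarrow> s \<noteq> s0 \<Longrightarrow> ?G s \<noteq> 0 \<and> norm (deriv ?G s / ?G s - of_nat mG / (s - s0)) \<le> CG"
    using log_deriv_near_zero[OF holomorphic_on_subset[OF hG sub] _ nzG]
    by (metis half_gt_zero zero_less_one)
  obtain mq Cq \<delta>q where q: "\<delta>q > 0" "\<delta>q \<le> 1/2" "(mq = 0) = (?q s0 \<noteq> 0)" "?q s0 = 0 \<Longrightarrow> deriv ?q s0 \<noteq> 0 \<Longrightarrow> mq = 1"
    "\<And>s. s \<in> ball s0 \<delta>q \<Longrightarrow> s \<noteq> s0 \<Longrightarrow> ?q s \<noteq> 0 \<and> norm (deriv ?q s / ?q s - of_nat mq / (s - s0)) \<le> Cq"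
    using log_deriv_near_zero[OF euler_factor_holomorphic _ nzq]
    by (metis half_gt_zero zero_less_one)
  show ?thesis
  proof (rule that[of "min \<delta>G \<delta>q" mG mq "4 * CG + 4 * Cq"])
    show "min \<delta>G \<delta>q > 0" using G q by simp
    fix s assume s: "s \<in> ball (Complex 1 t) (min \<delta>G \<delta>q)" "Re s > 1"
    have sne: "s \<noteq> s0" using s by (auto simp: s0_def)
    have Gs: "?G s \<noteq> 0" "norm (deriv ?G s / ?G s - of_nat mG / (s - s0)) \<le> CG"
      using G(4)[of s] s sne by (auto simp: s0_def)
    have qs: "?q s \<noteq> 0" "norm (deriv ?q s / ?q s - of_nat mq / (s - s0)) \<le> Cq"
      using q(5)[of s] s sne by (auto simp: s0_def)
    have eq: "?G w = ?q w * hecke_L k w" if "Re w > 1" for w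
      using hecke_cont_eq[OF R that] by (simp add: euler_factor_def)
    have L0: "hecke_L k s \<noteq> 0" using Gs(1) eq[OF s(2)] by auto
    have dq: "(?q has_field_derivative deriv ?q s) (at s)"
      using euler_factor_holomorphic[of \<alpha> R k UNIV] holomorphic_derivI by blast
    have dL: "(hecke_L k has_field_derivative deriv (hecke_L k) s) (at s)"
      using hecke_L_holomorphic open_connected_halfplane(1)[of 1] s holomorphic_derivI by blast
    have "((\<lambda>w. ?q w * hecke_L k w) has_field_derivative ?q s * deriv (hecke_L k) s + deriv ?q s * hecke_L k s) (at s)"
      using DERIV_mult'[OF dq dL] by simp
    then have "(?G has_field_derivative ?q s * deriv (hecke_L k) s + deriv ?q s * hecke_L k s) (at s)"
      by (rule has_field_derivative_transform_within_open[OF _ open_connected_halfplane(1)[of 1]])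
        (use s eq in auto)
    then have dG: "deriv ?G s = ?q s * deriv (hecke_L k) s + deriv ?q s * hecke_L k s"
      by (rule DERIV_imp_deriv)
    have "hecke_Lambda k s = -4 * (deriv (hecke_L k) s / hecke_L k s)"
      using deriv_hecke_L[OF s(2), of k] L0 by (simp add: field_simps)
    also have "deriv (hecke_L k) s / hecke_L k s = deriv ?G s / ?G s - deriv ?q s / ?q s"
      unfolding dG eq[OF s(2)] using L0 qs(1) by (simp add: field_simps)
    finally have "hecke_Lambda k s + 4 * (of_nat mG - of_nat mq) / (s - s0) =
       4 * (deriv ?q s / ?q s - of_nat mq / (s - s0)) - 4 * (deriv ?G s / ?G s - of_nat mG / (s - s0))"
      by (simp add: diff_divide_distrib algebra_simps)
    also have "norm \<dots> \<le> 4 * Cq + 4 * CG"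
      using Gs(2) qs(2) by (intro order_trans[OF norm_triangle_ineq4] add_mono) (simp_all only: norm_mult, simp_all)
    finally show "norm (hecke_Lambda k s + 4 * (of_nat mG - of_nat mq) / (s - Complex 1 t)) \<le> 4 * CG + 4 * Cq"
      by (simp add: s0_def add.commute)
  qed (use G q in \<open>auto simp: s0_def\<close>)
qed

text \<open>For a suitable \<open>\<alpha>\<close> the factor does not vanish, so only the zero
  order of \<open>hecke_cont\<close> remains. That \<open>m\<close> is a natural number, so the
  singular part has a known sign, is what the 3-4-1 inequality exploits.\<close>

lemma hecke_Lambda_near_line_nonpole:
  assumes "k \<noteq> 0 \<or> t \<noteq> 0"
  obtains m :: nat and C \<delta> where "\<delta> > 0"
    "\<And>s. s \<in> ball (Complex 1 t) \<delta> \<Longrightarrow> Re s > 1 \<Longrightarrow> norm (hecke_Lambda k s + 4 * of_nat m / (s - Complex 1 t)) \<le> C"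
proof -
  obtain \<alpha> R where R: "residue_system \<alpha> R" "of_nat (card R) * hecke k (Complex 1 t) \<alpha> \<noteq> 1"
    using ex_residue_system_factor_nonzero[OF assms] by metis
  then have q: "euler_factor \<alpha> R k (Complex 1 t) \<noteq> 0" by (simp add: euler_factor_def)
  obtain mG mq :: nat and C \<delta> where h: "\<delta> > 0" "(mq = 0) = (euler_factor \<alpha> R k (Complex 1 t) \<noteq> 0)"
    "\<And>s. s \<in> ball (Complex 1 t) \<delta> \<Longrightarrow> Re s > 1 \<Longrightarrow>
       norm (hecke_Lambda k s + 4 * (of_nat mG - of_nat mq) / (s - Complex 1 t)) \<le> C"
    using hecke_Lambda_near_line_aux[OF R(1), of k t] by metis
  show ?thesis by (rule that[OF h(1), of mG C]) (use h q in auto)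
qed

lemma hecke_0_real: "hecke 0 (of_real c) z = of_real (exp (-(c * lnorm z)))"
  by (simp add: hecke_def exp_of_real[symmetric])

text \<open>On the triangle 1 \<le> b \<le> a one has a^2 + b^2 \<le> 2 a^2, so row a contributes at
  least 1 / (2 a), and the harmonic series diverges.\<close>

lemma sum_exp_lnorm_unbounded:
  assumes "\<And>X. finite X \<Longrightarrow> X \<subseteq> gnz \<Longrightarrow> (\<Sum>z\<in>X. exp (-lnorm z)) \<le> B"
  shows False
proof -
  have hb: "harm N \<le> 2 * B" for N
  proof -
    let ?S = "Sigma {1..N} (\<lambda>a. {1..a})"
    let ?C = "\<lambda>x. Complex (real (fst x)) (real (snd x))"
    have inj: "inj_on ?C ?S" by (auto simp: inj_on_def)
    have "?C ` ?S \<subseteq> gnz"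
    proof clarify
      fix a b assume "a \<in> {1..N}" "b \<in> {1..a}"
      then show "?C (a, b) \<in> gnz" using gauss_ints_Complex[of "int a" "int b"] by (auto simp: complex_eq_iff)
    qed
    then have "(\<Sum>z\<in>?C ` ?S. exp (-lnorm z)) \<le> B" by (intro assms) auto
    also have "(\<Sum>z\<in>?C ` ?S. exp (-lnorm z)) = (\<Sum>x\<in>?S. exp (-lnorm (?C x)))"
      by (subst sum.reindex[OF inj]) simp
    also have "\<dots> = (\<Sum>a=1..N. \<Sum>b=1..a. exp (-lnorm (?C (a, b))))"
      by (subst sum.Sigma) (auto intro!: sum.cong)
    finally have le: "(\<Sum>a=1..N. \<Sum>b=1..a. exp (-lnorm (?C (a, b)))) \<le> B" .
    have "(\<Sum>a=1..N. 1 / real a / 2) \<le> (\<Sum>a=1..N. \<Sum>b=1..a. exp (-lnorm (?C (a, b))))"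
    proof (rule sum_mono)
      fix a assume a: "a \<in> {1..N}"
      have "1 / real a / 2 = (\<Sum>b=1..a. 1 / (2 * (real a)\<^sup>2))" using a by (simp add: power2_eq_square field_simps)
      also have "\<dots> \<le> (\<Sum>b=1..a. exp (-lnorm (?C (a, b))))"
      proof (rule sum_mono)
        fix b assume b: "b \<in> {1..a}"
        have nz: "Complex (real a) (real b) \<noteq> 0" using a by (auto simp: complex_eq_iff)
        have "(real b)\<^sup>2 \<le> (real a)\<^sup>2" using b by (intro power_mono) auto
        then have "1 / (2 * (real a)\<^sup>2) \<le> 1 / ((real a)\<^sup>2 + (real b)\<^sup>2)"
          using a by (intro divide_left_mono) (auto intro!: mult_pos_pos add_pos_nonneg)
        also have "(real a)\<^sup>2 + (real b)\<^sup>2 = exp (lnorm (Complex (real a) (real b)))"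
          using nz by (simp add: exp_lnorm_eq cmod_power2)
        finally show "1 / (2 * (real a)\<^sup>2) \<le> exp (-lnorm (?C (a, b)))" by (simp add: exp_minus inverse_eq_divide)
      qed
      finally show "1 / real a / 2 \<le> (\<Sum>b=1..a. exp (-lnorm (?C (a, b))))" .
    qed
    then have "(\<Sum>a=1..N. 1 / real a / 2) \<le> B" using le by linarith
    moreover have "(\<Sum>a=1..N. 1 / real a / 2) = harm N / 2"
      by (simp add: harm_def sum_divide_distrib inverse_eq_divide)
    ultimately show ?thesis by simp
  qed
  have "convergent (harm :: nat \<Rightarrow> real)"
    by (rule Bseq_mono_convergent)
      (use hb harm_mono harm_nonneg in \<open>auto intro!: BseqI'[of _ "2 * B"] simp: abs_of_nonneg\<close>)
  then show False using not_convergent_harm by blast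
qed

lemma hecke_Lambda_pole:
  obtains C \<delta> where "\<delta> > 0"
    "\<And>s. s \<in> ball 1 \<delta> \<Longrightarrow> Re s > 1 \<Longrightarrow> norm (hecke_Lambda 0 s - 4 / (s - 1)) \<le> C"
proof -
  let ?\<alpha> = "1 + \<i>" and ?R = "{0, 1::complex}"
  let ?G = "hecke_cont ?\<alpha> ?R 0" and ?q = "euler_factor ?\<alpha> ?R 0"
  note R = residue_system_1_i
  have one: "Complex 1 0 = 1" by (simp add: complex_eq_iff)
  have l2: "lnorm ?\<alpha> = ln 2" by (simp add: lnorm_def cmod_def ln_sqrt)
  have h2: "hecke 0 1 ?\<alpha> = 1/2" using hecke_0_real[of 1 ?\<alpha>] by (simp add: l2 exp_minus)
  have q1: "?q 1 = 0" by (simp add: euler_factor_def h2)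
  have "(?q has_field_derivative - (of_nat (card ?R) * -(of_real (lnorm ?\<alpha>) * hecke 0 1 ?\<alpha>))) (at 1)"
    unfolding euler_factor_def[abs_def]
    by (rule derivative_eq_intros hecke_has_field_derivative refl | simp)+
  then have dq: "(?q has_field_derivative of_real (ln 2)) (at 1)" by (simp add: h2 l2)
  then have dq0: "deriv ?q 1 \<noteq> 0" using DERIV_imp_deriv[OF dq] by simp
  obtain mG mq :: nat and C \<delta> where h: "\<delta> > 0" "(mG = 0) = (?G 1 \<noteq> 0)"
    "?q 1 = 0 \<Longrightarrow> deriv ?q 1 \<noteq> 0 \<Longrightarrow> mq = 1"
    "\<And>s. s \<in> ball 1 \<delta> \<Longrightarrow> Re s > 1 \<Longrightarrow>
       norm (hecke_Lambda 0 s + 4 * (of_nat mG - of_nat mq) / (s - 1)) \<le> C"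
    using hecke_Lambda_near_line_aux[OF R, of 0 0] unfolding one by metis
  \<comment> \<open>If G vanished at 1, the simple zero of the factor would cancel and L_0 would
    have a finite limit along real c decreasing to 1. This limit would bound every finite partial
    sum of 1 / N(z), which is impossible.\<close>
  have "?G 1 \<noteq> 0"
  proof
    assume G1: "?G 1 = 0"
    have "(?G has_field_derivative deriv ?G 1) (at 1)"
      using hecke_cont_holomorphic[OF R, of 0] open_connected_halfplane(1)[of "1/2"]
      by (rule holomorphic_derivI) auto
    then have "((\<lambda>s. ?G s / (s - 1)) \<longlongrightarrow> deriv ?G 1) (at 1)" using G1 by (simp add: has_field_derivative_iff)
    moreover have "((\<lambda>s. ?q s / (s - 1)) \<longlongrightarrow> of_real (ln 2)) (at 1)" using dq q1 by (simp add: has_field_derivative_iff)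
    ultimately have lim: "((\<lambda>s. (?G s / (s - 1)) / (?q s / (s - 1))) \<longlongrightarrow> deriv ?G 1 / of_real (ln 2)) (at 1)"
      by (intro tendsto_divide) auto
    have seq: "filterlim (\<lambda>n. of_real (1 + inverse (real (Suc n))) :: complex) (at 1) sequentially"
      unfolding filterlim_at
    proof
      show "\<forall>\<^sub>F n in sequentially. of_real (1 + inverse (real (Suc n))) \<in> (UNIV :: complex set) \<and>
         of_real (1 + inverse (real (Suc n))) \<noteq> (1::complex)"
        by (auto simp del: of_real_add)
      have "(\<lambda>n. 1 + inverse (real (Suc n))) \<longlonglongrightarrow> 1 + 0"
        by (intro tendsto_intros LIMSEQ_inverse_real_of_nat)
      then have "(\<lambda>n. 1 + inverse (real (Suc n))) \<longlonglongrightarrow> 1" by simp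
      from tendsto_of_real[OF this]
      show "(\<lambda>n. of_real (1 + inverse (real (Suc n))) :: complex) \<longlonglongrightarrow> 1"
        by (simp only: of_real_1)
    qed
    define c where "c n = 1 + inverse (real (Suc n))" for n
    have c1: "c n > 1" for n by (simp add: c_def)
    have "(\<lambda>n. (?G (of_real (c n)) / (of_real (c n) - 1)) / (?q (of_real (c n)) / (of_real (c n) - 1)))
       \<longlonglongrightarrow> deriv ?G 1 / of_real (ln 2)"
      using filterlim_compose[OF lim seq] by (simp only: c_def)
    moreover have "(?G (of_real (c n)) / (of_real (c n) - 1)) / (?q (of_real (c n)) / (of_real (c n) - 1)) = hecke_L 0 (of_real (c n))" for n
    proof -
      have "?G (of_real (c n)) = ?q (of_real (c n)) * hecke_L 0 (of_real (c n))"
        using hecke_cont_eq[OF R, of "of_real (c n)" 0] c1 by (simp add: euler_factor_def)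
      moreover have "?q (of_real (c n)) \<noteq> 0" using euler_factor_nonzero[OF R, of "of_real (c n)" 0] c1 by simp
      moreover have "of_real (c n) \<noteq> (1::complex)" using c1[of n] by auto
      ultimately show ?thesis by (simp add: field_simps)
    qed
    ultimately have "(\<lambda>n. hecke_L 0 (of_real (c n))) \<longlonglongrightarrow> deriv ?G 1 / of_real (ln 2)" by simp
    then have limL: "(\<lambda>n. Re (hecke_L 0 (of_real (c n)))) \<longlonglongrightarrow> Re (deriv ?G 1 / of_real (ln 2))"
      by (rule tendsto_Re)
    have cl: "c \<longlonglongrightarrow> 1" unfolding c_def using tendsto_add[OF tendsto_const LIMSEQ_inverse_real_of_nat, of 1] by simp
    have "(\<Sum>z\<in>X. exp (-lnorm z)) \<le> Re (deriv ?G 1 / of_real (ln 2))" if X: "finite X" "X \<subseteq> gnz" for X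
    proof (rule LIMSEQ_le[OF _ limL])
      have "(\<lambda>n. \<Sum>z\<in>X. exp (-(c n * lnorm z))) \<longlonglongrightarrow> (\<Sum>z\<in>X. exp (-(1 * lnorm z)))"
        by (intro tendsto_intros cl)
      then show "(\<lambda>n. \<Sum>z\<in>X. exp (-(c n * lnorm z))) \<longlonglongrightarrow> (\<Sum>z\<in>X. exp (-lnorm z))" by simp
      have "(\<Sum>z\<in>X. exp (-(c n * lnorm z))) \<le> Re (hecke_L 0 (of_real (c n)))" for n
      proof -
        have s: "(\<lambda>z. exp (-(c n * lnorm z))) summable_on gnz" using c1 by (rule summable_on_exp_lnorm)
        have "hecke_L 0 (of_real (c n)) = of_real (\<Sum>\<^sub>\<infinity>z\<in>gnz. exp (-(c n * lnorm z)))"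
          unfolding hecke_L_def hecke_0_real by (rule infsumI[OF has_sum_of_real]) (use s in simp)
        then have "Re (hecke_L 0 (of_real (c n))) = (\<Sum>\<^sub>\<infinity>z\<in>gnz. exp (-(c n * lnorm z)))" by simp
        then show ?thesis using finite_sum_le_infsum[OF s X] by simp
      qed
      then show "\<exists>N. \<forall>n\<ge>N. (\<Sum>z\<in>X. exp (-(c n * lnorm z))) \<le> Re (hecke_L 0 (of_real (c n)))" by blast
    qed
    then show False by (rule sum_exp_lnorm_unbounded)
  qed
  then have "mG = 0" "mq = 1" using h(2,3) q1 dq0 by auto
  then show ?thesis using that[OF h(1), of C] h(4) by simp
qed

section \<open>Nonvanishing on the line of real part one\<close>

lemma three_four_one:
  fixes z :: complex
  assumes "norm z = 1"
  shows "3 + 4 * Re z + Re (z\<^sup>2) \<ge> 0"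
proof -
  have "(Re z)\<^sup>2 + (Im z)\<^sup>2 = 1" using assms by (simp add: cmod_def)
  then have "3 + 4 * Re z + Re (z\<^sup>2) = 2 * (1 + Re z)\<^sup>2" by (simp add: power2_eq_square algebra_simps)
  then show ?thesis by simp
qed

lemma hecke_Lambda_341:
  assumes c: "c > 1"
  shows "3 * Re (hecke_Lambda 0 (of_real c)) + 4 * Re (hecke_Lambda k (Complex c t)) + Re (hecke_Lambda (2 * k) (Complex c (2 * t))) \<ge> 0"
proof -
  let ?f = "\<lambda>k s x. of_real (lnorm (fst x)) * hecke k s (fst x ^ snd x)"
  have hs: "(?f k s has_sum hecke_Lambda k s) prime_powers" if "Re s > 1" for k s
    using abs_summable_summable[OF lambda_abs_summable[OF that, of k]]
    by (simp add: hecke_Lambda_def case_prod_unfold)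
  have "((\<lambda>x. 3 * Re (?f 0 (of_real c) x) + 4 * Re (?f k (Complex c t) x) + Re (?f (2 * k) (Complex c (2 * t)) x)) has_sum
     (3 * Re (hecke_Lambda 0 (of_real c)) + 4 * Re (hecke_Lambda k (Complex c t)) + Re (hecke_Lambda (2 * k) (Complex c (2 * t))))) prime_powers"
    using c by (intro has_sum_add has_sum_cmult_right has_sum_Re hs) auto
  then show ?thesis
  proof (rule has_sum_nonneg)
    fix x assume "x \<in> prime_powers"
    then have p: "gauss_prime (fst x)" by auto
    define z where "z = fst x ^ snd x"
    have z0: "z \<noteq> 0" using gauss_primeD[OF p] by (simp add: z_def)
    \<comment> \<open>The unitary part of the character: doubling both \<open>k\<close> and
      \<open>t\<close> squares it, so each term is a nonnegative multiple of the trigonometric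
      expression in \<open>u\<close>.\<close>
    define u where "u = sgn z powi (4 * k) * exp (-(\<i> * of_real (t * lnorm z)))"
    define e where "e = exp (-(c * lnorm z))"
    have split: "exp (-(Complex c y * of_real (lnorm z))) = of_real e * exp (-(\<i> * of_real (y * lnorm z)))" for y
    proof -
      have "-(Complex c y * of_real (lnorm z)) = of_real (-(c * lnorm z)) + -(\<i> * of_real (y * lnorm z))"
        by (simp add: complex_eq_iff)
      then show ?thesis unfolding e_def by (simp only: exp_add exp_of_real)
    qed
    have h0: "hecke 0 (of_real c) z = of_real e" by (simp add: hecke_0_real e_def)
    have h1: "hecke k (Complex c t) z = of_real e * u"
      unfolding hecke_def split u_def by (simp only: mult.left_commute)
    have h2: "hecke (2 * k) (Complex c (2 * t)) z = of_real e * u\<^sup>2"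
    proof -
      have "sgn z powi (4 * (2 * k)) = (sgn z powi (4 * k))\<^sup>2"
        using z0 by (simp add: power2_eq_square power_int_add[symmetric] sgn_zero_iff)
      moreover have "exp (-(\<i> * of_real (2 * t * lnorm z))) = (exp (-(\<i> * of_real (t * lnorm z))))\<^sup>2"
        unfolding power2_eq_square exp_add[symmetric] by (rule arg_cong[of _ _ exp]) simp
      ultimately show ?thesis unfolding hecke_def split u_def by (simp add: power_mult_distrib)
    qed
    have "norm (sgn z powi (4 * k)) = 1" using z0 by (simp only: norm_power_int norm_sgn) simp
    moreover have "norm (exp (-(\<i> * of_real (t * lnorm z)))) = 1" by (simp only: norm_exp_eq_Re) simp
    ultimately have u1: "norm u = 1" unfolding u_def norm_mult by simp
    have "3 * Re (?f 0 (of_real c) x) + 4 * Re (?f k (Complex c t) x) + Re (?f (2 * k) (Complex c (2 * t)) x) =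
       lnorm (fst x) * e * (3 + 4 * Re u + Re (u\<^sup>2))"
      unfolding z_def[symmetric] h0 h1 h2 by (simp add: algebra_simps)
    also have "\<dots> \<ge> 0" using three_four_one[OF u1] lnorm_nonneg[of "fst x"] gauss_primeD[OF p]
      by (intro mult_nonneg_nonneg) (auto simp: e_def)
    finally show "3 * Re (?f 0 (of_real c) x) + 4 * Re (?f k (Complex c t) x) + Re (?f (2 * k) (Complex c (2 * t)) x) \<ge> 0" .
  qed
qed

lemma hecke_Lambda_bounded_near_line:
  assumes "k \<noteq> 0 \<or> t \<noteq> 0"
  obtains C \<delta> where "\<delta> > 0"
    "\<And>s. s \<in> ball (Complex 1 t) \<delta> \<Longrightarrow> Re s > 1 \<Longrightarrow> norm (hecke_Lambda k s) \<le> C"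
proof -
  obtain m :: nat and C1 d1 where 1: "d1 > 0"
    "\<And>s. s \<in> ball (Complex 1 t) d1 \<Longrightarrow> Re s > 1 \<Longrightarrow> norm (hecke_Lambda k s + 4 * of_nat m / (s - Complex 1 t)) \<le> C1"
    using hecke_Lambda_near_line_nonpole[OF assms] by metis
  \<comment> \<open>Doubling never leads back to (0, 0), so no analogue of a real quadratic
    character needs separate treatment.\<close>
  have as2: "2 * k \<noteq> 0 \<or> 2 * t \<noteq> 0" using assms by simp
  obtain m2 :: nat and C2 d2 where 2: "d2 > 0"
    "\<And>s. s \<in> ball (Complex 1 (2 * t)) d2 \<Longrightarrow> Re s > 1 \<Longrightarrow>
       norm (hecke_Lambda (2 * k) s + 4 * of_nat m2 / (s - Complex 1 (2 * t))) \<le> C2"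
    using hecke_Lambda_near_line_nonpole[OF as2] by metis
  obtain C0 d0 where 0: "d0 > 0"
    "\<And>s. s \<in> ball 1 d0 \<Longrightarrow> Re s > 1 \<Longrightarrow> norm (hecke_Lambda 0 s - 4 / (s - 1)) \<le> C0"
    using hecke_Lambda_pole by metis
  have "m = 0"
  proof (rule ccontr)
    assume "m \<noteq> 0"
    then have m1: "real m \<ge> 1" by simp
    define K where "K = 3 * C0 + 4 * C1 + C2"
    \<comment> \<open>The singular parts sum to (12 - 16 m - 4 m2) / y, at most -4 / y when m \<ge>
      1; \<open>K\<close> collects the bounded errors with the weights 3, 4, 1.\<close>
    have key: "4 / y \<le> K" if y: "y > 0" "y < d0" "y < d1" "y < d2" for y :: real
    proof -
      have R: "Re (a / of_real y) = Re a / y" for a by simp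
      have b0: "of_real (1 + y) \<in> ball (1::complex) d0" using y by (simp add: dist_norm)
      have b1: "Complex (1 + y) u \<in> ball (Complex 1 u) d" if "y < d" for u d
      proof -
        have "Complex 1 u - Complex (1 + y) u = of_real (-y)" by (simp add: complex_eq_iff)
        then show ?thesis using y(1) that by (simp add: dist_norm del: of_real_minus)
      qed
      have sub: "Complex (1 + y) u - Complex 1 u = of_real y" for u by (simp add: complex_eq_iff)
      have "\<bar>Re (hecke_Lambda 0 (of_real (1 + y)) - 4 / (of_real (1 + y) - 1))\<bar> \<le> C0"
        using order_trans[OF abs_Re_le_cmod 0(2)[OF b0]] y by simp
      then have e0: "Re (hecke_Lambda 0 (of_real (1 + y))) \<le> 4 / y + C0" by simp
      have "\<bar>Re (hecke_Lambda k (Complex (1 + y) t) + 4 * of_nat m / (Complex (1 + y) t - Complex 1 t))\<bar> \<le> C1"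
        using order_trans[OF abs_Re_le_cmod 1(2)[OF b1[OF y(3)]]] y by simp
      then have e1: "Re (hecke_Lambda k (Complex (1 + y) t)) \<le> C1 - 4 * real m / y" unfolding sub by simp
      have "\<bar>Re (hecke_Lambda (2 * k) (Complex (1 + y) (2 * t)) + 4 * of_nat m2 / (Complex (1 + y) (2 * t) - Complex 1 (2 * t)))\<bar> \<le> C2"
        using order_trans[OF abs_Re_le_cmod 2(2)[OF b1[OF y(4)]]] y by simp
      then have e2: "Re (hecke_Lambda (2 * k) (Complex (1 + y) (2 * t))) \<le> C2 - 4 * real m2 / y" unfolding sub by simp
      have "4 * real m2 / y \<ge> 0" using y by simp
      moreover have "4 * real m / y \<ge> 4 / y" using y m1 by (intro divide_right_mono) auto
      moreover have "3 * Re (hecke_Lambda 0 (of_real (1 + y))) + 4 * Re (hecke_Lambda k (Complex (1 + y) t))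
         + Re (hecke_Lambda (2 * k) (Complex (1 + y) (2 * t))) \<ge> 0"
        using hecke_Lambda_341[of "1 + y" k t] y by simp
      ultimately show ?thesis using e0 e1 e2 unfolding K_def by argo
    qed
    define b where "b = 1 / (\<bar>K\<bar> + 1)"
    define y where "y = min (min d0 d1) (min d2 b) / 2"
    have "b > 0" by (simp add: b_def add_nonneg_pos)
    then have y: "y > 0" "y < d0" "y < d1" "y < d2" "y < 1 / (\<bar>K\<bar> + 1)"
      using 0(1) 1(1) 2(1) unfolding y_def b_def[symmetric] by (simp_all add: min_def)
    have "4 / y \<le> K" by (rule key[OF y(1-4)])
    moreover have "y * (\<bar>K\<bar> + 1) < 1" using y(5) by (simp add: field_simps)
    then have "\<bar>K\<bar> + 1 < 1 / y" using y(1) by (simp add: field_simps)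
    moreover have "4 / y = 4 * (1 / y)" "1 / y > 0" using y(1) by auto
    ultimately show False by linarith
  qed
  then show ?thesis using that[OF 1(1), of C1] 1(2) by simp
qed

section \<open>Sums over primes in place of prime powers\<close>

definition hecke_P :: "int \<Rightarrow> complex \<Rightarrow> complex" where
  "hecke_P k s = (\<Sum>\<^sub>\<infinity>p\<in>{p. gauss_prime p}. of_real (lnorm p) * hecke k s p)"

lemma prime_sum_summable:
  fixes c :: real assumes "c > 1"
  shows "(\<lambda>p. lnorm p * exp (-(c * lnorm p))) summable_on {p. gauss_prime p}"
  by (rule summable_on_subset_banach[OF summable_on_lnorm_exp_lnorm[OF assms]]) (auto simp: gauss_primeD)

text \<open>For m \<ge> 2 the terms are dominated by \<open>lnorm p\<close> N(p)^(-2) 2^(2 - m),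
  independently of \<open>k\<close> and \<open>s\<close>; so the proper powers cost a single
  constant.\<close>

lemma hecke_P_diff_bounded:
  obtains C where "\<And>k s. Re s > 1 \<Longrightarrow> norm (hecke_P k s - hecke_Lambda k s) \<le> C"
proof -
  let ?P = "{p. gauss_prime p}"
  let ?M = "\<lambda>x. (lnorm (fst x) * exp (-(2 * lnorm (fst x)))) * (1/2::real) ^ (snd x - 2)"
  have "bij_betw (\<lambda>n. n + 2) UNIV {2::nat..}" by (rule bij_betw_byWitness[of _ "\<lambda>n. n - 2"]) auto
  moreover have "(\<lambda>n. (1/2::real) ^ n) summable_on UNIV"
    by (subst summable_on_UNIV_nonneg_real_iff) auto
  ultimately have g: "(\<lambda>m. (1/2::real) ^ (m - 2)) summable_on {2..}"
    using summable_on_reindex_bij_betw[of "\<lambda>n. n + 2" UNIV "{2..}" "\<lambda>m. (1/2::real) ^ (m - 2)"] by simp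
  have "(\<lambda>(p, m). (lnorm p * exp (-(2 * lnorm p))) * (1/2::real) ^ (m - 2)) summable_on ?P \<times> {2..}"
    using g prime_sum_summable[of 2] by (intro summable_on_mult_product) (auto simp: gauss_primeD lnorm_nonneg)
  then have M: "?M summable_on ?P \<times> {2..}" by (simp add: case_prod_unfold)
  show ?thesis
  proof (rule that)
    fix k s assume s: "Re s > 1"
    let ?f = "\<lambda>x. of_real (lnorm (fst x)) * hecke k s (fst x ^ snd x)"
    have sf: "?f summable_on prime_powers"
      using abs_summable_summable[OF lambda_abs_summable[OF s, of k]] by (simp add: case_prod_unfold)
    have s1: "?f summable_on ?P \<times> {1}" and s2: "?f summable_on ?P \<times> {2..}"
      by (rule summable_on_subset_banach[OF sf]; auto)+
    have bij: "bij_betw (\<lambda>p. (p, 1::nat)) ?P (?P \<times> {1})" by (auto simp: bij_betw_def inj_on_def)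
    have "prime_powers = ?P \<times> {1} \<union> ?P \<times> {2..}" by auto
    then have "hecke_Lambda k s = infsum ?f (?P \<times> {1} \<union> ?P \<times> {2..})"
      by (simp add: hecke_Lambda_def case_prod_unfold)
    also have "\<dots> = infsum ?f (?P \<times> {1}) + infsum ?f (?P \<times> {2..})"
      by (rule infsum_Un_disjoint[OF s1 s2]) auto
    also have "infsum ?f (?P \<times> {1}) = hecke_P k s"
      using infsum_reindex_bij_betw[OF bij, of ?f] by (simp add: hecke_P_def)
    finally have "norm (hecke_P k s - hecke_Lambda k s) = norm (infsum ?f (?P \<times> {2..}))" by simp
    also have "\<dots> \<le> infsum ?M (?P \<times> {2..})"
    proof (rule norm_infsum_le)
      show "(?f has_sum infsum ?f (?P \<times> {2..})) (?P \<times> {2..})" using s2 by simp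
      show "(?M has_sum infsum ?M (?P \<times> {2..})) (?P \<times> {2..})" using M by simp
      fix x :: "complex \<times> nat" assume "x \<in> ?P \<times> {2..}"
      then obtain p m where x: "x = (p, m)" "gauss_prime p" "m \<ge> 2" by auto
      note p = gauss_primeD[OF x(2)]
      have l: "lnorm p \<ge> 0" "lnorm p \<ge> ln 2" using p lnorm_nonneg lnorm_prime_ge x by auto
      have lm: "lnorm (p ^ m) = 2 * lnorm p + of_nat (m - 2) * lnorm p"
        using x(3) lnorm_power[of p m] p by (simp add: algebra_simps of_nat_diff)
      have "lnorm (p ^ m) \<le> Re s * lnorm (p ^ m)"
        using s lnorm_nonneg[of "p ^ m"] p mult_right_mono[of 1 "Re s" "lnorm (p ^ m)"] by simp
      then have "exp (-(Re s * lnorm (p ^ m))) \<le> exp (-(2 * lnorm p) + of_nat (m - 2) * (- lnorm p))"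
        unfolding exp_le_cancel_iff using lm by simp
      also have "\<dots> = exp (-(2 * lnorm p)) * exp (- lnorm p) ^ (m - 2)"
        by (simp only: exp_add exp_of_nat_mult)
      also have "\<dots> \<le> exp (-(2 * lnorm p)) * (1/2) ^ (m - 2)"
      proof (intro mult_left_mono power_mono)
        have "exp (- lnorm p) \<le> exp (- ln 2)" using l by simp
        then show "exp (- lnorm p) \<le> 1/2" by (simp add: exp_minus)
      qed auto
      finally have "lnorm p * exp (-(Re s * lnorm (p ^ m))) \<le> lnorm p * (exp (-(2 * lnorm p)) * (1/2) ^ (m - 2))"
        using l by (intro mult_left_mono) auto
      then show "norm (?f x) \<le> ?M x" using x p l by (simp add: norm_mult norm_hecke mult.assoc)
    qed
    finally show "norm (hecke_P k s - hecke_Lambda k s) \<le> infsum ?M (?P \<times> {2..})" .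
  qed
qed

text \<open>Half of each local radius covers the shift in \<open>t\<close> and the other half the
  distance \<open>y\<close> from the line, so a finite subcover yields uniform constants.\<close>

lemma hecke_P_bounded_compact:
  assumes K: "compact K" and nz: "\<And>t. t \<in> K \<Longrightarrow> k \<noteq> 0 \<or> t \<noteq> 0"
  obtains B e where "e > 0" "\<And>t y. t \<in> K \<Longrightarrow> 0 < y \<Longrightarrow> y < e \<Longrightarrow> norm (hecke_P k (Complex (1 + y) t)) \<le> B"
proof -
  obtain C0 where C0: "\<And>k s. Re s > 1 \<Longrightarrow> norm (hecke_P k s - hecke_Lambda k s) \<le> C0"
    using hecke_P_diff_bounded by blast
  have "\<exists>d C. d > 0 \<and> (\<forall>s. s \<in> ball (Complex 1 t) d \<longrightarrow> Re s > 1 \<longrightarrow> norm (hecke_Lambda k s) \<le> C)" if "t \<in> K" for t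
    using hecke_Lambda_bounded_near_line[OF nz[OF that]] by metis
  then obtain d C where dC: "\<And>t. t \<in> K \<Longrightarrow> d t > 0"
    "\<And>t s. t \<in> K \<Longrightarrow> s \<in> ball (Complex 1 t) (d t) \<Longrightarrow> Re s > 1 \<Longrightarrow> norm (hecke_Lambda k s) \<le> C t"
    by metis
  have "K \<subseteq> (\<Union>t\<in>K. ball t (d t / 2))" using dC(1) by fastforce
  then obtain K' where K': "K' \<subseteq> K" "finite K'" "K \<subseteq> (\<Union>t\<in>K'. ball t (d t / 2))"
    using compactE_image[OF K, of K "\<lambda>t. ball t (d t / 2)"] by auto
  define e where "e = Min (insert 1 ((\<lambda>t. d t / 2) ` K'))"
  define B where "B = Max (insert 0 (C ` K')) + C0"
  have e0: "e > 0" unfolding e_def using K' dC(1) by (subst Min_gr_iff) auto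
  show ?thesis
  proof (rule that[OF e0, of B])
    fix t y assume t: "t \<in> K" and y: "0 < y" "y < e"
    obtain u where u: "u \<in> K'" "dist u t < d u / 2" using K'(3) t by auto
    have "e \<le> d u / 2" unfolding e_def using K'(2) u by (intro Min_le) auto
    then have "y < d u / 2" using y by simp
    have "Complex 1 u - Complex (1 + y) t = \<i> * of_real (u - t) - of_real y" by (simp add: complex_eq_iff)
    then have "norm (Complex 1 u - Complex (1 + y) t) \<le> norm (\<i> * of_real (u - t)) + norm (of_real y :: complex)"
      by (metis norm_triangle_ineq4)
    also have "\<dots> = \<bar>u - t\<bar> + \<bar>y\<bar>" by (simp only: norm_mult norm_of_real norm_ii mult_1)
    also have "\<dots> < d u" using u \<open>y < d u / 2\<close> y by (simp add: dist_real_def)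
    finally have "Complex (1 + y) t \<in> ball (Complex 1 u) (d u)" by (simp add: dist_norm)
    then have "norm (hecke_Lambda k (Complex (1 + y) t)) \<le> C u" using dC(2) u K' y by auto
    also have "\<dots> \<le> Max (insert 0 (C ` K'))" using K'(2) u by (intro Max_ge) auto
    finally have "norm (hecke_Lambda k (Complex (1 + y) t)) \<le> Max (insert 0 (C ` K'))" .
    moreover have "norm (hecke_P k (Complex (1 + y) t) - hecke_Lambda k (Complex (1 + y) t)) \<le> C0"
      using y by (intro C0) simp
    ultimately show "norm (hecke_P k (Complex (1 + y) t)) \<le> B"
      unfolding B_def using norm_triangle_sub[of "hecke_P k (Complex (1 + y) t)" "hecke_Lambda k (Complex (1 + y) t)"] by linarith
  qed
qed

text \<open>In this range |s - 1| \<le> 2 y, so 4 / (s - 1) has modulus at least 2 / y; the choice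
  of \<open>e\<close> makes the bounded errors at most 1 / y.\<close>

lemma hecke_P_lower_bound:
  obtains e where "e > 0" "\<And>t y. 0 < y \<Longrightarrow> y < e \<Longrightarrow> \<bar>t\<bar> \<le> y \<Longrightarrow> norm (hecke_P 0 (Complex (1 + y) t)) \<ge> 1 / y"
proof -
  obtain C0 where C0: "\<And>k s. Re s > 1 \<Longrightarrow> norm (hecke_P k s - hecke_Lambda k s) \<le> C0"
    using hecke_P_diff_bounded by blast
  obtain C d where C: "d > 0"
    "\<And>s. s \<in> ball 1 d \<Longrightarrow> Re s > 1 \<Longrightarrow> norm (hecke_Lambda 0 s - 4 / (s - 1)) \<le> C"
    using hecke_Lambda_pole by metis
  define e where "e = min (d / 2) (1 / (\<bar>C0\<bar> + \<bar>C\<bar> + 1))"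
  show ?thesis
  proof (rule that[of e])
    show "e > 0" using C by (simp add: e_def add_pos_nonneg)
    fix t y :: real assume y: "0 < y" "y < e" "\<bar>t\<bar> \<le> y"
    let ?s = "Complex (1 + y) t"
    have "?s - 1 = of_real y + \<i> * of_real t" by (simp add: complex_eq_iff)
    then have "norm (?s - 1) \<le> norm (of_real y :: complex) + norm (\<i> * of_real t)" by (metis norm_triangle_ineq)
    also have "\<dots> = \<bar>y\<bar> + \<bar>t\<bar>" by (simp only: norm_mult norm_of_real norm_ii mult_1)
    finally have n: "norm (?s - 1) \<le> 2 * y" using y by simp
    have s1: "?s \<noteq> 1" using y by (auto simp: complex_eq_iff)
    have "?s \<in> ball 1 d" using n y by (simp add: dist_norm norm_minus_commute e_def)
    then have "norm (hecke_Lambda 0 ?s - 4 / (?s - 1)) \<le> C" using C(2) y by simp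
    moreover have "norm (hecke_P 0 ?s - hecke_Lambda 0 ?s) \<le> C0" using y by (intro C0) simp
    moreover have "4 / (?s - 1) = hecke_P 0 ?s - (hecke_P 0 ?s - hecke_Lambda 0 ?s) - (hecke_Lambda 0 ?s - 4 / (?s - 1))"
      by simp
    then have "norm (4 / (?s - 1)) \<le> norm (hecke_P 0 ?s) + norm (hecke_P 0 ?s - hecke_Lambda 0 ?s)
        + norm (hecke_Lambda 0 ?s - 4 / (?s - 1))"
      by (metis norm_triangle_ineq4 order_trans add_right_mono)
    ultimately have "norm (4 / (?s - 1)) \<le> norm (hecke_P 0 ?s) + (\<bar>C0\<bar> + \<bar>C\<bar>)" by linarith
    moreover have "norm (4 / (?s - 1)) \<ge> 4 / (2 * y)"
      unfolding norm_divide using n y s1 by (intro frac_le) auto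
    moreover have "1 / y \<ge> \<bar>C0\<bar> + \<bar>C\<bar>"
    proof -
      have "y * (\<bar>C0\<bar> + \<bar>C\<bar> + 1) \<le> 1" using y by (simp add: e_def field_simps)
      then have "\<bar>C0\<bar> + \<bar>C\<bar> + 1 \<le> 1 / y" using y by (simp add: field_simps)
      then show ?thesis by linarith
    qed
    moreover have "4 / (2 * y) = 2 * (1 / y)" using y by simp
    ultimately show "norm (hecke_P 0 ?s) \<ge> 1 / y" by linarith
  qed
qed

section \<open>A kernel with compactly supported Fourier transform\<close>

text \<open>\<open>kern_wt\<close> is twice the autocorrelation of \<open>sin (pi * x)\<close> on \<open>[0, 1]\<close>, so that
  \<open>kern_pos u = 2 * pi\<^sup>2 * (1 + cos u) / (pi\<^sup>2 - u\<^sup>2)\<^sup>2\<close>. Multiplying by \<open>pi\<^sup>2 - u\<^sup>2\<close>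
  yields \<open>2 * pi * kern_sin u\<close>, whose weight vanishes at \<open>x = 0\<close> and hence does not affect the mean.\<close>

definition kern_sin :: "real \<Rightarrow> real" where
  "kern_sin u = integral {0..1} (\<lambda>x. sin (pi * x) * cos (x * u))"

definition kern_wt :: "real \<Rightarrow> real" where
  "kern_wt x = (1 - x) * cos (pi * x) + sin (pi * x) / pi"

definition kern_pos :: "real \<Rightarrow> real" where
  "kern_pos u = integral {0..1} (\<lambda>x. kern_wt x * cos (x * u))"

lemma kern_wt_continuous [continuous_intros]: "continuous_on A kern_wt"
  unfolding kern_wt_def by (intro continuous_intros) auto

lemma kern_sin_eq: "(pi\<^sup>2 - u\<^sup>2) * kern_sin u = pi * (1 + cos u)"
proof -
  \<comment> \<open>The boundary term of two integrations by parts; its values at 1 and 0 are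
    \<open>pi * cos u\<close> and \<open>- pi\<close>.\<close>
  let ?A = "\<lambda>x. - pi * cos (pi * x) * cos (x * u) - u * sin (pi * x) * sin (x * u)"
  have "((\<lambda>x. (pi\<^sup>2 - u\<^sup>2) * (sin (pi * x) * cos (x * u))) has_integral (?A 1 - ?A 0)) {0..1}"
  proof (rule fundamental_theorem_of_calculus)
    fix x :: real
    show "(?A has_vector_derivative (pi\<^sup>2 - u\<^sup>2) * (sin (pi * x) * cos (x * u))) (at x within {0..1})"
      unfolding has_real_derivative_iff_has_vector_derivative[symmetric]
      by (rule derivative_eq_intros refl | simp)+ (simp add: power2_eq_square algebra_simps)
  qed auto
  then have "integral {0..1} (\<lambda>x. (pi\<^sup>2 - u\<^sup>2) * (sin (pi * x) * cos (x * u))) = ?A 1 - ?A 0"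
    by (rule integral_unique)
  then show ?thesis unfolding kern_sin_def integral_mult_right by (simp add: distrib_left)
qed

lemma kern_pos_eq: "(pi\<^sup>2 - u\<^sup>2) * kern_pos u = 2 * pi * kern_sin u"
proof -
  \<comment> \<open>Again two integrations by parts, using that \<open>kern_wt\<close> solves w'' +
    pi^2 w = 2 pi sin(pi x). The boundary terms vanish because w is 0 at 1 and w' is 0 at both
    ends.\<close>
  let ?A = "\<lambda>x. pi * (1 - x) * sin (pi * x) * cos (x * u) - u * kern_wt x * sin (x * u)"
  have "((\<lambda>x. (pi\<^sup>2 - u\<^sup>2) * (kern_wt x * cos (x * u)) - 2 * pi * (sin (pi * x) * cos (x * u)))
     has_integral (?A 1 - ?A 0)) {0..1}"
  proof (rule fundamental_theorem_of_calculus)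
    fix x :: real
    have d: "(kern_wt has_real_derivative - pi * (1 - x) * sin (pi * x)) (at x within {0..1})"
      unfolding kern_wt_def[abs_def] by (rule derivative_eq_intros refl | simp)+
    show "(?A has_vector_derivative (pi\<^sup>2 - u\<^sup>2) * (kern_wt x * cos (x * u)) - 2 * pi * (sin (pi * x) * cos (x * u)))
        (at x within {0..1})"
      unfolding has_real_derivative_iff_has_vector_derivative[symmetric]
      by (rule derivative_eq_intros d refl | simp)+ (simp add: kern_wt_def power2_eq_square field_simps)
  qed auto
  then have "integral {0..1} (\<lambda>x. (pi\<^sup>2 - u\<^sup>2) * (kern_wt x * cos (x * u)) - 2 * pi * (sin (pi * x) * cos (x * u))) = ?A 1 - ?A 0"
    by (rule integral_unique)
  also have "\<dots> = 0" by (simp add: kern_wt_def)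
  finally have "integral {0..1} (\<lambda>x. (pi\<^sup>2 - u\<^sup>2) * (kern_wt x * cos (x * u)) - 2 * pi * (sin (pi * x) * cos (x * u))) = 0" .
  moreover have "integral {0..1} (\<lambda>x. (pi\<^sup>2 - u\<^sup>2) * (kern_wt x * cos (x * u)) - 2 * pi * (sin (pi * x) * cos (x * u)))
     = (pi\<^sup>2 - u\<^sup>2) * kern_pos u - 2 * pi * kern_sin u"
    unfolding kern_pos_def kern_sin_def
    by (subst integral_diff)
      (auto simp: mult.assoc intro!: integrable_continuous_real continuous_intros)
  ultimately show ?thesis by simp
qed

text \<open>At this frequency the product identity reads 0 = 0, so the integral is examined
  directly: it is that of (1 - x) cos(pi x)^2 plus an exact derivative.\<close>

lemma kern_pos_pi: "kern_pos pi \<ge> 0"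
proof -
  let ?A = "\<lambda>x. (sin (pi * x))\<^sup>2 / (2 * pi)"
  have "((\<lambda>x. sin (pi * x) * cos (pi * x)) has_integral (?A 1 - ?A 0)) {0..1}"
  proof (rule fundamental_theorem_of_calculus)
    fix x :: real
    show "(?A has_vector_derivative sin (pi * x) * cos (pi * x)) (at x within {0..1})"
      unfolding has_real_derivative_iff_has_vector_derivative[symmetric]
      by (rule derivative_eq_intros refl | simp)+
  qed auto
  then have 0: "integral {0..1} (\<lambda>x. sin (pi * x) * cos (pi * x)) = 0" by (simp add: integral_unique)
  have "kern_pos pi = integral {0..1} (\<lambda>x. (1 - x) * (cos (pi * x))\<^sup>2 + 1 / pi * (sin (pi * x) * cos (pi * x)))"
    unfolding kern_pos_def by (intro integral_cong) (simp add: kern_wt_def power2_eq_square algebra_simps)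
  also have "\<dots> = integral {0..1} (\<lambda>x. (1 - x) * (cos (pi * x))\<^sup>2) + 1 / pi * integral {0..1} (\<lambda>x. sin (pi * x) * cos (pi * x))"
    unfolding integral_mult_right[symmetric]
    by (intro integral_add integrable_continuous_real continuous_intros) auto
  also have "\<dots> = integral {0..1} (\<lambda>x. (1 - x) * (cos (pi * x))\<^sup>2)" unfolding 0 by simp
  also have "\<dots> \<ge> 0"
    by (intro integral_nonneg integrable_continuous_real continuous_intros) auto
  finally show ?thesis .
qed

lemma kern_pos_minus: "kern_pos (-u) = kern_pos u"
  by (simp add: kern_pos_def)

text \<open>Combining the two identities gives (pi^2 - u^2)^2 \<open>kern_pos u\<close> = 2 pi^2 (1
  + cos u).\<close>

lemma kern_pos_nonneg: "kern_pos u \<ge> 0"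
proof (cases "u\<^sup>2 = pi\<^sup>2")
  case True
  then have "u = pi \<or> u = -pi" by (simp add: power2_eq_iff)
  then show ?thesis using kern_pos_pi kern_pos_minus by auto
next
  case False
  have "(pi\<^sup>2 - u\<^sup>2)\<^sup>2 * kern_pos u = 2 * pi * ((pi\<^sup>2 - u\<^sup>2) * kern_sin u)"
    using kern_pos_eq[of u] unfolding power2_eq_square[of "pi\<^sup>2 - u\<^sup>2"] mult.assoc by simp
  also have "\<dots> = 2 * pi\<^sup>2 * (1 + cos u)" unfolding kern_sin_eq by (simp add: power2_eq_square)
  also have "\<dots> \<ge> 0"
  proof -
    have "1 + cos u \<ge> 0" using cos_ge_minus_one[of u] by linarith
    then show ?thesis by simp
  qed
  finally have "(pi\<^sup>2 - u\<^sup>2)\<^sup>2 * kern_pos u \<ge> 0" .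
  moreover have "(pi\<^sup>2 - u\<^sup>2)\<^sup>2 > 0" using False by simp
  ultimately show ?thesis by (simp add: zero_le_mult_iff)
qed

text \<open>The Fourier coefficients of cos(theta/2)^(2m), a nonnegative weight that concentrates at
  theta = 0 as m grows.\<close>

definition cospow_coeff :: "nat \<Rightarrow> int \<Rightarrow> real" where
  "cospow_coeff m k = (if \<bar>k\<bar> \<le> int m then real ((2 * m) choose nat (int m + k)) / 4 ^ m else 0)"

text \<open>On the unit circle \<open>(1 + Re w) / 2 = (1 + w)\<^sup>2 / (4 * w)\<close>.\<close>

lemma cos_power_expansion:
  fixes w :: complex
  assumes "norm w = 1" "m \<le> N"
  shows "(\<Sum>k\<in>{-int N..int N}. of_real (cospow_coeff m k) * w powi k) = of_real (((1 + Re w) / 2) ^ m)"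
proof -
  have w0: "w \<noteq> 0" using assms by auto
  have ww: "w * cnj w = 1" using assms by (simp add: complex_norm_square[symmetric])
  have "of_real ((1 + Re w) / 2) = (1 + w)\<^sup>2 / (4 * w)"
  proof -
    have "of_real (1 + Re w) * 2 = 2 + w + cnj w" by (simp add: complex_eq_iff)
    then have "of_real (1 + Re w) * 2 * w = 2 * w + w * w + w * cnj w" by (simp add: algebra_simps)
    then have "of_real (1 + Re w) * 2 * w = (1 + w)\<^sup>2" unfolding ww by (simp add: power2_eq_square algebra_simps)
    then show ?thesis using w0 by (simp add: field_simps)
  qed
  then have "of_real (((1 + Re w) / 2) ^ m) = ((1 + w)\<^sup>2 / (4 * w)) ^ m" by (simp only: of_real_power)
  also have "\<dots> = (w + 1) ^ (2 * m) / (4 ^ m * w ^ m)"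
    by (simp add: power_divide power_mult_distrib power_mult add.commute)
  also have "(w + 1) ^ (2 * m) = (\<Sum>j\<le>2 * m. of_nat ((2 * m) choose j) * w ^ j)"
    by (simp add: binomial_ring)
  also have "\<dots> / (4 ^ m * w ^ m) = (\<Sum>j\<le>2 * m. of_real (real ((2 * m) choose j) / 4 ^ m) * w powi (int j - int m))"
    unfolding sum_divide_distrib using w0 by (intro sum.cong) (auto simp: power_int_diff)
  also have "\<dots> = (\<Sum>k\<in>{-int m..int m}. of_real (cospow_coeff m k) * w powi k)"
    by (rule sum.reindex_bij_witness[of _ "\<lambda>k. nat (int m + k)" "\<lambda>j. int j - int m"]) (auto simp: cospow_coeff_def)
  also have "\<dots> = (\<Sum>k\<in>{-int N..int N}. of_real (cospow_coeff m k) * w powi k)"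
    using assms by (intro sum.mono_neutral_left) (auto simp: cospow_coeff_def)
  finally show ?thesis by simp
qed

text \<open>The ratio (2n + 1) / (2n + 2) of scaled central binomial coefficients. Written as 1
  minus a small term, it shows how little mean is lost in passing from n to n + 1.\<close>

lemma cospow_coeff_Suc_0: "cospow_coeff (Suc n) 0 = cospow_coeff n 0 * (1 - inverse (real n + 1) / 2)"
proof -
  have "Suc n * (2 * Suc n choose Suc n) = Suc (2 * n + 1) * (2 * n + 1 choose n)"
    using Suc_times_binomial[of n "2 * n + 1"] by simp
  moreover have "(2 * n + 1 choose n) = (2 * n + 1 choose Suc n)"
    using binomial_symmetric[of n "2 * n + 1"] by simp
  moreover have "Suc n * (2 * n + 1 choose Suc n) = Suc (2 * n) * (2 * n choose n)"
    using Suc_times_binomial[of n "2 * n"] by simp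
  ultimately have "Suc n * (Suc n * (2 * Suc n choose Suc n)) = (2 * n + 2) * (Suc (2 * n) * (2 * n choose n))"
    by (metis Suc_eq_plus1 add_2_eq_Suc' mult.left_commute)
  then have "(real n + 1) * ((real n + 1) * real (2 * Suc n choose Suc n)) = (real n + 1) * (2 * ((2 * real n + 1) * real (2 * n choose n)))"
    using arg_cong[of _ _ real] by (fastforce simp: algebra_simps)
  then have e: "(real n + 1) * real (2 * Suc n choose Suc n) = 2 * ((2 * real n + 1) * real (2 * n choose n))"
    by (subst (asm) mult_left_cancel) auto
  have "cospow_coeff (Suc n) 0 = real (2 * Suc n choose Suc n) / 4 ^ Suc n" by (simp add: cospow_coeff_def nat_add_distrib)
  also have "real (2 * Suc n choose Suc n) = 2 * ((2 * real n + 1) * real (2 * n choose n)) / (real n + 1)"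
    using e by (simp add: field_simps)
  also have "\<dots> / 4 ^ Suc n = real (2 * n choose n) / 4 ^ n * (1 - inverse (real n + 1) / 2)"
  proof -
    have "2 * ((2 * q - 1) * X) / q / (4 * B) = X / B * (1 - inverse q / 2)" if "q \<noteq> 0" "B \<noteq> 0" for q B X :: real
      using that by (simp add: field_simps)
    from this[of "real n + 1" "4 ^ n" "real (2 * n choose n)"] show ?thesis by (simp add: add.commute)
  qed
  also have "real (2 * n choose n) / 4 ^ n = cospow_coeff n 0" by (simp add: cospow_coeff_def)
  finally show ?thesis .
qed

text \<open>The sum of integrals equals
  \<open>((1 + Re w) / 2) ^ n * kern_pos u * (4 * pi\<^sup>2 - u\<^sup>2 - C * (1 - Re w))\<close>; a large \<open>n\<close>
  concentrates the weight near \<open>w = 1\<close> and so keeps the mean \<open>a 0 0\<close> positive.\<close>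

lemma kernel_minorant:
  fixes C :: real
  assumes "C > 0"
  obtains N :: nat and a :: "int \<Rightarrow> real \<Rightarrow> real" where
    "\<And>k A. continuous_on A (a k)" "a 0 0 > 0"
    "\<And>w u. norm w = 1 \<Longrightarrow>
       0 < (\<Sum>k\<in>{-int N..int N}. integral {0..1} (\<lambda>x. a k x * Re (w powi k * exp (-(\<i> * of_real (x * u))))))
       \<Longrightarrow> \<bar>u\<bar> < 2 * pi \<and> C * (1 - Re w) < 4 * pi\<^sup>2"
proof -
  define n where "n = nat \<lceil>C\<rceil>"
  have nC: "real n \<ge> C" unfolding n_def by linarith
  \<comment> \<open>The target factor is split as (pi^2 - u^2) + (3 pi^2 - 2 C) + 2 C (1 + Re w) /
    2. The first part turns \<open>kern_pos\<close> into \<open>2 * pi * kern_sin\<close>, and the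
    last raises the power of (1 + Re w) / 2, whence \<open>f2\<close>.\<close>
  define f1 where "f1 x = 2 * pi * sin (pi * x) + (3 * pi\<^sup>2 - 2 * C) * kern_wt x" for x
  define f2 where "f2 x = 2 * C * kern_wt x" for x
  define a where "a k x = cospow_coeff n k * f1 x + cospow_coeff (Suc n) k * f2 x" for k x
  have f_cont: "continuous_on A f1" "continuous_on A f2" for A
    unfolding f1_def[abs_def] f2_def[abs_def] by (intro continuous_intros)+
  show ?thesis
  proof (rule that[of a "Suc n"])
    show "continuous_on A (a k)" for k A unfolding a_def[abs_def] by (intro continuous_intros f_cont)
    have p0: "cospow_coeff n 0 > 0" by (simp add: cospow_coeff_def zero_less_binomial)
    \<comment> \<open>The terms 2 C cancel up to C / (n + 1) < 1. The constant 4 pi^2 instead of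
      pi^2 leaves the 3 pi^2 that pays for this.\<close>
    have "f1 0 = 3 * pi\<^sup>2 - 2 * C" "f2 0 = 2 * C" by (simp_all add: f1_def f2_def kern_wt_def)
    then have "a 0 0 = cospow_coeff n 0 * (3 * pi\<^sup>2 - C * inverse (real n + 1))"
      unfolding a_def cospow_coeff_Suc_0 by (simp only:) (simp add: ring_distribs)
    moreover have "C * inverse (real n + 1) < 1" using nC assms by (simp add: field_simps)
    moreover have "3 * pi\<^sup>2 \<ge> 1"
    proof -
      have "pi\<^sup>2 \<ge> 1" using pi_ge_two by (intro one_le_power) auto
      then show ?thesis by linarith
    qed
    ultimately show "a 0 0 > 0" using p0 by simp
    fix w :: complex and u :: real
    assume w: "norm w = 1"
    define p where "p m = ((1 + Re w) / 2) ^ m" for m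
    let ?e = "\<lambda>k x. Re (w powi k * exp (-(\<i> * of_real (x * u))))"
    have cosx: "(\<Sum>k\<in>{-int (Suc n)..int (Suc n)}. cospow_coeff m k * ?e k x) = p m * cos (x * u)" if "m \<le> Suc n" for m x
    proof -
      have "(\<Sum>k\<in>{-int (Suc n)..int (Suc n)}. cospow_coeff m k * ?e k x) =
        Re ((\<Sum>k\<in>{-int (Suc n)..int (Suc n)}. of_real (cospow_coeff m k) * w powi k) * exp (-(\<i> * of_real (x * u))))"
        unfolding sum_distrib_right Re_sum by (intro sum.cong refl) (simp add: algebra_simps)
      also have "\<dots> = p m * cos (x * u)"
        unfolding cos_power_expansion[OF w that] p_def Re_complex_of_real by (simp add: Re_exp)
      finally show ?thesis .
    qed
    have ce: "continuous_on A (\<lambda>x. ?e k x)" for k A by (intro continuous_intros)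
    have "(\<Sum>k\<in>{-int (Suc n)..int (Suc n)}. integral {0..1} (\<lambda>x. a k x * ?e k x)) =
       integral {0..1} (\<lambda>x. \<Sum>k\<in>{-int (Suc n)..int (Suc n)}. a k x * ?e k x)"
      by (intro integral_sum[symmetric] integrable_continuous_real continuous_intros ce)
        (auto simp: a_def[abs_def] intro!: continuous_intros f_cont)
    also have "\<dots> = integral {0..1} (\<lambda>x. p n * (f1 x * cos (x * u)) + p (Suc n) * (f2 x * cos (x * u)))"
    proof (rule integral_cong)
      fix x :: real
      have "(\<Sum>k\<in>{-int (Suc n)..int (Suc n)}. a k x * ?e k x) =
         f1 x * (\<Sum>k\<in>{-int (Suc n)..int (Suc n)}. cospow_coeff n k * ?e k x)
         + f2 x * (\<Sum>k\<in>{-int (Suc n)..int (Suc n)}. cospow_coeff (Suc n) k * ?e k x)"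
        unfolding sum_distrib_left sum.distrib[symmetric] by (intro sum.cong refl) (simp add: a_def algebra_simps)
      also have "\<dots> = p n * (f1 x * cos (x * u)) + p (Suc n) * (f2 x * cos (x * u))"
        by (subst cosx, simp, subst cosx, simp, simp add: algebra_simps)
      finally show "(\<Sum>k\<in>{-int (Suc n)..int (Suc n)}. a k x * ?e k x) = p n * (f1 x * cos (x * u)) + p (Suc n) * (f2 x * cos (x * u))" .
    qed
    also have "\<dots> = p n * integral {0..1} (\<lambda>x. f1 x * cos (x * u)) + p (Suc n) * integral {0..1} (\<lambda>x. f2 x * cos (x * u))"
      by (subst integral_add) (auto intro!: integrable_continuous_real continuous_intros f_cont)
    also have "integral {0..1} (\<lambda>x. f1 x * cos (x * u)) = 2 * pi * kern_sin u + (3 * pi\<^sup>2 - 2 * C) * kern_pos u"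
    proof -
      have "integral {0..1} (\<lambda>x. f1 x * cos (x * u)) =
         integral {0..1} (\<lambda>x. 2 * pi * (sin (pi * x) * cos (x * u)) + (3 * pi\<^sup>2 - 2 * C) * (kern_wt x * cos (x * u)))"
        by (intro integral_cong) (simp add: f1_def algebra_simps)
      also have "\<dots> = 2 * pi * kern_sin u + (3 * pi\<^sup>2 - 2 * C) * kern_pos u"
        unfolding kern_sin_def kern_pos_def
        by (subst integral_add) (auto simp: mult.assoc intro!: integrable_continuous_real continuous_intros)
      finally show ?thesis .
    qed
    also have "integral {0..1} (\<lambda>x. f2 x * cos (x * u)) = 2 * C * kern_pos u"
      by (simp add: f2_def kern_pos_def mult.assoc)
    also have "p n * (2 * pi * kern_sin u + (3 * pi\<^sup>2 - 2 * C) * kern_pos u) + p (Suc n) * (2 * C * kern_pos u)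
       = p n * kern_pos u * (4 * pi\<^sup>2 - u\<^sup>2 - C * (1 - Re w))"
      unfolding kern_pos_eq[symmetric] by (simp add: p_def field_simps)
    finally have eq: "(\<Sum>k\<in>{-int (Suc n)..int (Suc n)}. integral {0..1} (\<lambda>x. a k x * ?e k x)) =
       p n * kern_pos u * (4 * pi\<^sup>2 - u\<^sup>2 - C * (1 - Re w))" .
    have Rew: "\<bar>Re w\<bar> \<le> 1" using abs_Re_le_cmod[of w] w by simp
    then have "p n * kern_pos u \<ge> 0" using kern_pos_nonneg by (intro mult_nonneg_nonneg) (auto simp: p_def)
    moreover assume "0 < (\<Sum>k\<in>{-int (Suc n)..int (Suc n)}. integral {0..1} (\<lambda>x. a k x * ?e k x))"
    ultimately have pos: "4 * pi\<^sup>2 - u\<^sup>2 - C * (1 - Re w) > 0" unfolding eq by (auto simp: zero_less_mult_iff)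
    have "C * (1 - Re w) \<ge> 0" using assms Rew by (intro mult_nonneg_nonneg) auto
    then have "u\<^sup>2 < 4 * pi\<^sup>2" using pos by linarith
    then have "\<bar>u\<bar>\<^sup>2 < (2 * pi)\<^sup>2" by (simp add: power_mult_distrib)
    then have "\<bar>u\<bar> < 2 * pi" by (rule power2_less_imp_less) simp
    moreover have "u\<^sup>2 \<ge> 0" by simp
    then have "C * (1 - Re w) < 4 * pi\<^sup>2" using pos by linarith
    ultimately show "\<bar>u\<bar> < 2 * pi \<and> C * (1 - Re w) < 4 * pi\<^sup>2" by simp
  qed
qed

section \<open>Pairs of primes\<close>

lemma hecke_inverse:
  assumes "q \<noteq> 0"
  shows "hecke k (Complex 0 t) (inverse q) = cnj (hecke k (Complex 0 t) q)"
proof -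
  have 1: "hecke k (Complex 0 t) q * hecke k (Complex 0 t) (inverse q) = 1"
    using hecke_mult[of q "inverse q" k "Complex 0 t"] hecke_unit[of 1 k "Complex 0 t"] assms
    by (simp add: gauss_unit_iff)
  have "norm (hecke k (Complex 0 t) q) = 1" using norm_hecke[OF assms, of k "Complex 0 t"] by simp
  then have "hecke k (Complex 0 t) q * cnj (hecke k (Complex 0 t) q) = 1"
    by (simp add: complex_norm_square[symmetric])
  with 1 show ?thesis by (metis inverse_unique)
qed

lemma hecke_shift: "hecke k (Complex c t) z = of_real (exp (-(c * lnorm z))) * hecke k (Complex 0 t) z"
proof -
  have "-(Complex c t * of_real (lnorm z)) = of_real (-(c * lnorm z)) + -(Complex 0 t * of_real (lnorm z))"
    by (simp add: complex_eq_iff)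
  then have "exp (-(Complex c t * of_real (lnorm z))) = of_real (exp (-(c * lnorm z))) * exp (-(Complex 0 t * of_real (lnorm z)))"
    by (simp only: exp_add exp_of_real)
  then show ?thesis unfolding hecke_def by (simp only: mult.left_commute)
qed

lemma hecke_continuous_on [continuous_intros]: "continuous_on A (\<lambda>x. hecke k (Complex c (T * x)) z)"
proof -
  have "(\<lambda>x. Complex c (T * x)) = (\<lambda>x. of_real c + \<i> * of_real (T * x))" by (auto simp: complex_eq_iff)
  then have "continuous_on A (\<lambda>x. Complex c (T * x))" by (simp only:) (intro continuous_intros)
  then show ?thesis unfolding hecke_def by (intro continuous_intros)
qed

text \<open>The majorant depends on neither \<open>k\<close> nor \<open>t\<close>, so one finite set
  serves all of them, and sums over pairs can be exchanged with integrals freely.\<close>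

lemma hecke_P_finite_approx:
  assumes y: "y > 0"
  obtains X where "finite X" "X \<subseteq> {p. gauss_prime p}"
    "\<And>k t. norm (hecke_P k (Complex (1 + y) t) - (\<Sum>p\<in>X. of_real (lnorm p) * hecke k (Complex (1 + y) t) p)) \<le> 1"
proof -
  let ?P = "{p. gauss_prime p}"
  let ?W = "\<lambda>p. lnorm p * exp (-((1 + y) * lnorm p))"
  have W: "?W summable_on ?P" using y by (intro prime_sum_summable) simp
  then have "(?W has_sum infsum ?W ?P) ?P" by simp
  then have "\<forall>\<^sub>F X in finite_subsets_at_top ?P. dist (sum ?W X) (infsum ?W ?P) < 1"
    unfolding has_sum_def by (rule tendstoD) simp
  then obtain X where X: "finite X" "X \<subseteq> ?P" "dist (sum ?W X) (infsum ?W ?P) < 1"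
    unfolding eventually_finite_subsets_at_top by blast
  show ?thesis
  proof (rule that[OF X(1,2)])
    fix k t
    let ?s = "Complex (1 + y) t"
    let ?f = "\<lambda>p. of_real (lnorm p) * hecke k ?s p"
    have nf: "norm (?f p) \<le> ?W p" if "p \<in> ?P" for p
      using that gauss_primeD[of p] lnorm_nonneg[of p] by (simp add: norm_mult norm_hecke)
    have "(\<lambda>p. norm (?f p)) summable_on ?P"
      by (rule Infinite_Sum.abs_summable_on_comparison_test'[OF W nf])
    then have f: "?f summable_on ?P" by (rule abs_summable_summable)
    have "hecke_P k ?s - sum ?f X = infsum ?f (?P - X)"
      unfolding hecke_P_def using X by (subst infsum_Diff[OF f]) auto
    also have "norm \<dots> \<le> infsum ?W (?P - X)"
    proof (rule norm_infsum_le)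
      show "(?f has_sum infsum ?f (?P - X)) (?P - X)"
        using summable_on_subset_banach[OF f, of "?P - X"] by auto
      show "(?W has_sum infsum ?W (?P - X)) (?P - X)"
        using summable_on_subset_banach[OF W, of "?P - X"] by auto
    qed (use nf in auto)
    also have "\<dots> = infsum ?W ?P - sum ?W X"
      using X W by (subst infsum_Diff[OF W]) auto
    also have "\<dots> \<le> 1" using X(3) by (simp add: dist_real_def)
    finally show "norm (hecke_P k ?s - sum ?f X) \<le> 1" .
  qed
qed

lemma integral_ge_const:
  fixes f :: "real \<Rightarrow> real"
  assumes "continuous_on {a..b} f" "a \<le> b" "\<And>x. x \<in> {a..b} \<Longrightarrow> f x \<ge> m"
  shows "integral {a..b} f \<ge> m * (b - a)"
proof -
  have "integral {a..b} (\<lambda>x. m) \<le> integral {a..b} f"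
    using assms by (intro integral_le integrable_continuous_real) auto
  then show ?thesis using assms by (simp add: mult.commute)
qed

text \<open>The double sum over pairs is a square because \<open>hecke k (Complex 0 t)\<close> is a unitary character.\<close>

lemma pair_sum_eq:
  assumes X: "finite X" "X \<subseteq> {p. gauss_prime p}" and z0: "z0 \<noteq> 0"
    and a: "continuous_on {0..1} a"
  shows "(\<Sum>p\<in>X. \<Sum>q\<in>X. W p * W q * integral {0..1} (\<lambda>x. a x * Re (hecke k (Complex 0 (T * x)) (p / (q * z0))))) =
     integral {0..1} (\<lambda>x. a x * Re (hecke k (Complex 0 (T * x)) (inverse z0)) *
       (norm (\<Sum>p\<in>X. of_real (W p) * hecke k (Complex 0 (T * x)) p))\<^sup>2)"
proof -
  let ?e = "\<lambda>x. hecke k (Complex 0 (T * x))"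
  have pt: "a x * Re (?e x (inverse z0)) * (norm (\<Sum>p\<in>X. of_real (W p) * ?e x p))\<^sup>2 =
     (\<Sum>p\<in>X. \<Sum>q\<in>X. W p * W q * (a x * Re (?e x (p / (q * z0)))))" for x
  proof -
    let ?S = "\<Sum>p\<in>X. of_real (W p) * ?e x p"
    have m: "?e x (p / (q * z0)) = ?e x p * cnj (?e x q) * ?e x (inverse z0)" if "p \<in> X" "q \<in> X" for p q
    proof -
      have nz: "p \<noteq> 0" "q \<noteq> 0" using that X gauss_primeD(2) by auto
      have "p / (q * z0) = p * (inverse q * inverse z0)" by (simp add: field_simps)
      then show ?thesis using nz z0 by (simp add: hecke_mult hecke_inverse)
    qed
    have "of_real ((norm ?S)\<^sup>2) = ?S * cnj ?S" by (simp only: complex_norm_square)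
    also have "\<dots> = (\<Sum>p\<in>X. \<Sum>q\<in>X. of_real (W p * W q) * (?e x p * cnj (?e x q)))"
      unfolding cnj_sum sum_product by (intro sum.cong refl) (simp add: mult_ac)
    finally have "of_real ((norm ?S)\<^sup>2) * ?e x (inverse z0) =
       (\<Sum>p\<in>X. \<Sum>q\<in>X. of_real (W p * W q) * ?e x (p / (q * z0)))"
      by (simp add: sum_distrib_right m mult.assoc)
    from arg_cong[OF this, of Re] have "(norm ?S)\<^sup>2 * Re (?e x (inverse z0)) =
        (\<Sum>p\<in>X. \<Sum>q\<in>X. W p * W q * Re (?e x (p / (q * z0))))" by (simp del: of_real_mult of_real_power)
    then have "a x * ((norm ?S)\<^sup>2 * Re (?e x (inverse z0))) =
        a x * (\<Sum>p\<in>X. \<Sum>q\<in>X. W p * W q * Re (?e x (p / (q * z0))))" by simp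
    then show ?thesis by (simp add: sum_distrib_left mult_ac)
  qed
  have ii: "(\<lambda>x. W p * W q * (a x * Re (?e x (p / (q * z0))))) integrable_on {0..1}" for p q
    by (intro integrable_continuous_real continuous_intros a)
  have "integral {0..1} (\<lambda>x. a x * Re (?e x (inverse z0)) * (norm (\<Sum>p\<in>X. of_real (W p) * ?e x p))\<^sup>2) =
     integral {0..1} (\<lambda>x. \<Sum>p\<in>X. \<Sum>q\<in>X. W p * W q * (a x * Re (?e x (p / (q * z0)))))"
    unfolding pt ..
  also have "\<dots> = (\<Sum>p\<in>X. integral {0..1} (\<lambda>x. \<Sum>q\<in>X. W p * W q * (a x * Re (?e x (p / (q * z0))))))"
    by (rule integral_sum[OF X(1)]) (intro integrable_sum X(1) ii)
  also have "\<dots> = (\<Sum>p\<in>X. \<Sum>q\<in>X. integral {0..1} (\<lambda>x. W p * W q * (a x * Re (?e x (p / (q * z0))))))"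
    by (intro sum.cong refl integral_sum X(1) ii)
  also have "\<dots> = (\<Sum>p\<in>X. \<Sum>q\<in>X. W p * W q * integral {0..1} (\<lambda>x. a x * Re (?e x (p / (q * z0)))))"
    by (simp only: integral_mult_right)
  finally show ?thesis by simp
qed

text \<open>The weighted sum of the kernel over all pairs is positive for small \<open>y\<close>;
  since the weights are nonnegative, some pair must have a positive kernel value.\<close>

lemma ex_prime_pair_kernel_pos:
  fixes a :: "int \<Rightarrow> real \<Rightarrow> real" and N :: nat
  assumes z0: "z0 \<noteq> 0" and T: "T > 0" and a: "\<And>k A. continuous_on A (a k)" and a0: "a 0 0 > 0"
  obtains p q where "gauss_prime p" "gauss_prime q"
    "0 < (\<Sum>k\<in>{-int N..int N}. integral {0..1} (\<lambda>x. a k x * Re (hecke k (Complex 0 (T * x)) (p / (q * z0)))))"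
proof (rule ccontr)
  assume contr: "\<not> thesis"
  define I where "I = {-int N..int N}"
  have I: "finite I" "0 \<in> I" by (auto simp: I_def)
  define b where "b k x = a k x * Re (hecke k (Complex 0 (T * x)) (inverse z0))" for k x
  have bc: "continuous_on A (b k)" for k A unfolding b_def[abs_def] by (intro continuous_intros a)
  have "Complex 0 0 = 0" by (simp add: complex_eq_iff)
  \<comment> \<open>At the pole the character is trivial, so the twist by \<open>z0\<close> does not
    affect the decisive coefficient.\<close>
  then have b0: "b 0 0 = a 0 0" by (simp add: b_def hecke_def)
  obtain d where d: "d > 0" "\<And>x. \<bar>x\<bar> < d \<Longrightarrow> \<bar>b 0 x - b 0 0\<bar> < a 0 0 / 2"
    using bc[of UNIV 0] a0 unfolding continuous_on_iff
    by (metis UNIV_I half_gt_zero dist_real_def diff_zero)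
  \<comment> \<open>On [0, \<delta>] the coefficient of the square is positive, so this stretch
    cannot spoil the lower bound however large the square is.\<close>
  define \<delta> where "\<delta> = min (d / 2) (1 / 2)"
  have \<delta>: "\<delta> > 0" "\<delta> < 1" "\<And>x. 0 \<le> x \<Longrightarrow> x \<le> \<delta> \<Longrightarrow> b 0 x \<ge> a 0 0 / 2"
  proof -
    show "\<delta> > 0" "\<delta> < 1" using d by (auto simp: \<delta>_def)
    fix x assume "0 \<le> x" "x \<le> \<delta>"
    then have "\<bar>x\<bar> < d" using d(1) by (auto simp: \<delta>_def)
    then have "\<bar>b 0 x - a 0 0\<bar> < a 0 0 / 2" using d(2) b0 by simp
    then show "b 0 x \<ge> a 0 0 / 2" by linarith
  qed
  have "\<exists>D. \<forall>x\<in>{0..1}. \<bar>b k x\<bar> \<le> D" for k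
  proof -
    have "compact (b k ` {0..1})" by (intro compact_continuous_image bc) auto
    then have "bounded (b k ` {0..1})" by (rule compact_imp_bounded)
    then show ?thesis unfolding bounded_iff by auto
  qed
  then obtain D where D: "\<And>k x. x \<in> {0..1} \<Longrightarrow> \<bar>b k x\<bar> \<le> D k" by metis
  \<comment> \<open>The values of t on which an upper bound is needed; for k = 0 the neighbourhood
    of the pole is removed.\<close>
  define K where "K k = (if k = 0 then {T * \<delta>..T} else {0..T})" for k :: int
  have "\<exists>B e. e > 0 \<and> (\<forall>t y. t \<in> K k \<longrightarrow> 0 < y \<longrightarrow> y < e \<longrightarrow> norm (hecke_P k (Complex (1 + y) t)) \<le> B)" for k
  proof -
    have "compact (K k)" by (simp add: K_def)
    moreover have "k \<noteq> 0 \<or> t \<noteq> 0" if "t \<in> K k" for t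
    proof (cases "k = 0")
      case True
      then have "t \<ge> T * \<delta>" using that by (simp add: K_def)
      moreover have "T * \<delta> > 0" using T \<delta> by simp
      ultimately show ?thesis by linarith
    qed simp
    ultimately obtain B e where "e > 0" "\<And>t y. t \<in> K k \<Longrightarrow> 0 < y \<Longrightarrow> y < e \<Longrightarrow> norm (hecke_P k (Complex (1 + y) t)) \<le> B"
      using hecke_P_bounded_compact[of "K k" k] by metis
    then show ?thesis by blast
  qed
  then obtain B e where Be: "\<And>k. e k > 0"
    "\<And>k t y. t \<in> K k \<Longrightarrow> 0 < y \<Longrightarrow> y < e k \<Longrightarrow> norm (hecke_P k (Complex (1 + y) t)) \<le> B k" by metis
  obtain e1 where e1: "e1 > 0"
    "\<And>t y. 0 < y \<Longrightarrow> y < e1 \<Longrightarrow> \<bar>t\<bar> \<le> y \<Longrightarrow> norm (hecke_P 0 (Complex (1 + y) t)) \<ge> 1 / y"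
    using hecke_P_lower_bound by metis
  define M where "M = (\<Sum>k\<in>I. \<bar>D k\<bar> * (\<bar>B k\<bar> + 1)\<^sup>2)"
  have M: "\<bar>D k\<bar> * (\<bar>B k\<bar> + 1)\<^sup>2 \<le> M" if "k \<in> I" for k
    unfolding M_def using that I by (intro member_le_sum) auto
  have M0: "M \<ge> 0" unfolding M_def by (intro sum_nonneg) auto
  define c where "c = a 0 0 / 2"
  \<comment> \<open>For y < R the pole term c / (4 y T) exceeds the total loss
    \<open>M * card I\<close>.\<close>
  define R where "R = c / (4 * T * (M * real (card I) + 1))"
  have c0: "c > 0" using a0 by (simp add: c_def)
  have den: "M * real (card I) + 1 > 0" using M0 by (simp add: add_nonneg_pos)
  have R0: "R > 0" unfolding R_def using c0 T den by simp
  define y where "y = Min (insert e1 (insert (1/2) (insert (T * \<delta>) (insert R (e ` I))))) / 2"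
  let ?S0 = "insert e1 (insert (1/2) (insert (T * \<delta>) (insert R (e ` I))))"
  have fin: "finite ?S0" using I by simp
  have Mp: "Min ?S0 > 0" using fin Be(1) e1(1) R0 T \<delta>(1) by (subst Min_gr_iff) auto
  have yl: "y < r" if "r \<in> ?S0" for r
  proof -
    have "Min ?S0 \<le> r" by (rule Min_le[OF fin that])
    then show ?thesis unfolding y_def using Mp by linarith
  qed
  have y: "y > 0" "y < e1" "y < 1/2" "y < T * \<delta>" "y < R" "\<And>k. k \<in> I \<Longrightarrow> y < e k"
    using Mp by (simp add: y_def) (rule yl, simp)+
  obtain X where X: "finite X" "X \<subseteq> {p. gauss_prime p}"
    "\<And>k t. norm (hecke_P k (Complex (1 + y) t) - (\<Sum>p\<in>X. of_real (lnorm p) * hecke k (Complex (1 + y) t) p)) \<le> 1"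
    using hecke_P_finite_approx[OF y(1)] by metis
  define W where "W p = lnorm p * exp (-((1 + y) * lnorm p))" for p
  have W0: "W p \<ge> 0" if "p \<in> X" for p using that X gauss_primeD[of p] lnorm_nonneg[of p] by (auto simp: W_def)
  define S where "S k x = (\<Sum>p\<in>X. of_real (W p) * hecke k (Complex 0 (T * x)) p)" for k x
  have S_eq: "S k x = (\<Sum>p\<in>X. of_real (lnorm p) * hecke k (Complex (1 + y) (T * x)) p)" for k x
    unfolding S_def W_def by (intro sum.cong refl) (subst hecke_shift[of k "1 + y"], simp)
  have SP: "norm (hecke_P k (Complex (1 + y) (T * x)) - S k x) \<le> 1" for k x
    unfolding S_eq by (rule X(3))
  define f where "f k x = b k x * (norm (S k x))\<^sup>2" for k x
  have fc: "continuous_on A (f k)" for k A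
    unfolding f_def[abs_def] S_def[abs_def] by (intro continuous_intros bc)
  have up: "\<bar>f k x\<bar> \<le> M" if k: "k \<in> I" and x: "x \<in> {0..1}" and tx: "T * x \<in> K k" for k x
  proof -
    have "norm (hecke_P k (Complex (1 + y) (T * x))) \<le> B k" using Be(2)[OF tx y(1) y(6)[OF k]] .
    moreover have "norm (S k x) \<le> norm (hecke_P k (Complex (1 + y) (T * x))) + 1"
      using SP[of k x] norm_triangle_sub[of "S k x" "hecke_P k (Complex (1 + y) (T * x))"]
      by (simp add: norm_minus_commute)
    ultimately have "norm (S k x) \<le> \<bar>B k\<bar> + 1" by linarith
    then have "(norm (S k x))\<^sup>2 \<le> (\<bar>B k\<bar> + 1)\<^sup>2" by (intro power_mono) auto
    moreover have "\<bar>b k x\<bar> \<le> \<bar>D k\<bar>" using D[OF x, of k] by linarith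
    ultimately have "\<bar>f k x\<bar> \<le> \<bar>D k\<bar> * (\<bar>B k\<bar> + 1)\<^sup>2" unfolding f_def abs_mult by (intro mult_mono) auto
    then show ?thesis using M[OF k] by linarith
  qed
  have ik: "integral {0..1} (f k) \<ge> - M" if k: "k \<in> I - {0}" for k
  proof -
    have "f k x \<ge> -M" if "x \<in> {0..1}" for x
    proof -
      have "T * x \<in> K k" using that k T by (auto simp: K_def mult_left_le)
      then show ?thesis using up[of k x] k that by auto
    qed
    then show ?thesis using integral_ge_const[OF fc, of 0 1 "-M" k] by simp
  qed
  \<comment> \<open>On [0, h] the point t = T x satisfies t \<le> y. There the truncated sum is at
    least 1/y - 1 \<ge> 1/(2y), and its square over the length y / T yields c / (4 y T).\<close>
  define h where "h = y / T"
  have h: "h > 0" "h < \<delta>" using y(1,4) T by (auto simp: h_def field_simps)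
  have i0: "integral {0..1} (f 0) \<ge> c / (4 * y * T) - M"
  proof -
    have "integral {0..1} (f 0) = integral {0..h} (f 0) + integral {h..1} (f 0)"
      using h \<delta>(2) by (intro Henstock_Kurzweil_Integration.integral_combine[symmetric] integrable_continuous_real fc) auto
    moreover have "integral {0..h} (f 0) \<ge> c * (1 / (2 * y))\<^sup>2 * (h - 0)"
    proof (rule integral_ge_const[OF fc])
      fix x assume x: "x \<in> {0..h}"
      have "T * x \<le> y" using x T by (auto simp: h_def field_simps)
      then have "norm (hecke_P 0 (Complex (1 + y) (T * x))) \<ge> 1 / y"
        using x T y by (intro e1(2)) (auto simp: abs_mult)
      moreover have "norm (hecke_P 0 (Complex (1 + y) (T * x))) \<le> norm (S 0 x) + 1"
        using SP[of 0 x] norm_triangle_sub[of "hecke_P 0 (Complex (1 + y) (T * x))" "S 0 x"] by linarith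
      moreover have "1 / y = 2 * (1 / (2 * y))" by simp
      moreover have "1 / (2 * y) \<ge> 1" using y by (simp add: field_simps)
      ultimately have "norm (S 0 x) \<ge> 1 / (2 * y)" by linarith
      then have "(norm (S 0 x))\<^sup>2 \<ge> (1 / (2 * y))\<^sup>2" using y by (intro power_mono) auto
      moreover have "b 0 x \<ge> c" unfolding c_def using \<delta>(3)[of x] x h by auto
      ultimately show "f 0 x \<ge> c * (1 / (2 * y))\<^sup>2" unfolding f_def using c0 by (intro mult_mono) auto
    qed (use h in auto)
    moreover have "c * (1 / (2 * y))\<^sup>2 * (h - 0) = c / (4 * y * T)"
      using y(1) T by (simp add: h_def power2_eq_square field_simps)
    moreover have "integral {h..1} (f 0) \<ge> - M * (1 - h)"
    proof (rule integral_ge_const[OF fc])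
      fix x assume x: "x \<in> {h..1}"
      show "f 0 x \<ge> - M"
      proof (cases "x \<le> \<delta>")
        case True
        then have "b 0 x \<ge> 0" using \<delta>(3)[of x] x h a0 by auto
        then have "f 0 x \<ge> 0" by (simp add: f_def)
        then show ?thesis using M0 by linarith
      next
        case False
        then have "T * x \<in> K 0" using x T by (auto simp: K_def)
        then show ?thesis using up[of 0 x] I x h by auto
      qed
    qed (use h \<delta> in auto)
    moreover have "- M * (1 - h) \<ge> - M" using M0 h by (simp add: algebra_simps)
    ultimately show ?thesis by linarith
  qed
  have "(\<Sum>k\<in>I. integral {0..1} (f k)) = integral {0..1} (f 0) + (\<Sum>k\<in>I - {0}. integral {0..1} (f k))"
    using I by (simp add: sum.remove)
  also have "\<dots> \<ge> (c / (4 * y * T) - M) + (\<Sum>k\<in>I - {0}. - M)"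
    by (intro add_mono i0 sum_mono ik)
  finally have "(\<Sum>k\<in>I. integral {0..1} (f k)) \<ge> (c / (4 * y * T) - M) + (\<Sum>k\<in>I - {0}. - M)" .
  moreover have "(\<Sum>k\<in>I. - M) = - M + (\<Sum>k\<in>I - {0}. - M)" by (rule sum.remove[OF I])
  moreover have "(\<Sum>k\<in>I. - M) = - (M * real (card I))" by simp
  ultimately have ge: "(\<Sum>k\<in>I. integral {0..1} (f k)) \<ge> c / (4 * y * T) - M * real (card I)" by linarith
  have "y * (4 * T * (M * real (card I) + 1)) < c"
    using y(5) T den unfolding R_def by (simp add: pos_less_divide_eq)
  then have "(M * real (card I) + 1) * (4 * y * T) < c" by (simp add: mult_ac)
  then have "M * real (card I) + 1 < c / (4 * y * T)" using y(1) T by (simp add: pos_less_divide_eq)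
  then have pos: "(\<Sum>k\<in>I. integral {0..1} (f k)) > 0" using ge by linarith
  have "(\<Sum>k\<in>I. integral {0..1} (f k)) =
     (\<Sum>k\<in>I. \<Sum>p\<in>X. \<Sum>q\<in>X. W p * W q * integral {0..1} (\<lambda>x. a k x * Re (hecke k (Complex 0 (T * x)) (p / (q * z0)))))"
    unfolding f_def[abs_def] S_def b_def by (intro sum.cong refl pair_sum_eq[symmetric] X(1,2) z0 a)
  also have "\<dots> = (\<Sum>p\<in>X. \<Sum>q\<in>X. W p * W q *
      (\<Sum>k\<in>I. integral {0..1} (\<lambda>x. a k x * Re (hecke k (Complex 0 (T * x)) (p / (q * z0))))))"
    by (subst sum.swap, intro sum.cong refl, subst sum.swap) (simp add: sum_distrib_left)
  also have "\<dots> \<le> 0"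
  proof (intro sum_nonpos)
    fix p q assume pq: "p \<in> X" "q \<in> X"
    have "(\<Sum>k\<in>I. integral {0..1} (\<lambda>x. a k x * Re (hecke k (Complex 0 (T * x)) (p / (q * z0))))) \<le> 0"
      using contr that[of p q] pq X(2) unfolding I_def by force
    then show "W p * W q * (\<Sum>k\<in>I. integral {0..1} (\<lambda>x. a k x * Re (hecke k (Complex 0 (T * x)) (p / (q * z0))))) \<le> 0"
      using W0[OF pq(1)] W0[OF pq(2)] by (intro mult_nonneg_nonpos) auto
  qed
  finally show False using pos by simp
qed

section \<open>From kernel positivity to approximation by quotients of primes\<close>

lemma near_gauss_unit:
  assumes "norm v = 1" "norm (v ^ 4 - 1) \<le> e ^ 4" "e \<ge> 0"
  obtains u where "gauss_unit u" "norm (v - u) \<le> e"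
proof (rule ccontr)
  assume "\<not> thesis"
  then have gt: "norm (v - u) > e" if "gauss_unit u" for u using that \<open>\<And>u. gauss_unit u \<Longrightarrow> norm (v - u) \<le> e \<Longrightarrow> thesis\<close> by force
  \<comment> \<open>The units are the roots of X^4 - 1, so distance more than \<open>e\<close> from
    all four would make the product exceed e^4.\<close>
  have "v ^ 4 - 1 = (v - 1) * (v - (-1)) * ((v - \<i>) * (v - (-\<i>)))"
    by (simp add: power4_eq_xxxx algebra_simps)
  then have "norm (v ^ 4 - 1) = norm (v - 1) * norm (v - (-1)) * (norm (v - \<i>) * norm (v - (-\<i>)))"
    by (simp only: norm_mult)
  also have "\<dots> > e * e * (e * e)"
    using assms(3) gt[of 1] gt[of "-1"] gt[of "\<i>"] gt[of "-\<i>"]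
    by (intro mult_strict_mono' mult_nonneg_nonneg) (auto simp: gauss_unit_iff)
  finally show False using assms(2) by (simp add: power4_eq_xxxx mult.assoc)
qed

lemma prime_quotient_near:
  assumes z0: "z0 \<noteq> 0" and \<epsilon>: "\<epsilon> > 0"
  obtains p q where "gauss_prime p" "gauss_prime q" "norm (p / q - z0) < \<epsilon>"
proof -
  \<comment> \<open>The final error is at most 4 \<eta> |z0|: up to 3 \<eta> from the modulus and
    \<eta> from the direction. The 8 makes the inequality strict.\<close>
  define \<eta> where "\<eta> = min 1 (\<epsilon> / (8 * norm z0))"
  have \<eta>: "\<eta> > 0" "\<eta> \<le> 1" "8 * norm z0 * \<eta> \<le> \<epsilon>"
    using z0 \<epsilon> by (auto simp: \<eta>_def min_def field_simps)
  \<comment> \<open>Since \<open>lnorm\<close> is twice the logarithm of the modulus, |T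
    \<open>lnorm r\<close>| < 2 pi says |ln |r|| < \<eta>.\<close>
  define T where "T = pi / \<eta>"
  have T: "T > 0" using \<eta> by (simp add: T_def)
  \<comment> \<open>With |w - 1|^2 = 2 (1 - Re w), the kernel condition becomes |w - 1| < \<eta>^4,
    the input of \<open>near_gauss_unit\<close>.\<close>
  define C where "C = 8 * pi\<^sup>2 / \<eta> ^ 8"
  have C: "C > 0" using \<eta> by (simp add: C_def)
  obtain N :: nat and a :: "int \<Rightarrow> real \<Rightarrow> real" where a: "\<And>k A. continuous_on A (a k)" "a 0 0 > 0"
    "\<And>w u. norm w = 1 \<Longrightarrow>
       0 < (\<Sum>k\<in>{-int N..int N}. integral {0..1} (\<lambda>x. a k x * Re (w powi k * exp (-(\<i> * of_real (x * u))))))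
       \<Longrightarrow> \<bar>u\<bar> < 2 * pi \<and> C * (1 - Re w) < 4 * pi\<^sup>2"
    by (rule kernel_minorant[OF C]) (rule that, assumption+)
  obtain p q where pq: "gauss_prime p" "gauss_prime q"
    "0 < (\<Sum>k\<in>{-int N..int N}. integral {0..1} (\<lambda>x. a k x * Re (hecke k (Complex 0 (T * x)) (p / (q * z0)))))"
    by (rule ex_prime_pair_kernel_pos[where a = a and N = N, OF z0 T a(1,2)]) (rule that, assumption+)
  define r where "r = p / (q * z0)"
  have nz: "p \<noteq> 0" "q \<noteq> 0" using pq gauss_primeD by auto
  have r0: "r \<noteq> 0" using nz z0 by (simp add: r_def)
  \<comment> \<open>The characters see the direction only through its fourth power; this is where
    the ambiguity by a unit enters.\<close>
  define w where "w = sgn r ^ 4"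
  have sr: "norm (sgn r) = 1" using r0 by (simp add: norm_sgn)
  have w1: "norm w = 1" by (simp add: w_def norm_power sr)
  have "hecke k (Complex 0 (T * x)) r = w powi k * exp (-(\<i> * of_real (x * (T * lnorm r))))" for k x
  proof -
    have "Complex 0 (T * x) * of_real (lnorm r) = \<i> * of_real (x * (T * lnorm r))" by (simp add: complex_eq_iff)
    moreover have "sgn r powi (4 * k) = w powi k" unfolding w_def power_int_mult by simp
    ultimately show ?thesis unfolding hecke_def by (simp only:)
  qed
  then have "\<bar>T * lnorm r\<bar> < 2 * pi \<and> C * (1 - Re w) < 4 * pi\<^sup>2"
    using a(3)[OF w1, of "T * lnorm r"] pq(3) unfolding r_def[symmetric] by simp
  then have u: "T * \<bar>lnorm r\<bar> < 2 * pi" and Rw: "C * (1 - Re w) < 4 * pi\<^sup>2" using T by (auto simp: abs_mult)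
  have "pi * \<bar>lnorm r\<bar> < pi * (2 * \<eta>)" using u \<eta>(1) by (simp add: T_def field_simps)
  then have ln: "\<bar>ln (norm r)\<bar> < \<eta>" by (simp add: lnorm_def abs_mult)
  have nr: "\<bar>norm r - 1\<bar> \<le> 3 * \<eta>"
  proof -
    have "norm (exp (of_real (ln (norm r))) - 1 :: complex) \<le> norm (of_real (ln (norm r)) :: complex) * exp (norm (of_real (ln (norm r)) :: complex))"
      by (rule norm_exp_minus_1_le)
    moreover have "exp (of_real (ln (norm r))) - 1 = (of_real (norm r - 1) :: complex)"
      using r0 by (simp add: exp_of_real)
    ultimately have "\<bar>norm r - 1\<bar> \<le> \<bar>ln (norm r)\<bar> * exp \<bar>ln (norm r)\<bar>" by (simp only: norm_of_real)
    also have "\<dots> \<le> \<eta> * exp 1" using ln \<eta> by (intro mult_mono) auto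
    also have "\<dots> \<le> \<eta> * 3" using exp_le \<eta> by (intro mult_left_mono) auto
    finally show ?thesis by simp
  qed
  have "(Re w)\<^sup>2 + (Im w)\<^sup>2 = 1" using w1 cmod_power2[of w] by simp
  then have nw: "(norm (w - 1))\<^sup>2 = 2 * (1 - Re w)"
    unfolding cmod_power2 by (simp add: power2_eq_square algebra_simps)
  have "8 * pi\<^sup>2 * (1 - Re w) < 4 * pi\<^sup>2 * \<eta> ^ 8"
    using Rw \<eta>(1) by (simp add: C_def field_simps)
  then have "pi\<^sup>2 * (2 * (1 - Re w)) < pi\<^sup>2 * \<eta> ^ 8" by simp
  then have "2 * (1 - Re w) < \<eta> ^ 8" by (subst (asm) mult_less_cancel_left_pos) auto
  also have "\<eta> ^ 8 = (\<eta> ^ 4)\<^sup>2" by (simp add: power_mult[symmetric])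
  finally have "(norm (w - 1))\<^sup>2 \<le> (\<eta> ^ 4)\<^sup>2" unfolding nw by (rule less_imp_le)
  then have "norm (w - 1) \<le> \<eta> ^ 4" by (rule power2_le_imp_le) (use \<eta> in simp)
  then obtain v where v: "gauss_unit v" "norm (sgn r - v) \<le> \<eta>"
    using near_gauss_unit[OF sr, of \<eta>] \<eta>(1) unfolding w_def by (metis less_imp_le)
  have v1: "norm v = 1" "v \<noteq> 0" using norm_gauss_unit[OF v(1)] by auto
  have "r - v = of_real (norm r - 1) * sgn r + (sgn r - v)"
    using r0 by (simp add: sgn_eq field_simps)
  then have "norm (r - v) \<le> norm (of_real (norm r - 1) * sgn r) + norm (sgn r - v)" by (metis norm_triangle_ineq)
  also have "\<dots> \<le> 3 * \<eta> + \<eta>" using nr v(2) by (intro add_mono) (simp_all only: norm_mult norm_of_real sr, simp)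
  finally have rv: "norm (r - v) \<le> 4 * \<eta>" by simp
  \<comment> \<open>The inverse unit, moved onto the prime in the numerator, which removes the
    ambiguity.\<close>
  define v' where "v' = cnj v"
  have v': "gauss_unit v'" using v(1) by (auto simp: gauss_unit_iff v'_def)
  have vv: "v * v' = 1" using v1 by (simp add: v'_def complex_norm_square[symmetric])
  have v'1: "norm v' = 1" using norm_gauss_unit[OF v'] .
  have "v' * p / q - z0 = z0 * v' * (r - v)"
  proof -
    have "z0 * v' * (r - v) = z0 * v' * r - z0 * (v * v')" by (simp add: algebra_simps)
    also have "\<dots> = v' * p / q - z0" unfolding vv r_def using z0 nz by simp
    finally show ?thesis by simp
  qed
  then have "norm (v' * p / q - z0) = norm z0 * norm (r - v)" by (simp add: norm_mult v'1)
  also have "\<dots> \<le> norm z0 * (4 * \<eta>)" by (intro mult_left_mono rv) simp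
  also have "\<dots> < \<epsilon>"
  proof -
    have "norm z0 * \<eta> > 0" using z0 \<eta> by simp
    then show ?thesis using \<eta>(3) by linarith
  qed
  finally show ?thesis using that[OF gauss_prime_unit_mult[OF v' pq(1)] pq(2)] by simp
qed

theorem mainTheorem1:
  shows "closure {g1 / g2 | g1 g2. gauss_prime g1 \<and> gauss_prime g2} = UNIV"
proof -
  let ?S = "{g1 / g2 | g1 g2. gauss_prime g1 \<and> gauss_prime g2}"
  have "z \<in> closure ?S" for z
    unfolding closure_approachable
  proof (intro allI impI)
    fix e :: real assume e: "e > 0"
    \<comment> \<open>Rescaling by the target requires it to be nonzero, so 0 is replaced by a
      nearby point at the cost of half the tolerance.\<close>
    define z' where "z' = (if z = 0 then of_real (e / 2) else z)"
    have z': "z' \<noteq> 0" "norm (z' - z) \<le> e / 2" using e by (auto simp: z'_def)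
    obtain p q where pq: "gauss_prime p" "gauss_prime q" "norm (p / q - z') < e / 2"
      using prime_quotient_near[OF z'(1), of "e / 2"] e by auto
    have "norm (p / q - z) \<le> norm (p / q - z') + norm (z' - z)"
      using norm_triangle_ineq[of "p / q - z'" "z' - z"] by simp
    then have "dist (p / q) z < e" using pq(3) z'(2) by (simp add: dist_norm)
    then show "\<exists>y\<in>?S. dist y z < e" using pq(1,2) by blast
  qed
  then show ?thesis by blast
qed

end
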